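(* Let $R$ be a ring, let $G$ be a graph with $n$ vertices and $m$ edges, and let $k\ge1$. Let $I$ be any RCSP instance over $R$ with constraint graph $G$ and domain $[k]$. Then there is an algorithm that calculates the partition function $Z_I$ in polynomial space and with $O^\star(k^{19m/100})$ ring operations.
   Context: An RCSP (Ring CSP) instance $I$ over a ring $R$ with constraint graph $G=(V,E)$ and domain $[k]=\{0,\dots,k-1\}$ consists of ring elements $r_\emptyset$, $r_v(i)$ for each $v\in V$, $i\in[k]$, and $r_{xy}(i,j)$ for each edge $xy\in E$ and $i,j\in[k]$ (with $r_{xy}(i,j)$ and $r_{yx}(j,i)$ denoting the same element). The score of an assignment $\sigma:V\to[k]$ is $I(\sigma)=r_\emptyset\prod_{v\in V}r_v(\sigma(v))\prod_{xy\in E}r_{xy}(\sigma(x),\sigma(y))$, and the partition function is $Z_I=\sum_{\sigma:V\to[k]}I(\sigma)$. Ring operations are additions and multiplications in $R$. The notation $O^\star(\cdot)$ hides factors polynomial in the input parameters (e.g. $n$, $m$). *)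

theory Defs
  imports Complex_Main "HOL-Library.FuncSet"
begin

section \<open>RCSP instances\<close>

text \<open>The constraint graph is a finite simple graph on the vertex set \<open>{..<nverts I}\<close>, its edges
  being two-element sets. The domain is \<open>{..<dom_size I}\<close>. The function \<open>edge_score\<close> takes an
  ordered pair of adjacent vertices; \<open>valid_rcsp\<close> demands that both orientations name the same
  ring element.\<close>

record 'a rcsp =
  nverts :: nat
  edges :: "nat set set"
  dom_size :: nat
  const_score :: 'a
  vertex_score :: "nat \<Rightarrow> nat \<Rightarrow> 'a"
  edge_score :: "nat \<Rightarrow> nat \<Rightarrow> nat \<Rightarrow> nat \<Rightarrow> 'a"

definition valid_rcsp :: "'a rcsp \<Rightarrow> bool" where
  "valid_rcsp I \<longleftrightarrow>
     (\<forall>e\<in>edges I. \<exists>x<nverts I. \<exists>y<nverts I. x \<noteq> y \<and> e = {x, y}) \<and>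
     dom_size I \<ge> 1 \<and>
     (\<forall>x y. {x, y} \<in> edges I \<longrightarrow>
        (\<forall>i<dom_size I. \<forall>j<dom_size I. edge_score I x y i j = edge_score I y x j i))"

definition score :: "'a::comm_ring_1 rcsp \<Rightarrow> (nat \<Rightarrow> nat) \<Rightarrow> 'a" where
  "score I \<sigma> = const_score I * (\<Prod>v<nverts I. vertex_score I v (\<sigma> v)) *
     (\<Prod>(x, y)\<in>{(x, y). x < y \<and> {x, y} \<in> edges I}. edge_score I x y (\<sigma> x) (\<sigma> y))"

definition partition_function :: "'a::comm_ring_1 rcsp \<Rightarrow> 'a" where
  "partition_function I = (\<Sum>\<sigma>\<in>{..<nverts I} \<rightarrow>\<^sub>E {..<dom_size I}. score I \<sigma>)"


section \<open>The model of computation\<close>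

text \<open>Algorithms are programs of a WHILE language over binary trees (in the style of N. D. Jones)
  whose leaves are \<open>Null\<close> or ring elements. A ring element occupies one unit of space and is
  opaque: it can be copied, added and multiplied, but never tested or compared. Program texts do
  not contain ring elements, and a single program has to treat inputs of all sizes.\<close>

datatype 'a val = Null | Atom 'a | Pair "'a val" "'a val"

datatype instr =
    SetNull nat
  | Copy nat nat
  | MkPair nat nat nat
  | First nat nat
  | Second nat nat
  | SetZero nat
  | SetOne nat
  | Add nat nat nat
  | Mult nat nat nat

datatype com =
    Do instr
  | Seq com com
  | If nat com com
  | While nat com

type_synonym 'a store = "nat \<Rightarrow> 'a val"

fun first :: "'a val \<Rightarrow> 'a val" where
  "first (Pair a b) = a"
| "first _ = Null"

fun second :: "'a val \<Rightarrow> 'a val" where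
  "second (Pair a b) = b"
| "second _ = Null"

fun lift_op :: "('a \<Rightarrow> 'a \<Rightarrow> 'a) \<Rightarrow> 'a val \<Rightarrow> 'a val \<Rightarrow> 'a val" where
  "lift_op f (Atom a) (Atom b) = Atom (f a b)"
| "lift_op f _ _ = Null"

fun step :: "instr \<Rightarrow> 'a::comm_ring_1 store \<Rightarrow> 'a store" where
  "step (SetNull x) s = s(x := Null)"
| "step (Copy x y) s = s(x := s y)"
| "step (MkPair x y z) s = s(x := Pair (s y) (s z))"
| "step (First x y) s = s(x := first (s y))"
| "step (Second x y) s = s(x := second (s y))"
| "step (SetZero x) s = s(x := Atom 0)"
| "step (SetOne x) s = s(x := Atom 1)"
| "step (Add x y z) s = s(x := lift_op (+) (s y) (s z))"
| "step (Mult x y z) s = s(x := lift_op (*) (s y) (s z))"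

fun ring_ops :: "instr \<Rightarrow> nat" where
  "ring_ops (Add x y z) = 1"
| "ring_ops (Mult x y z) = 1"
| "ring_ops _ = 0"

fun val_size :: "'a val \<Rightarrow> nat" where
  "val_size Null = 1"
| "val_size (Atom a) = 1"
| "val_size (Pair a b) = 1 + val_size a + val_size b"

text \<open>The sum ranges over a finite set for every store that arises from \<open>init_store\<close>: a program
  mentions only finitely many variables. For the same reason, leaving out the variables with value
  \<open>Null\<close> changes the size by at most a constant.\<close>

definition store_size :: "'a store \<Rightarrow> nat" where
  "store_size s = (\<Sum>x | s x \<noteq> Null. val_size (s x))"

text \<open>\<open>exec c s r w t\<close>: started in store \<open>s\<close>, the program \<open>c\<close> terminates in store \<open>t\<close> after
  performing exactly \<open>r\<close> ring operations, and \<open>w\<close> is the maximal size of a store visited on the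
  way. Control and data movement contribute to space but not to \<open>r\<close>.\<close>

inductive exec :: "com \<Rightarrow> 'a::comm_ring_1 store \<Rightarrow> nat \<Rightarrow> nat \<Rightarrow> 'a store \<Rightarrow> bool" where
  Do: "exec (Do i) s (ring_ops i) (max (store_size s) (store_size (step i s))) (step i s)"
| Seq: "exec c1 s r1 w1 t \<Longrightarrow> exec c2 t r2 w2 u \<Longrightarrow> exec (Seq c1 c2) s (r1 + r2) (max w1 w2) u"
| IfTrue: "s x \<noteq> Null \<Longrightarrow> exec c1 s r w t \<Longrightarrow> exec (If x c1 c2) s r w t"
| IfFalse: "s x = Null \<Longrightarrow> exec c2 s r w t \<Longrightarrow> exec (If x c1 c2) s r w t"
| WhileTrue: "s x \<noteq> Null \<Longrightarrow> exec c s r1 w1 t \<Longrightarrow> exec (While x c) t r2 w2 u \<Longrightarrow>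
    exec (While x c) s (r1 + r2) (max w1 w2) u"
| WhileFalse: "s x = Null \<Longrightarrow> exec (While x c) s 0 (store_size s) s"

inductive_cases exec_DoE: "exec (Do i) s r w t"
inductive_cases exec_SeqE: "exec (Seq c1 c2) s r w t"
inductive_cases exec_IfE: "exec (If x c1 c2) s r w t"
inductive_cases exec_WhileE: "exec (While x c) s r w t"

lemma exec_deterministic:
  "exec c s r w t \<Longrightarrow> exec c s r' w' t' \<Longrightarrow> r' = r \<and> w' = w \<and> t' = t"
proof (induction arbitrary: r' w' t' rule: exec.induct)
  case (Do i s)
  from Do.prems show ?case by (rule exec_DoE) simp
next
  case (Seq c1 s r1 w1 t c2 r2 w2 u)
  from Seq.prems show ?case by (rule exec_SeqE) (metis Seq.IH)
next
  case (IfTrue s x c1 r w t c2)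
  from IfTrue.prems show ?case by (rule exec_IfE) (metis IfTrue.IH IfTrue.hyps(1))+
next
  case (IfFalse s x c2 r w t c1)
  from IfFalse.prems show ?case by (rule exec_IfE) (metis IfFalse.IH IfFalse.hyps(1))+
next
  case (WhileTrue s x c r1 w1 t r2 w2 u)
  from WhileTrue.prems show ?case
    by (rule exec_WhileE) (metis WhileTrue.IH WhileTrue.hyps(1))+
next
  case (WhileFalse s x c)
  from WhileFalse.prems show ?case by (rule exec_WhileE) (simp_all add: WhileFalse.hyps)
qed


section \<open>Input encoding\<close>

text \<open>Numbers are encoded in unary, so the encoding of an instance has size polynomial in the
  numbers of vertices and edges and the domain size.\<close>

fun enc_list :: "'a val list \<Rightarrow> 'a val" where
  "enc_list [] = Null"
| "enc_list (v # vs) = Pair v (enc_list vs)"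

definition enc_nat :: "nat \<Rightarrow> 'a val" where
  "enc_nat n = enc_list (replicate n Null)"

definition edge_list :: "'a rcsp \<Rightarrow> (nat \<times> nat) list" where
  "edge_list I = [(x, y). x \<leftarrow> [0..<nverts I], y \<leftarrow> [Suc x..<nverts I], {x, y} \<in> edges I]"

definition enc_vertex :: "'a rcsp \<Rightarrow> nat \<Rightarrow> 'a val" where
  "enc_vertex I v = enc_list [Atom (vertex_score I v i). i \<leftarrow> [0..<dom_size I]]"

definition enc_edge :: "'a rcsp \<Rightarrow> nat \<times> nat \<Rightarrow> 'a val" where
  "enc_edge I = (\<lambda>(x, y). enc_list [enc_nat x, enc_nat y,
     enc_list [enc_list [Atom (edge_score I x y i j). j \<leftarrow> [0..<dom_size I]].
       i \<leftarrow> [0..<dom_size I]]])"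

definition enc_rcsp :: "'a rcsp \<Rightarrow> 'a val" where
  "enc_rcsp I = enc_list
     [enc_nat (nverts I),
      enc_nat (dom_size I),
      Atom (const_score I),
      enc_list (map (enc_vertex I) [0..<nverts I]),
      enc_list (map (enc_edge I) (edge_list I))]"

definition init_store :: "'a val \<Rightarrow> 'a store" where
  "init_store v = (\<lambda>x. Null)(0 := v)"

end

(*
A state of the computation is a vertex set U with an adjacency relation and a dense table of binary
factors. A connected component is split off whenever possible, a vertex of degree 1 or 2 is summed
out into a factor on its neighbours at polynomial cost, and otherwise we branch on a vertex v of
maximal degree, choosing one with a neighbour of smaller degree if there is one.

Only the branchings cost a factor k. They are controlled by the measure that gives a vertex of degree
d the weight 0, 1/4, 3/8 or 19d/200 for d <= 2, d = 3, d = 4 or d >= 5. Each weight is at most 19d/200,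
so the initial measure is at most 19m/100. Branching lowers the measure by at least 1, except when
all degrees are 4 or all degrees are 5. Those regular graphs receive an additive bonus below 1. It is lost with
the first branching, and the vertices that have to disappear before a regular graph can arise again
pay for a new one. Only pointwise upper bounds on the degrees enter, so eliminations and splittings
need no separate analysis.

Control is free and only ring operations count, so the program may recompute all bookkeeping. It is
compiled from an expression language without general recursion, in which every expression
has polynomial cost, and one WHILE loop that runs a stack machine.
*)
theory Submission
  imports Defs
begin


section \<open>Compiling an expression language\<close>

text \<open>The weights make irregular branchings balance exactly. Write \<open>w3\<close>,
  \<open>w4\<close>, \<open>w5\<close> for the weights of degrees 3, 4, 5; branching gains the
  weight of \<open>v\<close> plus the drops of its neighbours. A cubic graph asks for 4 w3 = 1.
  Degree 4 with one neighbour of degree 3 asks for w4 + 3 (w4 - w3) + w3 = 1, so w4 = 3/8. Degree 5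
  with one neighbour of degree 4 asks for w5 + 4 (w5 - w4) + (w4 - w3) = 1, so w5 = 19/40. A
  5-regular graph has 5/2 edges per vertex, and w5 / (5/2) = 19/100 is the exponent of the theorem.
  For higher degrees the slope 19/200 suffices, as 12 * 19/200 > 1. The gain is only 7/8 in a
  4-regular and 39/40 in a 5-regular graph, and regularity may recur after later branchings, so a
  single allowance at the outset would not do; the bonus is an allowance that can be earned again.
  Two additive terms survive in the exponent: the initial bonus, at most 3/20, and 1 for a component
  that has shrunk to a single vertex, where branching costs a factor k at measure 0. They amount to
  k^(23/20), which is polynomial in the input because the domain is listed explicitly.\<close>

definition runs_within :: "com \<Rightarrow> 'a::comm_ring_1 store \<Rightarrow> nat \<Rightarrow> nat \<Rightarrow> 'a store \<Rightarrow> bool" where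
  "runs_within c s R W t \<longleftrightarrow> (\<exists>r w. exec c s r w t \<and> r \<le> R \<and> w \<le> W)"

lemma runs_within_Seq: "runs_within c1 s R1 W t \<Longrightarrow> runs_within c2 t R2 W u \<Longrightarrow> runs_within (Seq c1 c2) s (R1 + R2) W u"
  unfolding runs_within_def by (meson Seq add_mono max.boundedI)

lemma runs_within_Do: "store_size s \<le> W \<Longrightarrow> store_size (step i s) \<le> W \<Longrightarrow> runs_within (Do i) s (ring_ops i) W (step i s)"
  unfolding runs_within_def by (meson Do le_refl max.boundedI)

lemma runs_within_mono: "runs_within c s R W t \<Longrightarrow> R \<le> R' \<Longrightarrow> W \<le> W' \<Longrightarrow> runs_within c s R' W' t"
  unfolding runs_within_def by (meson le_trans)

lemma runs_within_If:
  "(s x \<noteq> Null \<Longrightarrow> runs_within c1 s R W t) \<Longrightarrow> (s x = Null \<Longrightarrow> runs_within c2 s R W t) \<Longrightarrow> runs_within (If x c1 c2) s R W t"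
  unfolding runs_within_def by (metis IfTrue IfFalse)

lemma runs_within_WhileTrue:
  "s x \<noteq> Null \<Longrightarrow> runs_within c s R1 W t \<Longrightarrow> runs_within (While x c) t R2 W u \<Longrightarrow> runs_within (While x c) s (R1 + R2) W u"
  unfolding runs_within_def by (meson WhileTrue add_mono max.boundedI)

lemma runs_within_WhileFalse: "s x = Null \<Longrightarrow> store_size s \<le> W \<Longrightarrow> runs_within (While x c) s 0 W s"
  unfolding runs_within_def by (meson WhileFalse le_refl)

fun block :: "instr list \<Rightarrow> com" where
  "block [] = Do (SetNull 4)"
| "block (i # is) = Seq (Do i) (block is)"

declare block.simps [simp del]

text \<open>Register 0 holds the value of the current expression, register 1 the environment and register 2 a
  stack of temporary values. Register 3 is scratch space and is \<open>Null\<close> between expressions; register 4 is always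
  \<open>Null\<close> and only serves to express the empty block.\<close>

definition st :: "'a val \<Rightarrow> 'a val \<Rightarrow> 'a val \<Rightarrow> 'a val \<Rightarrow> 'a store" where
  "st a e s b = (\<lambda>_. Null)(0 := a, 1 := e, 2 := s, 3 := b)"

lemma st_apply [simp]: "st a e s b 0 = a" "st a e s b (Suc 0) = e" "st a e s b 2 = s" "st a e s b 3 = b"
   "st a e s b 4 = Null"
  by (auto simp: st_def)

lemma st_upd [simp]: "(st a e s b)(0 := x) = st x e s b" "(st a e s b)(Suc 0 := x) = st a x s b"
   "(st a e s b)(2 := x) = st a e x b" "(st a e s b)(3 := x) = st a e s x" "(st a e s b)(4 := Null) = st a e s b"
  by (auto simp: st_def fun_eq_iff)

lemma val_size_pos [simp]: "0 < val_size v" "val_size v \<noteq> 0" "Suc 0 \<le> val_size v"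
  by (induction v) auto

lemma val_size_first: "val_size (first v) \<le> val_size v"
  by (cases v) auto

lemma val_size_second: "val_size (second v) \<le> val_size v"
  by (cases v) auto

lemma val_size_lift_op [simp]: "val_size (lift_op f v u) = 1"
  by (cases v; cases u) auto

lemma store_size_st: "store_size (st a e s b) \<le> val_size a + val_size e + val_size s + val_size b"
proof -
  have "store_size (st a e s b) \<le> (\<Sum>x\<in>{0,1,2,3}. val_size (st a e s b x))"
    unfolding store_size_def by (rule sum_mono2) (auto simp: st_def split: if_splits)
  then show ?thesis by (simp add: add.assoc)
qed

lemma store_size_st_le:
  "val_size a + val_size e + val_size s + val_size b \<le> W \<Longrightarrow> store_size (st a e s b) \<le> W"
  using store_size_st[of a e s b] by simp

fun fits :: "nat \<Rightarrow> instr list \<Rightarrow> 'a::comm_ring_1 store \<Rightarrow> bool" where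
  "fits W [] s \<longleftrightarrow> store_size s \<le> W"
| "fits W (i # is) s \<longleftrightarrow> store_size s \<le> W \<and> fits W is (step i s)"

lemma runs_within_block:
  assumes "fits W is s" "s 4 = Null" "fold step is s 4 = Null" "fold step is s = t" "sum_list (map ring_ops is) \<le> R"
  shows "runs_within (block is) s R W t"
proof -
  have "runs_within (block is) s (sum_list (map ring_ops is)) W (fold step is s)"
    using assms(1,3)
  proof (induction "is" arbitrary: s)
    case Nil
    then have "step (SetNull 4) s = s" by (auto simp: fun_eq_iff)
    with Nil runs_within_Do[of s W "SetNull 4"] show ?case by (simp add: block.simps)
  next
    case (Cons i "is")
    from Cons.prems have "store_size (step i s) \<le> W" by (cases "is") auto
    with Cons show ?case by (auto simp: block.simps intro!: runs_within_Seq runs_within_Do)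
  qed
  with assms show ?thesis by (metis runs_within_mono order_refl)
qed

section \<open>Expressions with loops over lists, and their semantics\<close>

datatype const = CNull | CZero | COne
datatype unop = UFirst | USecond
datatype binop = BPair | BAdd | BMult
datatype loopop = LAdd | LCons | LTail | LFilter | LTails
datatype expr = Var nat | Const const | Unary unop expr | Binary binop expr expr | Ite expr expr expr | LetIn expr expr | Loop loopop expr expr expr

fun constv :: "const \<Rightarrow> 'a::comm_ring_1 val" where
  "constv CNull = Null" | "constv CZero = Atom 0" | "constv COne = Atom 1"

fun unv :: "unop \<Rightarrow> 'a val \<Rightarrow> 'a val" where
  "unv UFirst v = first v" | "unv USecond v = second v"

fun binv :: "binop \<Rightarrow> 'a::comm_ring_1 val \<Rightarrow> 'a val \<Rightarrow> 'a val" where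
  "binv BPair u v = Pair u v" | "binv BAdd u v = lift_op (+) u v" | "binv BMult u v = lift_op (*) u v"

fun loopv :: "loopop \<Rightarrow> 'a::comm_ring_1 val \<Rightarrow> 'a val \<Rightarrow> 'a val \<Rightarrow> 'a val" where
  "loopv LAdd x v a = lift_op (+) v a"
| "loopv LCons x v a = Pair v a"
| "loopv LTail x v a = second a"
| "loopv LFilter x v a = (if v = Null then a else Pair x a)"
| "loopv LTails x v a = Pair x a"

text \<open>A WHILE loop tests only for \<open>Null\<close>, so an atom in the place of a list
  causes one pass, with the item \<open>first (Atom a) = Null\<close>. Reading an atom as
  \<open>[Null]\<close> keeps evaluation total and in agreement with the compiled code on ill-formed
  values.\<close>

fun to_list :: "'a val \<Rightarrow> 'a val list" where
  "to_list Null = []" | "to_list (Pair a b) = a # to_list b" | "to_list (Atom a) = [Null]"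

text \<open>\<open>LTails\<close> runs through the proper tails of a list instead of its elements. Applied to a unary number
  this yields all smaller numbers, which no other operation can produce from a single number.\<close>

fun item_of :: "loopop \<Rightarrow> 'a val \<Rightarrow> 'a val" where
  "item_of LTails v = second v"
| "item_of _ v = first v"

fun items :: "loopop \<Rightarrow> 'a val \<Rightarrow> 'a val list" where
  "items f Null = []"
| "items f (Pair a b) = item_of f (Pair a b) # items f b"
| "items f (Atom a) = [Null]"

lemma val_size_item_of: "val_size (item_of f v) \<le> val_size v"
  by (cases f) (auto simp: val_size_first val_size_second)

lemma item_of_Atom: "item_of f (Atom a) = Null"
  by (cases f) auto

lemma items_to_list: "f \<noteq> LTails \<Longrightarrow> items f v = to_list v"
  by (induction v; cases f) auto

text \<open>The body of a loop is evaluated in \<open>x # env\<close> and never sees the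
  accumulator, which changes only through \<open>loopv\<close> and therefore grows additively. A
  body able to read it could double it in every pass, and polynomial bounds would fail.\<close>

primrec eval :: "expr \<Rightarrow> 'a::comm_ring_1 val list \<Rightarrow> 'a val" where
  "eval (Var i) env = (if i < length env then env ! i else Null)"
| "eval (Const c) env = constv c"
| "eval (Unary f e) env = unv f (eval e env)"
| "eval (Binary f a b) env = binv f (eval a env) (eval b env)"
| "eval (Ite c a b) env = (if eval c env \<noteq> Null then eval a env else eval b env)"
| "eval (LetIn a b) env = eval b (eval a env # env)"
| "eval (Loop f i l b) env = foldl (\<lambda>a x. loopv f x (eval b (x # env)) a) (eval i env) (items f (eval l env))"

abbreviation esz :: "'a val list \<Rightarrow> nat" where "esz env \<equiv> val_size (enc_list env)"

text \<open>A common upper bound for the number of ring operations, the additional space and the size of the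
  result.\<close>

primrec cost :: "expr \<Rightarrow> 'a::comm_ring_1 val list \<Rightarrow> nat" where
  "cost (Var i) env = 10 + esz env"
| "cost (Const c) env = 10"
| "cost (Unary f e) env = 10 + 2 * cost e env"
| "cost (Binary f a b) env = 10 + 2 * cost a env + 2 * cost b env"
| "cost (Ite c a b) env = 10 + 2 * cost c env + cost a env + cost b env"
| "cost (LetIn a b) env = 10 + 2 * cost a env + cost b (eval a env # env)"
| "cost (Loop f i l b) env = 20 + 4 * cost i env + 6 * cost l env + 
     (\<Sum>x\<leftarrow>items f (eval l env). 10 + 4 * cost b (x # env) + 3 * val_size x)"

section \<open>Translation into WHILE programs\<close>

fun binstr :: "binop \<Rightarrow> instr" where
  "binstr BPair = MkPair 0 3 0" | "binstr BAdd = Add 0 3 0" | "binstr BMult = Mult 0 3 0"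

text \<open>On entry the value of the body is in register 0, the accumulator in register 3, and the
  current item is the head of the environment in register 1.\<close>

fun lcode :: "loopop \<Rightarrow> com" where
  "lcode LAdd = block [Add 0 0 3]"
| "lcode LCons = block [MkPair 0 0 3]"
| "lcode LTail = block [Second 0 3]"
| "lcode LTails = block [First 0 1, MkPair 0 0 3]"
| "lcode LFilter = If 0 (block [First 0 1, MkPair 0 0 3]) (block [Copy 0 3])"

text \<open>Calling convention: code for an expression starts with registers 0 and 3
  \<open>Null\<close> and returns registers 1 and 2 as it found them, hence the
  \<open>SetNull 0\<close> before every further subexpression. During a loop the remaining list lies
  on the stack, and a copy in register 3 is the guard.\<close>

primrec compile :: "expr \<Rightarrow> com" where
  "compile (Var i) = block (Copy 0 1 # replicate i (Second 0 0) @ [First 0 0])"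
| "compile (Const c) = (case c of CNull \<Rightarrow> block [] | CZero \<Rightarrow> block [SetZero 0] | COne \<Rightarrow> block [SetOne 0])"
| "compile (Unary f e) = Seq (compile e) (block [case f of UFirst \<Rightarrow> First 0 0 | USecond \<Rightarrow> Second 0 0])"
| "compile (Binary f a b) = Seq (compile a) (Seq (block [MkPair 2 0 2, SetNull 0]) (Seq (compile b)
     (block [First 3 2, Second 2 2, binstr f, SetNull 3])))"
| "compile (Ite c a b) = Seq (compile c) (Seq (block [Copy 3 0, SetNull 0])
     (If 3 (Seq (block [SetNull 3]) (compile a)) (compile b)))"
| "compile (LetIn a b) = Seq (compile a) (Seq (block [MkPair 1 0 1, SetNull 0]) (Seq (compile b)
     (block [Second 1 1])))"
| "compile (Loop f i l b) = Seq (compile l) (Seq (block [MkPair 2 0 2, SetNull 0]) (Seq (compile i)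
     (Seq (block [First 3 2])
     (Seq (While 3 (Seq (block [MkPair 2 0 2, SetNull 0, if f = LTails then Second 3 3 else First 3 3, MkPair 1 3 1, SetNull 3])
        (Seq (compile b) (Seq (block [First 3 2]) (Seq (lcode f) 
         (block [Second 1 1, Second 2 2, First 3 2, Second 3 3, Second 2 2, MkPair 2 3 2, First 3 2]))))))
      (block [Second 2 2])))))"

lemma val_size_constv [simp]: "val_size (constv c) = 1" by (cases c) auto

lemma val_size_unv: "val_size (unv f v) \<le> val_size v"
  by (cases f) (auto simp: val_size_first val_size_second)

lemma val_size_binv: "val_size (binv f u v) \<le> Suc (val_size u + val_size v)"
  by (cases f) auto

lemma val_size_loopv: "val_size (loopv f x v a) \<le> Suc (val_size x + val_size v + val_size a)"
  using val_size_second[of a] by (cases f) auto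

lemma val_size_nth: "i < length env \<Longrightarrow> val_size (env ! i) \<le> esz env"
  by (induction env arbitrary: i) (auto simp: nth_Cons split: nat.splits, fastforce)

lemma val_size_foldl_loopv:
  "val_size (foldl (\<lambda>a x. loopv f x (g x) a) a xs) \<le> val_size a + (\<Sum>x\<leftarrow>xs. Suc (val_size x + val_size (g x)))"
proof (induction xs arbitrary: a)
  case (Cons x xs)
  show ?case using Cons.IH[of "loopv f x (g x) a"] val_size_loopv[of f x "g x" a] by simp
qed simp

lemma val_size_eval: "val_size (eval e env) \<le> cost e env"
proof (induction e arbitrary: env)
  case (Var i) then show ?case using val_size_nth[of i env] by auto
next
  case (Unary f e) show ?case using Unary[of env] val_size_unv[of f "eval e env"] by simp
next
  case (Binary f a b) show ?case using Binary(1)[of env] Binary(2)[of env] val_size_binv[of f "eval a env" "eval b env"] by simp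
next
  case (Ite c a b) show ?case using Ite(2)[of env] Ite(3)[of env] by auto
next
  case (LetIn a b) show ?case using LetIn(2)[of "eval a env # env"] by simp
next
  case (Loop f i l b)
  have "(\<Sum>x\<leftarrow>items f (eval l env). Suc (val_size x + val_size (eval b (x # env)))) \<le>
    (\<Sum>x\<leftarrow>items f (eval l env). 10 + 4 * cost b (x # env) + 3 * val_size x)"
    proof (intro sum_list_mono)
    fix x show "Suc (val_size x + val_size (eval b (x # env))) \<le> 10 + 4 * cost b (x # env) + 3 * val_size x"
      using Loop(3)[of "x # env"] by linarith
  qed
  with val_size_foldl_loopv[of f "\<lambda>x. eval b (x # env)" "eval i env" "items f (eval l env)"] Loop(1)[of env]
  show ?case by simp
qed auto


lemma runs_within_Seq_le: "runs_within c1 s R1 W t \<Longrightarrow> runs_within c2 t R2 W u \<Longrightarrow> R1 + R2 \<le> R \<Longrightarrow> runs_within (Seq c1 c2) s R W u"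
  using runs_within_Seq runs_within_mono by blast

lemma second_enc_list [simp]: "second (enc_list xs) = enc_list (tl xs)"
  by (cases xs) auto

lemma funpow_second:
  "(step (Second 0 0) ^^ i) (st (enc_list env) e s b) = st (enc_list (drop i env)) e s b"
proof (induction i)
  case (Suc i)
  show ?case unfolding funpow.simps comp_apply Suc by (simp add: drop_Suc tl_drop)
qed simp

lemma esz_tl: "esz (tl env) \<le> esz env"
  by (cases env) auto


lemma fits_second: 
  assumes "esz env + val_size e + val_size s + val_size b \<le> W"
  shows "fits W (replicate i (Second 0 0) @ [First 0 0]) (st (enc_list env) e s b)"
  using assms
proof (induction i arbitrary: env)
  case 0 
  then show ?case using val_size_first[of "enc_list env"] by (auto intro!: store_size_st_le)
next
  case (Suc i) 
  have "esz (tl env) \<le> esz env" by (rule esz_tl)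
  with Suc show ?case by (auto intro!: store_size_st_le)
qed

lemma first_drop: "first (enc_list (drop i env)) = (if i < length env then env ! i else Null)"
  by (cases "drop i env") (auto simp: drop_eq_Nil nth_via_drop dest: arg_cong[of _ _ length])

lemma runs_within_lcode: 
  assumes "2 * val_size x + val_size v + 2 * val_size a + val_size e + val_size s + 3 \<le> W"
  shows "runs_within (lcode f) (st v (Pair x e) s a) 1 W (st (loopv f x v a) (Pair x e) s a)"
  using assms val_size_second[of a]
  by (cases f) (auto intro!: runs_within_If runs_within_block store_size_st_le)



text \<open>The stack is arbitrary because a subexpression runs while values of its context wait
  there. \<open>W\<close> bounds the whole store, so these waiting values are paid for by the cost
  of the enclosing expression; this is the reason for the factors above 1 in
  \<open>cost\<close>.\<close>

theorem compile_correct: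
  "cost e env + esz env + val_size stk + 10 \<le> W \<Longrightarrow>
   runs_within (compile e) (st Null (enc_list env) stk Null) (cost e env) W (st (eval e env) (enc_list env) stk Null)"
proof (induction e arbitrary: env stk)
  case (Var i)
  show ?case unfolding compile.simps
    by (rule runs_within_block) (use Var in \<open>auto simp: funpow_second first_drop sum_list_replicate intro!: store_size_st_le fits_second\<close>)
next
  case (Const c)
  then show ?case by (cases c) (auto intro!: runs_within_block store_size_st_le)
next
  case (Unary f e)
  note v = val_size_eval[of e env] val_size_first[of "eval e env"] val_size_second[of "eval e env"]
  show ?case unfolding compile.simps
    apply (rule runs_within_Seq_le[OF Unary.IH runs_within_block[where R=0]])
    using v Unary.prems by (cases f; auto intro!: store_size_st_le)+
next
  case (Binary f a b)
  note v = val_size_eval[of a env] val_size_eval[of b env] val_size_binv[of f "eval a env" "eval b env"]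
  show ?case unfolding compile.simps
    apply (rule runs_within_Seq_le[OF Binary.IH(1)[of env stk] runs_within_Seq[OF runs_within_block[where R=0] runs_within_Seq[OF Binary.IH(2)[of env "Pair (eval a env) stk"] runs_within_block[where R=1]]]])
    using v Binary.prems
    by (auto intro!: store_size_st_le; cases f; auto intro!: store_size_st_le)+
next
  case (Ite c a b)
  note v = val_size_eval[of c env]
  show ?case unfolding compile.simps
    apply (rule runs_within_Seq_le[OF Ite.IH(1)[of env stk] runs_within_Seq[where ?R2.0="cost a env + cost b env", OF runs_within_block[where R=0] runs_within_If]])
    using v Ite.prems
           apply (auto intro!: store_size_st_le)[6]
    subgoal
      apply simp
      apply (rule runs_within_Seq_le[OF runs_within_block[where R=0] Ite.IH(2)[of env stk]])
      using v Ite.prems by (auto intro!: store_size_st_le)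
    subgoal
      apply simp
      apply (rule runs_within_mono[OF Ite.IH(3)[of env stk]])
      using v Ite.prems by (auto intro!: store_size_st_le)
    using Ite.prems by auto
next
  case (LetIn a b)
  note v = val_size_eval[of a env] val_size_eval[of b "eval a env # env"]
  have e: "enc_list (eval a env # env) = Pair (eval a env) (enc_list env)" by simp
  show ?case unfolding compile.simps
    apply (rule runs_within_Seq_le[OF LetIn.IH(1)[of env stk] runs_within_Seq[OF runs_within_block[where R=0] runs_within_Seq[OF LetIn.IH(2)[of "eval a env # env" stk] runs_within_block[where R=0]]]])
    using v LetIn.prems
    by (auto intro!: store_size_st_le)
next
  case (Loop f i l b)
  let ?body = "Seq (block [MkPair 2 0 2, SetNull 0, if f = LTails then Second 3 3 else First 3 3, MkPair 1 3 1, SetNull 3])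
        (Seq (compile b) (Seq (block [First 3 2]) (Seq (lcode f) 
         (block [Second 1 1, Second 2 2, First 3 2, Second 3 3, Second 2 2, MkPair 2 3 2, First 3 2]))))"
  let ?st = "\<lambda>rem acc. st acc (enc_list env) (Pair rem stk) rem"
  let ?S = "\<lambda>xs. \<Sum>x\<leftarrow>xs. 10 + 4 * cost b (x # env) + 3 * val_size x"
  have body: "runs_within ?body (?st rem acc) (1 + cost b (item_of f rem # env)) W
      (?st (second rem) (loopv f (item_of f rem) (eval b (item_of f rem # env)) acc))"
    if "3 * val_size acc + 2 * val_size rem + esz env + val_size stk + 20 + 2 * cost b (item_of f rem # env) + 3 * val_size (item_of f rem) \<le> W"
    for rem acc
  proof -
    note v = val_size_eval[of b "item_of f rem # env"] val_size_item_of[of f rem] val_size_second[of rem]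
      val_size_loopv[of f "item_of f rem" "eval b (item_of f rem # env)" acc]
    have it: "item_of f rem = (if f = LTails then second rem else first rem)" by (cases f) auto
    show ?thesis
      apply (rule runs_within_Seq_le[OF runs_within_block[where R=0] runs_within_Seq[OF Loop.IH(3)[of "item_of f rem # env" "Pair acc (Pair rem stk)"] 
          runs_within_Seq[OF runs_within_block[where R=0] runs_within_Seq[OF runs_within_lcode[of "item_of f rem" "eval b (item_of f rem # env)" acc "enc_list env" "Pair acc (Pair rem stk)" W f] runs_within_block[where R=0]]]]])
      using v that by (auto simp: it intro!: store_size_st_le split: if_splits)
  qed
  \<comment> \<open>The accumulator can be present three times: on the stack, in register 3 and,
    updated, in register 0. One pass enlarges it by at most 1 plus the sizes of item and value;
    three times this amount is below the summand that leaves \<open>?S\<close>, so the bound is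
    preserved.\<close>
  have loop: "runs_within (While 3 ?body) (?st rem acc) (?S (items f rem)) W
      (?st Null (foldl (\<lambda>a x. loopv f x (eval b (x # env)) a) acc (items f rem)))"
    if "3 * val_size acc + 2 * val_size rem + esz env + val_size stk + 20 + ?S (items f rem) \<le> W"
    for rem acc
    using that
  proof (induction rem arbitrary: acc)
    case Null
    then show ?case by (auto intro!: runs_within_WhileFalse store_size_st_le)
  next
    case (Atom a)
    have "runs_within (While 3 ?body) (?st (Atom a) acc) ((1 + cost b (Null # env)) + 0) W
       (?st Null (loopv f Null (eval b (Null # env)) acc))"
      apply (rule runs_within_WhileTrue)
      using body[of acc "Atom a"] Atom item_of_Atom[of f a] val_size_loopv[of f Null "eval b (Null # env)" acc] val_size_eval[of b "Null # env"]
      by (auto intro!: runs_within_WhileFalse store_size_st_le)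
    then show ?case by (rule runs_within_mono[THEN back_subst[of "\<lambda>t. runs_within _ _ _ _ t"]]) auto
  next
    case (Pair x rem)
    let ?i = "item_of f (Pair x rem)"
    have "runs_within (While 3 ?body) (?st (Pair x rem) acc) ((1 + cost b (?i # env)) + ?S (items f rem)) W
      (?st Null (foldl (\<lambda>a x. loopv f x (eval b (x # env)) a) (loopv f ?i (eval b (?i # env)) acc) (items f rem)))"
      apply (rule runs_within_WhileTrue)
      using body[of acc "Pair x rem"] Pair.prems
        Pair.IH(2)[of "loopv f ?i (eval b (?i # env)) acc"] val_size_loopv[of f ?i "eval b (?i # env)" acc]
        val_size_eval[of b "?i # env"]
      by auto
    then show ?case by (rule runs_within_mono[THEN back_subst[of "\<lambda>t. runs_within _ _ _ _ t"]]) auto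
  qed
  note v = val_size_eval[of l env] val_size_eval[of i env]
   val_size_foldl_loopv[of f "\<lambda>x. eval b (x # env)" "eval i env" "items f (eval l env)"] 
  have s: "(\<Sum>x\<leftarrow>items f (eval l env). Suc (val_size x + val_size (eval b (x # env)))) \<le> ?S (items f (eval l env))"
    proof (intro sum_list_mono)
    fix x show "Suc (val_size x + val_size (eval b (x # env))) \<le> 10 + 4 * cost b (x # env) + 3 * val_size x"
      using val_size_eval[of b "x # env"] by linarith
  qed
  show ?case unfolding compile.simps
    apply (rule runs_within_Seq_le[OF Loop.IH(2)[of env stk] runs_within_Seq[OF runs_within_block[where R=0] runs_within_Seq[OF Loop.IH(1)[of env "Pair (eval l env) stk"]
        runs_within_Seq[OF runs_within_block[where R=0] runs_within_Seq[OF loop[of "eval i env" "eval l env"] runs_within_block[where R=0]]]]]])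
    using v s Loop.prems
    by (auto intro!: store_size_st_le)
qed

section \<open>Polynomial bounds on the cost\<close>

definition poly_bounded :: "('a::comm_ring_1 val list \<Rightarrow> nat) \<Rightarrow> bool" where
  "poly_bounded f \<longleftrightarrow> (\<exists>C d. \<forall>env. f env \<le> C * esz env ^ d)"

lemma poly_bounded_mono: "poly_bounded g \<Longrightarrow> (\<And>env. f env \<le> g env) \<Longrightarrow> poly_bounded f"
  unfolding poly_bounded_def by (meson le_trans)

lemma poly_bounded_const: "poly_bounded (\<lambda>env. c)"
  unfolding poly_bounded_def by (rule exI[of _ c], rule exI[of _ 0]) simp

lemma poly_bounded_esz: "poly_bounded (\<lambda>env. esz env)"
  unfolding poly_bounded_def by (rule exI[of _ 1], rule exI[of _ 1]) simp

lemma poly_bounded_mult: 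
  assumes "poly_bounded f" "poly_bounded g"
  shows "poly_bounded (\<lambda>env. f env * g env)"
proof -
  from assms obtain C d C' d' where "\<And>env. f env \<le> C * esz env ^ d" "\<And>env. g env \<le> C' * esz env ^ d'"
    unfolding poly_bounded_def by blast
  then have "f env * g env \<le> (C * C') * esz env ^ (d + d')" for env
    using mult_mono[of "f env" "C * esz env ^ d" "g env" "C' * esz env ^ d'"] by (simp add: power_add ac_simps)
  then show ?thesis unfolding poly_bounded_def by blast
qed

lemma poly_bounded_add: 
  assumes "poly_bounded f" "poly_bounded g"
  shows "poly_bounded (\<lambda>env. f env + g env)"
proof -
  from assms obtain C d C' d' where *: "\<And>env. f env \<le> C * esz env ^ d" "\<And>env. g env \<le> C' * esz env ^ d'"
    unfolding poly_bounded_def by blast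
  have "f env + g env \<le> (C + C') * esz env ^ (d + d')" for env
  proof -
    have "esz env ^ d \<le> esz env ^ (d + d')" "esz env ^ d' \<le> esz env ^ (d + d')"
      by (auto intro!: power_increasing)
    then show ?thesis using *[of env] by (simp add: distrib_right) (meson add_mono le_trans mult_le_mono2)
  qed
  then show ?thesis unfolding poly_bounded_def by blast
qed

lemma poly_bounded_power: "poly_bounded f \<Longrightarrow> poly_bounded (\<lambda>env. f env ^ n)"
  by (induction n) (auto intro: poly_bounded_const poly_bounded_mult)

lemma items_size: "x \<in> set (items f v) \<Longrightarrow> val_size x \<le> val_size v"
proof (induction v)
  case (Pair a b)
  then show ?case using val_size_item_of[of f "Pair a b"] by auto
qed auto

lemma length_items: "length (items f v) \<le> val_size v"
  by (induction v) auto

text \<open>Polynomials are closed under composition. A value bound by \<open>LetIn\<close> is no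
  larger than the cost of computing it, so the body runs in an environment of polynomial size. A
  loop makes at most as many passes as its list has cells, its items are no larger than the list,
  and no pass depends on the accumulator.\<close>

lemma poly_bounded_cost: "poly_bounded (cost e :: 'a::comm_ring_1 val list \<Rightarrow> nat)"
proof (induction e)
  case (LetIn a b)
  from LetIn(2) obtain C d where b: "\<And>env. cost b env \<le> C * esz (env :: 'a val list) ^ d"
    unfolding poly_bounded_def by blast
  show ?case
  proof (rule poly_bounded_mono)
    show "poly_bounded (\<lambda>env. 10 + 2 * cost a env + C * (1 + cost a env + esz (env :: 'a val list)) ^ d)"
      by (intro poly_bounded_add poly_bounded_mult poly_bounded_power poly_bounded_const poly_bounded_esz LetIn(1))
    fix env :: "'a val list"
    have "cost b (eval a env # env) \<le> C * (1 + cost a env + esz env) ^ d"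
      using val_size_eval[of a env] by (intro order_trans[OF b] mult_le_mono2 power_mono) auto
    then show "cost (LetIn a b) env \<le> 10 + 2 * cost a env + C * (1 + cost a env + esz env) ^ d"
      by simp
  qed
next
  case (Loop f i l b)
  from Loop(3) obtain C d where b: "\<And>env. cost b env \<le> C * esz (env :: 'a val list) ^ d"
    unfolding poly_bounded_def by blast
  let ?g = "\<lambda>env::'a val list. 10 + 4 * (C * (1 + cost l env + esz env) ^ d) + 3 * cost l env"
  show ?case
  proof (rule poly_bounded_mono)
    show "poly_bounded (\<lambda>env :: 'a val list. 20 + 4 * cost i env + 6 * cost l env + cost l env * ?g env)"
      by (intro poly_bounded_add poly_bounded_mult poly_bounded_power poly_bounded_const poly_bounded_esz Loop(1,2))
    fix env :: "'a val list"
    let ?xs = "items f (eval l env)"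
    have "10 + 4 * cost b (x # env) + 3 * val_size x \<le> ?g env" if "x \<in> set ?xs" for x
    proof -
      have x: "val_size x \<le> cost l env"
        using items_size[OF that] val_size_eval[of l env] by simp
      then have "cost b (x # env) \<le> C * (1 + cost l env + esz env) ^ d"
        by (intro order_trans[OF b] mult_le_mono2 power_mono) auto
      with x show ?thesis by linarith
    qed
    then have "(\<Sum>x\<leftarrow>?xs. 10 + 4 * cost b (x # env) + 3 * val_size x) \<le> (\<Sum>x\<leftarrow>?xs. ?g env)"
      by (intro sum_list_mono) auto
    also have "\<dots> = length ?xs * ?g env"
      by (simp add: sum_list_triv)
    also have "\<dots> \<le> cost l env * ?g env"
      using length_items[of f "eval l env"] val_size_eval[of l env] by (intro mult_le_mono1) simp
    finally show "cost (Loop f i l b) env \<le> 20 + 4 * cost i env + 6 * cost l env + cost l env * ?g env"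
      by simp
  qed
qed (auto intro!: poly_bounded_add poly_bounded_mult poly_bounded_const poly_bounded_esz)

section \<open>One WHILE loop around a step expression\<close>

definition iterate_body :: "expr \<Rightarrow> com" where
  "iterate_body se = Seq (block [SetNull 3]) (Seq (compile se) (block [Copy 1 0, SetNull 0, First 3 1]))"

text \<open>The guard in register 3 is the first component of the state, later the stack of items.
  Compiled code wants this register empty, so every pass clears and reloads it. At the outset it is
  \<open>Null\<close>, so \<open>MkPair 1 0 3\<close> builds the environment with the input as only
  entry. The answer is the top of the second component.\<close>

definition iterate :: "expr \<Rightarrow> expr \<Rightarrow> com" where
  "iterate ie se = Seq (block [MkPair 1 0 3, SetNull 0]) (Seq (compile ie) (Seq (block [Copy 1 0, SetNull 0, First 3 1])
     (Seq (While 3 (iterate_body se)) (block [Second 0 1, First 0 0, First 0 0]))))"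

text \<open>\<open>C\<close> and \<open>d\<close> are chosen before the input and depend on the two
  expressions only, as uniformity requires. In \<open>Suc N\<close> the additional 1 accounts for
  the initial expression.\<close>

theorem iterate_correct:
  "\<exists>C d. \<forall>v (s :: nat \<Rightarrow> 'a::comm_ring_1 val list) N M. 
     eval ie [v] = enc_list (s 0) \<and> (\<forall>i<N. eval se (s i) = enc_list (s (Suc i)) \<and> hd (s i) \<noteq> Null) \<and>
     hd (s N) = Null \<and> (\<forall>i\<le>N. esz (s i) \<le> M \<and> s i \<noteq> []) \<and> val_size v + 2 \<le> M \<longrightarrow>
     (\<exists>r w t. exec (iterate ie se) (init_store v) r w t \<and> t 0 = first (first (enc_list (tl (s N)))) \<and>
       w \<le> C * M ^ d \<and> r \<le> Suc N * (C * M ^ d))"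
proof -
  obtain C1 d1 where c1: "\<And>env. cost ie env \<le> C1 * esz (env :: 'a val list) ^ d1"
    using poly_bounded_cost[of ie, where ?'a='a] unfolding poly_bounded_def by blast
  obtain C2 d2 where c2: "\<And>env. cost se env \<le> C2 * esz (env :: 'a val list) ^ d2"
    using poly_bounded_cost[of se, where ?'a='a] unfolding poly_bounded_def by blast
  define C where "C = 2 * C1 + 2 * C2 + 30"
  define d where "d = Suc (d1 + d2)"
  have "\<exists>r w t. exec (iterate ie se) (init_store v) r w t \<and> t 0 = first (first (enc_list (tl (s N)))) \<and>
       w \<le> C * M ^ d \<and> r \<le> Suc N * (C * M ^ d)"
    if ie: "eval ie [v] = enc_list (s 0)"
     and se: "\<And>i. i < N \<Longrightarrow> eval se (s i) = enc_list (s (Suc i))" "\<And>i. i < N \<Longrightarrow> hd (s i) \<noteq> Null"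
     and fin: "hd (s N) = Null" and M: "\<And>i. i \<le> N \<Longrightarrow> esz (s i) \<le> M" "val_size v + 2 \<le> M"
     and ne: "\<And>i. i \<le> N \<Longrightarrow> s i \<noteq> []"
   for v M N and s :: "nat \<Rightarrow> 'a val list"
  proof -
    have M1: "1 \<le> M" using M(2) by simp
    have f1: "first (enc_list (s i)) = hd (s i)" if "i \<le> N" for i
      using ne[OF that] by (cases "s i") auto
    have sz1: "val_size (hd (s i)) \<le> esz (s i)" if "i \<le> N" for i
      using ne[OF that] by (cases "s i") auto
    let ?W = "C * M ^ d"
    have pow: "M ^ d1 \<le> M ^ d" "M ^ d2 \<le> M ^ d" "M \<le> M ^ d"
    proof -
      have "d1 \<le> d" "d2 \<le> d" "1 \<le> d" unfolding d_def by auto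
      with M1 show "M ^ d1 \<le> M ^ d" "M ^ d2 \<le> M ^ d" "M \<le> M ^ d"
        using power_increasing[of 1 d M] by (simp_all only: power_increasing power_one_right)
    qed
    have W: "2 * (C1 * M ^ d1) + 2 * (C2 * M ^ d2) + 30 * M \<le> ?W"
      using pow unfolding C_def distrib_right mult.assoc by (intro add_mono mult_le_mono) auto
    have b1: "cost ie [v] \<le> C1 * M ^ d1"
      using M(2) by (intro order_trans[OF c1] mult_le_mono2 power_mono) auto
    have b2: "cost se (s i) \<le> C2 * M ^ d2" if "i \<le> N" for i
      using M(1)[OF that] by (intro order_trans[OF c2] mult_le_mono2 power_mono) auto
    have body: "runs_within (iterate_body se) (st Null (enc_list (s i)) Null (hd (s i))) (C2 * M ^ d2) ?W
       (st Null (enc_list (s (Suc i))) Null (hd (s (Suc i))))" if "i < N" for i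
    proof -
      have i: "i \<le> N" "Suc i \<le> N" using that by auto
      show ?thesis unfolding iterate_body_def
        apply (rule runs_within_Seq_le[OF runs_within_block[where R=0] runs_within_Seq[OF runs_within_mono[OF compile_correct[of se "s i" Null ?W] b2[OF i(1)] order_refl] runs_within_block[where R=0]]])
        using b2[OF i(1)] M(1)[OF i(1)] M(1)[OF i(2)] sz1[OF i(1)] sz1[OF i(2)] se(1)[OF that] f1[OF i(2)] W M1
        by (auto intro!: store_size_st_le)
    qed
    have loop: "runs_within (While 3 (iterate_body se)) (st Null (enc_list (s i)) Null (hd (s i))) ((N - i) * (C2 * M ^ d2)) ?W
       (st Null (enc_list (s N)) Null Null)" if "i \<le> N" for i
      using that
    proof (induction rule: inc_induct)
      case base
      show ?case using fin M(1)[of N] W M1 by (auto intro!: runs_within_WhileFalse store_size_st_le)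
    next
      case (step n)
      have "runs_within (While 3 (iterate_body se)) (st Null (enc_list (s n)) Null (hd (s n))) 
        (C2 * M ^ d2 + (N - Suc n) * (C2 * M ^ d2)) ?W (st Null (enc_list (s N)) Null Null)"
        using step by (intro runs_within_WhileTrue[OF _ body step.IH]) (auto simp: se(2))
      moreover have "N - n = Suc (N - Suc n)" using step.hyps by simp
      ultimately show ?case by (metis mult_Suc)
    qed
    have v1: "enc_list [v] = Pair v Null" by simp
    have v2: "val_size (enc_list (tl (s N))) \<le> esz (s N)" "val_size (first (enc_list (tl (s N)))) \<le> esz (s N)"
      "val_size (first (first (enc_list (tl (s N))))) \<le> esz (s N)"
      using esz_tl[of "s N"] val_size_first[of "enc_list (tl (s N))"] val_size_first[of "first (enc_list (tl (s N)))"] by linarith+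
    have X: "runs_within (iterate ie se) (st v Null Null Null) (C1 * M ^ d1 + N * (C2 * M ^ d2)) ?W 
      (st (first (first (enc_list (tl (s N))))) (enc_list (s N)) Null Null)"
      unfolding iterate_def
      apply (rule runs_within_Seq_le[OF runs_within_block[where R=0] runs_within_Seq[OF runs_within_mono[OF compile_correct[of ie "[v]" Null ?W] b1 order_refl]
          runs_within_Seq[OF runs_within_block[where R=0] runs_within_Seq[OF loop[of 0] runs_within_block[where R=0]]]]])
      using b1 M(1)[of 0] M(1)[of N] M(2) sz1[of 0] ie f1[of 0] v2 W M1
      by (auto intro!: store_size_st_le)
    have R: "C1 * M ^ d1 + N * (C2 * M ^ d2) \<le> Suc N * ?W"
    proof -
      have "C1 * M ^ d1 \<le> ?W" "C2 * M ^ d2 \<le> ?W" using W by linarith+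
      then show ?thesis by (simp add: add_mono)
    qed
    have v: "init_store v = st v Null Null Null"
      by (auto simp: init_store_def st_def)
    from runs_within_mono[OF X R order_refl] obtain r w where
      "exec (iterate ie se) (init_store v) r w (st (first (first (enc_list (tl (s N))))) (enc_list (s N)) Null Null)"
      "r \<le> Suc N * ?W" "w \<le> ?W"
      unfolding runs_within_def v by auto
    then show ?thesis using st_apply(1) by blast
  qed
  note main = this
  show ?thesis
  proof (rule exI[of _ C], rule exI[of _ d], intro allI impI, elim conjE)
    fix v :: "'a val" and s :: "nat \<Rightarrow> 'a val list" and N M
    assume a: "eval ie [v] = enc_list (s 0)" "\<forall>i<N. eval se (s i) = enc_list (s (Suc i)) \<and> hd (s i) \<noteq> Null"
      "hd (s N) = Null" "\<forall>i\<le>N. esz (s i) \<le> M \<and> s i \<noteq> []" "val_size v + 2 \<le> M"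
    show "\<exists>r w t. exec (iterate ie se) (init_store v) r w t \<and> t 0 = first (first (enc_list (tl (s N)))) \<and>
       w \<le> C * M ^ d \<and> r \<le> Suc N * (C * M ^ d)"
      by (rule main[OF a(1) _ _ a(3) _ a(5)]) (use a(2,4) in simp_all)
  qed
qed

section \<open>Partition functions of partially solved instances\<close>

text \<open>All ordered pairs take part, the diagonal included: \<open>T x x\<close> carries the
  unary factor of \<open>x\<close>, and the factor of an edge is the product of both orientations.
  The table need not be symmetric, so a new factor can be put into a single entry.\<close>

definition weight :: "nat set \<Rightarrow> (nat \<Rightarrow> nat \<Rightarrow> nat \<Rightarrow> nat \<Rightarrow> 'a::comm_ring_1) \<Rightarrow> (nat \<Rightarrow> nat) \<Rightarrow> 'a" where
  "weight U T \<sigma> = (\<Prod>x\<in>U. \<Prod>y\<in>U. T x y (\<sigma> x) (\<sigma> y))"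

definition zsum :: "nat \<Rightarrow> nat set \<Rightarrow> 'a \<Rightarrow> (nat \<Rightarrow> nat \<Rightarrow> nat \<Rightarrow> nat \<Rightarrow> 'a::comm_ring_1) \<Rightarrow> 'a" where
  "zsum k U c T = c * (\<Sum>\<sigma>\<in>U \<rightarrow>\<^sub>E {..<k}. weight U T \<sigma>)"

text \<open>Once \<open>v\<close> has the value \<open>l\<close>, its binary factors are unary and
  move to the diagonal. Adjacency is not consulted: in a consistent instance the factors towards a
  non-neighbour are 1.\<close>

definition branch_table :: "nat \<Rightarrow> nat \<Rightarrow> (nat \<Rightarrow> nat \<Rightarrow> nat \<Rightarrow> nat \<Rightarrow> 'a::comm_ring_1) \<Rightarrow> nat \<Rightarrow> nat \<Rightarrow> nat \<Rightarrow> nat \<Rightarrow> 'a" where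
  "branch_table v l T x y i j = (if x = y then T x y i j * (T v x l i * T x v i l) else T x y i j)"

text \<open>Degree 1 is coded as \<open>a = b\<close>. The sum is then a unary factor on the
  diagonal entry of \<open>a\<close>, and the conditional keeps the factors between \<open>v\<close>
  and \<open>a\<close> from being counted twice. If \<open>a\<close> and \<open>b\<close> are
  already adjacent, the product merges the parallel edges.\<close>

definition elim_table :: "nat \<Rightarrow> nat \<Rightarrow> nat \<Rightarrow> nat \<Rightarrow> (nat \<Rightarrow> nat \<Rightarrow> nat \<Rightarrow> nat \<Rightarrow> 'a::comm_ring_1) \<Rightarrow> nat \<Rightarrow> nat \<Rightarrow> nat \<Rightarrow> nat \<Rightarrow> 'a" where
  "elim_table k v a b T x y i j = (if x = a \<and> y = b
     then T x y i j * (\<Sum>l<k. T v v l l * (T v a l i * T a v i l) * (if a = b then 1 else T v b l j * T b v j l))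
     else T x y i j)"

lemma sum_PiE_insert:
  assumes "v \<notin> U"
  shows "(\<Sum>\<sigma>\<in>insert v U \<rightarrow>\<^sub>E K. f \<sigma>) = (\<Sum>i\<in>K. \<Sum>\<sigma>\<in>U \<rightarrow>\<^sub>E K. f (\<sigma>(v := i)))"
proof -
  have "(\<Sum>\<sigma>\<in>insert v U \<rightarrow>\<^sub>E K. f \<sigma>) = (\<Sum>(i, \<sigma>)\<in>K \<times> (U \<rightarrow>\<^sub>E K). f (\<sigma>(v := i)))"
    unfolding PiE_insert_eq
    by (subst sum.reindex[OF inj_combinator[OF assms]]) (simp add: case_prod_unfold o_def)
  then show ?thesis by (simp add: sum.cartesian_product)
qed

lemma weight_insert:
  assumes "v \<notin> U" "finite U"
  shows "weight (insert v U) T (\<sigma>(v := i)) =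
    T v v i i * (\<Prod>x\<in>U. T v x i (\<sigma> x) * T x v (\<sigma> x) i) * weight U T \<sigma>"
proof -
  have [simp]: "(if x = v then A else B) = B" if "x \<in> U" for x and A B :: 'b using that assms by auto
  show ?thesis
    unfolding weight_def using assms by (simp add: prod.distrib mult_ac cong: prod.cong)
qed

lemma weight_branch:
  assumes "finite U"
  shows "weight U (branch_table v l T) \<sigma> = (\<Prod>x\<in>U. T v x l (\<sigma> x) * T x v (\<sigma> x) l) * weight U T \<sigma>"
proof -
  have "(\<Prod>y\<in>U. branch_table v l T x y (\<sigma> x) (\<sigma> y)) =
      (T v x l (\<sigma> x) * T x v (\<sigma> x) l) * (\<Prod>y\<in>U. T x y (\<sigma> x) (\<sigma> y))" if "x \<in> U" for x
    unfolding prod.remove[OF assms that] by (simp add: branch_table_def mult_ac)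
  then show ?thesis unfolding weight_def by (simp add: prod.distrib)
qed

lemma zsum_branch:
  assumes "v \<notin> U" "finite U"
  shows "zsum k (insert v U) c T = (\<Sum>l<k. zsum k U (c * T v v l l) (branch_table v l T))"
  unfolding zsum_def sum_PiE_insert[OF assms(1)] weight_insert[OF assms] weight_branch[OF assms(2)]
  by (simp add: sum_distrib_left mult_ac)

lemma weight_elim:
  assumes "finite U" "a \<in> U" "b \<in> U"
  shows "weight U (elim_table k v a b T) \<sigma> = (\<Sum>l<k. T v v l l * (T v a l (\<sigma> a) * T a v (\<sigma> a) l) * 
     (if a = b then 1 else T v b l (\<sigma> b) * T b v (\<sigma> b) l)) * weight U T \<sigma>"
    (is "_ = ?s * _")
proof -
  have row: "(\<Prod>y\<in>U. elim_table k v a b T x y (\<sigma> x) (\<sigma> y)) = (if x = a then ?s else 1) * (\<Prod>y\<in>U. T x y (\<sigma> x) (\<sigma> y))" for x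
  proof (cases "x = a")
    case True
    then show ?thesis
      unfolding prod.remove[OF assms(1,3)] by (simp add: elim_table_def mult_ac)
  qed (simp add: elim_table_def)
  have "(\<Prod>x\<in>U. if x = a then ?s else 1) = ?s"
    using assms by (subst prod.delta) auto
  then show ?thesis unfolding weight_def row prod.distrib by simp
qed

text \<open>By distributivity the sum over the value of \<open>v\<close> moves inside, past all
  factors that do not mention \<open>v\<close>; by \<open>one\<close>, only those towards
  \<open>a\<close> and \<open>b\<close> stay behind.\<close>

lemma zsum_elim:
  assumes "v \<notin> U" "finite U" "a \<in> U" "b \<in> U"
   and one: "\<And>x i j. x \<in> U - {a, b} \<Longrightarrow> i < k \<Longrightarrow> j < k \<Longrightarrow> T v x i j = 1 \<and> T x v i j = 1"
  shows "zsum k (insert v U) c T = zsum k U c (elim_table k v a b T)"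
proof -
  have "(\<Sum>l<k. weight (insert v U) T (\<sigma>(v := l))) = weight U (elim_table k v a b T) \<sigma>"
    if \<sigma>: "\<sigma> \<in> U \<rightarrow>\<^sub>E {..<k}" for \<sigma>
  proof -
    have "(\<Prod>x\<in>U. T v x l (\<sigma> x) * T x v (\<sigma> x) l) = 
       (T v a l (\<sigma> a) * T a v (\<sigma> a) l) * (if a = b then 1 else T v b l (\<sigma> b) * T b v (\<sigma> b) l)" if "l < k" for l
    proof -
      have "(\<Prod>x\<in>U. T v x l (\<sigma> x) * T x v (\<sigma> x) l) = (\<Prod>x\<in>{a, b}. T v x l (\<sigma> x) * T x v (\<sigma> x) l)"
      proof (intro prod.mono_neutral_right ballI)
        fix x assume "x \<in> U - {a, b}"
        then show "T v x l (\<sigma> x) * T x v (\<sigma> x) l = 1"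
          using one[of x l "\<sigma> x"] one[of x "\<sigma> x" l] \<sigma> that by (auto simp: PiE_iff)
      qed (use assms in auto)
      then show ?thesis by (simp add: insert_absorb)
    qed
    then show ?thesis
      unfolding weight_insert[OF assms(1,2)] weight_elim[OF assms(2-4)]
      by (simp add: sum_distrib_right mult.assoc)
  qed
  then show ?thesis
    unfolding zsum_def sum_PiE_insert[OF assms(1)] by (subst sum.swap) simp
qed

text \<open>No nontrivial factor crosses between the two parts, so the sum over assignments
  factorises. The constant must enter once; it stays with \<open>A\<close>.\<close>

lemma zsum_union:
  assumes "finite A" "finite B" "A \<inter> B = {}"
   and one: "\<And>x y i j. x \<in> A \<Longrightarrow> y \<in> B \<Longrightarrow> i < k \<Longrightarrow> j < k \<Longrightarrow> T x y i j = 1 \<and> T y x i j = 1"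
  shows "zsum k (A \<union> B) c T = zsum k A c T * zsum k B 1 T"
proof -
  let ?r = "\<lambda>\<sigma> \<tau> x. if x \<in> A then \<sigma> x else \<tau> x"
  have w: "weight (A \<union> B) T \<sigma> = weight A T (restrict \<sigma> A) * weight B T (restrict \<sigma> B)"
    if "\<sigma> \<in> (A \<union> B) \<rightarrow>\<^sub>E {..<k}" for \<sigma>
  proof -
    have [simp]: "T x y (\<sigma> x) (\<sigma> y) = 1" "T y x (\<sigma> y) (\<sigma> x) = 1" if "x \<in> A" "y \<in> B" for x y
      using that one[of x y "\<sigma> x" "\<sigma> y"] one[of x y "\<sigma> y" "\<sigma> x"] \<open>\<sigma> \<in> _\<close> by (auto simp: PiE_iff)
    have "weight (A \<union> B) T \<sigma> = (\<Prod>x\<in>A. \<Prod>y\<in>A. T x y (\<sigma> x) (\<sigma> y)) * (\<Prod>x\<in>B. \<Prod>y\<in>B. T x y (\<sigma> x) (\<sigma> y))"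
      unfolding weight_def by (simp add: prod.union_disjoint[OF assms(1-3)] cong: prod.cong)
    then show ?thesis unfolding weight_def by (simp cong: prod.cong)
  qed
  have "(\<Sum>\<sigma>\<in>(A \<union> B) \<rightarrow>\<^sub>E {..<k}. weight (A \<union> B) T \<sigma>) =
    (\<Sum>(\<sigma>, \<tau>)\<in>(A \<rightarrow>\<^sub>E {..<k}) \<times> (B \<rightarrow>\<^sub>E {..<k}). weight A T \<sigma> * weight B T \<tau>)"
    by (rule sum.reindex_bij_witness[of _ "\<lambda>(\<sigma>, \<tau>). ?r \<sigma> \<tau>" "\<lambda>\<sigma>. (restrict \<sigma> A, restrict \<sigma> B)"])
       (use assms(3) w in \<open>auto simp: PiE_iff extensional_def fun_eq_iff split: if_splits\<close>)
  then show ?thesis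
    unfolding zsum_def by (simp add: sum_product sum.cartesian_product mult.assoc)
qed

section \<open>The degree measure\<close>

definition deg :: "(nat \<Rightarrow> nat \<Rightarrow> bool) \<Rightarrow> nat set \<Rightarrow> nat \<Rightarrow> nat" where
  "deg E U v = card {u \<in> U. E v u}"

definition vertex_measure :: "nat \<Rightarrow> real" where
  "vertex_measure d = (if d \<le> 2 then 0 else if d = 3 then 1/4 else if d = 4 then 3/8 else 19/200 * real d)"

text \<open>The value 1/8 pays for the first branching in a 4-regular graph, and 3/20 is the least value
  that lets a 5-regular graph become 4-regular in one branching, as \<open>K\<^sub>6\<close> does. Graphs with a vertex of
  degree at least 6 receive the larger bonus as well, so that they may become regular.\<close>

definition bonus :: "nat set \<Rightarrow> (nat \<Rightarrow> nat) \<Rightarrow> real" where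
  "bonus S g = (if S = {} then 0 else if (\<exists>x\<in>S. 6 \<le> g x) \<or> (\<forall>x\<in>S. g x = 5) then 3/20
     else if \<forall>x\<in>S. g x = 4 then 1/8 else 0)"

text \<open>The bound is required for all degree sequences dominated by that of the graph and not just for the
  graph itself. This makes it monotone under removal of vertices, although a bonus can appear when
  a graph becomes regular.\<close>

definition measure_le :: "nat set \<Rightarrow> (nat \<Rightarrow> nat \<Rightarrow> bool) \<Rightarrow> real \<Rightarrow> bool" where
  "measure_le U E b \<longleftrightarrow> (\<forall>S g. S \<subseteq> U \<and> (\<forall>x\<in>S. g x \<le> deg E U x) \<longrightarrow> (\<Sum>x\<in>S. vertex_measure (g x)) + bonus S g \<le> b)"

text \<open>Connectivity is stated by cuts instead of paths because it is only applied to cuts: a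
  single vertex against the rest, and the vertices of maximal degree against the others. The empty
  set counts as connected.\<close>

definition conn :: "(nat \<Rightarrow> nat \<Rightarrow> bool) \<Rightarrow> nat set \<Rightarrow> bool" where
  "conn E U \<longleftrightarrow> (\<forall>X\<subseteq>U. X \<noteq> {} \<and> X \<noteq> U \<longrightarrow> (\<exists>x\<in>X. \<exists>y\<in>U - X. E x y))"

lemma vertex_measure_nonneg [simp]: "0 \<le> vertex_measure d"
  by (simp add: vertex_measure_def)

lemma vertex_measure_mono: "d \<le> d' \<Longrightarrow> vertex_measure d \<le> vertex_measure d'"
  by (auto simp: vertex_measure_def)

lemma vertex_measure_le: "vertex_measure d \<le> 19/200 * real d"
  by (auto simp: vertex_measure_def)

text \<open>The drops from degree \<open>d\<close> to \<open>d - 1\<close> are 1/4, 1/8, 1/10 for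
  \<open>d = 3, 4, 5\<close> and 19/200 from then on. They never increase, so an upper bound on the
  degree is a lower bound on the drop.\<close>

lemma vertex_measure_gap6: "3 \<le> d \<Longrightarrow> 19/200 \<le> vertex_measure d - vertex_measure (d - 1)"
  by (cases d) (auto simp: vertex_measure_def algebra_simps)

lemma vertex_measure_gap5: "3 \<le> d \<Longrightarrow> d \<le> 5 \<Longrightarrow> 1/10 \<le> vertex_measure d - vertex_measure (d - 1)"
  by (auto simp: vertex_measure_def of_nat_diff)

lemma vertex_measure_gap4: "3 \<le> d \<Longrightarrow> d \<le> 4 \<Longrightarrow> 1/8 \<le> vertex_measure d - vertex_measure (d - 1)"
  by (auto simp: vertex_measure_def of_nat_diff)

lemma vertex_measure_vals: "vertex_measure 3 = 1/4" "vertex_measure 4 = 3/8" "vertex_measure 5 = 19/40" 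
  by (auto simp: vertex_measure_def)

lemma bonus_nonneg: "0 \<le> bonus S g" by (simp add: bonus_def)

lemma bonus_le: "bonus S g \<le> 3/20" by (simp add: bonus_def)

lemma measure_le_mono:
  assumes "measure_le U E b" "U' \<subseteq> U" "\<And>x. x \<in> U' \<Longrightarrow> deg E' U' x \<le> deg E U x"
  shows "measure_le U' E' b"
  using assms unfolding measure_le_def by (meson order_trans subset_iff)

lemma measure_le_nonneg: "measure_le U E b \<Longrightarrow> 0 \<le> b"
  unfolding measure_le_def by (elim allE[of _ "{}"]) (simp add: bonus_def)

lemma deg_mono: "finite U \<Longrightarrow> U' \<subseteq> U \<Longrightarrow> deg E U' x \<le> deg E U x"
  unfolding deg_def by (rule card_mono) auto

lemma conn_singleton: "conn E {u}"
  unfolding conn_def by auto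

lemma conn_insert:
  assumes "conn E A" "x \<in> A" "E x y" "\<And>x y. E x y \<Longrightarrow> E y x"
  shows "conn E (insert y A)"
  unfolding conn_def
proof (intro allI impI)
  fix X assume X: "X \<subseteq> insert y A" "X \<noteq> {} \<and> X \<noteq> insert y A"
  show "\<exists>x\<in>X. \<exists>z\<in>insert y A - X. E x z"
  proof (cases "X \<inter> A = {} \<or> X \<inter> A = A")
    case False
    then obtain u w where "u \<in> X \<inter> A" "w \<in> A - X \<inter> A" "E u w"
      using assms(1) unfolding conn_def by (metis Int_lower2)
    then show ?thesis by auto
  next
    case True
    then show ?thesis
    proof
      assume "X \<inter> A = {}"
      then have "y \<in> X" "x \<notin> X" using X assms(2) by auto
      then show ?thesis using assms(2-4) by blast
    next
      assume "X \<inter> A = A"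
      then have "y \<notin> X" "x \<in> X" using X assms(2) by auto
      then show ?thesis using assms(2-4) by blast
    qed
  qed
qed

lemma conn_deg_pos:
  assumes "conn E U" "finite U" "x \<in> U" "U \<noteq> {x}"
  shows "1 \<le> deg E U x"
proof -
  from assms obtain y where "y \<in> U" "E x y"
    unfolding conn_def by (metis DiffD1 empty_subsetI insert_subset singletonD insert_not_empty)
  then have "{u \<in> U. E x u} \<noteq> {}" by auto
  then show ?thesis unfolding deg_def using assms(2) by (simp add: Suc_le_eq card_gt_0_iff)
qed

section \<open>Branching lowers the measure by one\<close>

lemma sum_ge_card:
  fixes l :: "'b \<Rightarrow> real"
  assumes "finite N" "\<And>x. x \<in> N \<Longrightarrow> c \<le> l x"
  shows "real (card N) * c \<le> sum l N"
  using sum_bounded_below[of N c l] assms by simp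

lemma sum_ge_card_one:
  fixes l :: "'b \<Rightarrow> real"
  assumes "finite N" "\<And>x. x \<in> N \<Longrightarrow> c \<le> l x" "w \<in> N"
  shows "l w + (real (card N) - 1) * c \<le> sum l N"
proof -
  have "0 < card N" using assms card_gt_0_iff by blast
  then have "real (card N) - 1 = real (card (N - {w}))" using assms by (simp add: of_nat_diff)
  moreover have "real (card (N - {w})) * c \<le> sum l (N - {w})" using assms by (intro sum_ge_card) auto
  moreover have "sum l N = l w + sum l (N - {w})" using assms by (simp add: sum.remove)
  ultimately show ?thesis by simp
qed

text \<open>The loss is booked vertex by vertex: \<open>l x\<close> is the old weight if
  \<open>x\<close> is not in \<open>S\<close>, and otherwise the drop from \<open>?D x\<close> to
  \<open>g x\<close>. No loss is negative, so it is enough that \<open>v\<close> and its neighbours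
  \<open>N\<close> lose 1 plus the change of the bonus.\<close>

lemma measure_le_branch:
  assumes fin: "finite U" and sym: "\<And>x y. E x y \<Longrightarrow> E y x" and irr: "\<And>x. \<not> E x x"
    and deg3: "\<And>x. x \<in> U \<Longrightarrow> 3 \<le> deg E U x"
    and v: "v \<in> U" and max: "\<And>x. x \<in> U \<Longrightarrow> deg E U x \<le> deg E U v"
    and pref: "(\<exists>w\<in>U. E v w \<and> deg E U w < deg E U v) \<or> (\<forall>x\<in>U. deg E U x = deg E U v)"
    and le: "measure_le U E b"
  shows "measure_le (U - {v}) E (b - 1)"
  unfolding measure_le_def
proof (intro allI impI, elim conjE)
  fix S g assume S: "S \<subseteq> U - {v}" and g: "\<forall>x\<in>S. g x \<le> deg E (U - {v}) x"
  let ?D = "deg E U" and ?d = "deg E U v"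
  define N where "N = {u \<in> U. E v u}"
  define l where "l x = vertex_measure (?D x) - (if x \<in> S then vertex_measure (g x) else 0)" for x
  have N: "finite N" "card N = ?d" "N \<subseteq> U" "v \<notin> N" "N \<subseteq> U - {v}"
    using fin irr by (auto simp: N_def deg_def)
  have gD: "g x \<le> ?D x" if "x \<in> S" for x
    using g that deg_mono[OF fin, of "U - {v}" E x] by (meson Diff_subset le_trans)
  have gN: "g x \<le> ?D x - 1" if "x \<in> S" "x \<in> N" for x
  proof -
    have "{u \<in> U - {v}. E x u} = {u \<in> U. E x u} - {v}" by auto
    moreover have "v \<in> {u \<in> U. E x u}" using v that sym by (auto simp: N_def)
    ultimately have "deg E (U - {v}) x = ?D x - 1" unfolding deg_def by simp
    then show ?thesis using g that by auto
  qed
  have l0: "0 \<le> l x" for x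
    using vertex_measure_mono[OF gD] by (auto simp: l_def)
  have lout: "l x = vertex_measure (?D x)" if "x \<notin> S" for x using that by (simp add: l_def)
  have lN: "vertex_measure (?D x) - vertex_measure (?D x - 1) \<le> l x" if "x \<in> N" for x
    using vertex_measure_mono[OF gN[OF _ that]] by (auto simp: l_def)
  have "sum l U = (\<Sum>x\<in>U. vertex_measure (?D x)) - (\<Sum>x\<in>U. if x \<in> S then vertex_measure (g x) else 0)"
    by (simp add: l_def sum_subtractf)
  also have "(\<Sum>x\<in>U. if x \<in> S then vertex_measure (g x) else 0) = (\<Sum>x\<in>S. vertex_measure (g x))"
    using S fin by (subst sum.inter_restrict[symmetric]) (auto intro!: sum.cong)
  finally have sumU: "(\<Sum>x\<in>S. vertex_measure (g x)) = (\<Sum>x\<in>U. vertex_measure (?D x)) - sum l U" by simp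
  have "l v + sum l N = sum l (insert v N)" using N by simp
  also have "\<dots> \<le> sum l U" using N v fin l0 by (intro sum_mono2) auto
  finally have "l v + sum l N \<le> sum l U" .
  moreover have "v \<notin> S" using S by auto
  ultimately have "vertex_measure ?d + sum l N \<le> sum l U" using lout[of v] by simp
  moreover have "(\<Sum>x\<in>U. vertex_measure (?D x)) + bonus U ?D \<le> b"
    using le unfolding measure_le_def by blast
  moreover have "1 + bonus S g - bonus U ?D \<le> vertex_measure ?d + sum l N"
  proof (cases "6 \<le> ?d")
    case True
    with v have "U \<noteq> {}" "\<exists>x\<in>U. 6 \<le> ?D x" by auto
    then have "bonus U ?D = 3/20" by (simp add: bonus_def if_P)
    \<comment> \<open>For degree 6 the gain is 12 * 19/200 = 1.14, while 1 plus a new bonus of 3/20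
      is 1.15. The bonus that \<open>U\<close> already holds closes this gap.\<close>
    moreover have "real (card N) * (19/200) \<le> sum l N"
    proof (rule sum_ge_card[where l=l, OF N(1)])
      fix x assume "x \<in> N"
      then show "19/200 \<le> l x" using N(3) by (intro order_trans[OF vertex_measure_gap6 lN] deg3) auto
    qed
    moreover have "vertex_measure ?d = 19/200 * real ?d" using True by (simp add: vertex_measure_def)
    moreover have "6 \<le> real ?d" using True by simp
    ultimately show ?thesis using bonus_le[of S g] N(2) by simp
  next
    case False
    have d: "?d = 3 \<or> ?d = 4 \<or> ?d = 5" using False deg3[OF v] by auto
    have g5: "g x \<le> ?d" if "x \<in> S" for x using gD[OF that] max[of x] that S by auto
    have gN': "g x < ?d" if "x \<in> S" "x \<in> N" for x
      using gN[OF that] max[of x] deg3[of x] that N(3) by auto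
    have b0: "bonus S g = 0 \<or> (bonus S g = 3/20 \<and> ?d = 5 \<and> (\<forall>x\<in>S. g x = 5)) \<or> 
       (bonus S g = 1/8 \<and> (?d = 5 \<or> ?d = 4) \<and> (\<forall>x\<in>S. g x = 4))"
    proof -
      have not6: "\<not> (\<exists>x\<in>S. 6 \<le> g x)" using g5 False by (meson le_trans)
      show ?thesis
      proof (cases "S = {}")
        case True then show ?thesis by (simp add: bonus_def)
      next
        case False
        then obtain x where x: "x \<in> S" by blast
        have "?d = 5" if "\<forall>x\<in>S. g x = 5" using g5[OF x] that x d by auto
        moreover have "?d = 5 \<or> ?d = 4" if "\<forall>x\<in>S. g x = 4" using g5[OF x] that x d by auto
        ultimately show ?thesis unfolding bonus_def using not6 by presburger
      qed
    qed
    have reg: "bonus U ?D = (if ?d = 5 then 3/20 else if ?d = 4 then 1/8 else 0)" if r: "\<forall>x\<in>U. ?D x = ?d"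
    proof -
      obtain e where e: "?d = e" "e = 3 \<or> e = 4 \<or> e = 5" using d by auto
      from r have "\<forall>x\<in>U. ?D x = e" unfolding e(1) .
      moreover have "U \<noteq> {}" using v by auto
      ultimately show ?thesis using e by (auto simp: bonus_def)
    qed
    \<comment> \<open>Neighbours of \<open>v\<close> fall below degree \<open>?d\<close>. If
      \<open>S\<close> is regular of degree \<open>?d\<close>, none of them is left in
      \<open>S\<close>, and each pays its whole weight, at least 1/4; this finances the new
      bonus.\<close>
    have out: "real ?d * (1/4) \<le> sum l N" if "\<forall>x\<in>S. g x = ?d"
    proof -
      have "x \<notin> S" if "x \<in> N" for x using that gN'[of x] \<open>\<forall>x\<in>S. g x = ?d\<close> by auto
      then have "1/4 \<le> l x" if "x \<in> N" for x
        using that vertex_measure_mono[OF deg3[of x]] N(3) lout[of x] by (auto simp: vertex_measure_vals)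
      from sum_ge_card[where l=l, OF N(1) this] N(2) show ?thesis by simp
    qed
    from d show ?thesis
    proof (elim disjE)
      assume d: "?d = 3"
      have "1/4 \<le> l x" if "x \<in> N" for x
      proof -
        have "?D x = 3" using that max[of x] deg3[of x] d N(3) by auto
        then show ?thesis using lN[OF that] by (simp add: vertex_measure_def)
      qed
      then have "real (card N) * (1/4) \<le> sum l N" by (rule sum_ge_card[where l=l, OF N(1)])
      then show ?thesis
        using d N(2) b0 bonus_nonneg[of U ?D] by (auto simp: vertex_measure_vals)
    next
      assume d: "?d = 4"
      have l8: "1/8 \<le> l x" if "x \<in> N" for x
        using that N deg3[of x] max[of x] d by (intro order_trans[OF vertex_measure_gap4 lN]) auto
      have s8: "4 * (1/8) \<le> sum l N" using sum_ge_card[where l=l, OF N(1) l8] N(2) d by simp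
      show ?thesis
      proof (cases "bonus S g = 0")
        case False
        then have "\<forall>x\<in>S. g x = ?d" "bonus S g = 1/8" using b0 d by auto
        with out[OF this(1)] show ?thesis using d bonus_nonneg[of U ?D] by (simp add: vertex_measure_vals)
      next
        case True
        from pref show ?thesis
        proof
          assume "\<exists>w\<in>U. E v w \<and> ?D w < ?d"
          then obtain w where w: "w \<in> N" "?D w = 3" using d deg3 by (force simp: N_def)
          \<comment> \<open>The neighbour of degree 3 falls to weight 0, and 3/8 + 3 * 1/8 + 1/4 = 1
            holds with equality.\<close>
          then have "1/4 \<le> l w" using lN[OF w(1)] by (simp add: vertex_measure_def)
          with sum_ge_card_one[where l=l, OF N(1) l8 w(1)] show ?thesis
            using N(2) d True bonus_nonneg[of U ?D] by (simp add: vertex_measure_vals)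
        next
          assume "\<forall>x\<in>U. ?D x = ?d"
          \<comment> \<open>In the 4-regular case the gain is 3/8 + 4 * 1/8 = 7/8, and the bonus 1/8
            that is given up supplies the rest.\<close>
          from reg[OF this] s8 True show ?thesis using d by (simp add: vertex_measure_vals)
        qed
      qed
    next
      assume d: "?d = 5"
      have l10: "1/10 \<le> l x" if "x \<in> N" for x
        using that N deg3[of x] max[of x] d by (intro order_trans[OF vertex_measure_gap5 lN]) auto
      have s10: "5 * (1/10) \<le> sum l N" using sum_ge_card[where l=l, OF N(1) l10] N(2) d by simp
      show ?thesis
      proof (cases "bonus S g = 3/20")
        case True
        then have "\<forall>x\<in>S. g x = ?d" using b0 d by auto
        with out[OF this] True show ?thesis using d bonus_nonneg[of U ?D] by (simp add: vertex_measure_vals)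
      next
        case False
        then have b4: "bonus S g = 0 \<or> bonus S g = 1/8 \<and> (\<forall>x\<in>S. g x = 4)" using b0 by auto
        from pref show ?thesis
        proof
          assume "\<exists>w\<in>U. E v w \<and> ?D w < ?d"
          then obtain w where w: "w \<in> N" "?D w < 5" "3 \<le> ?D w" using d deg3 by (force simp: N_def)
          \<comment> \<open>Again an equality: 19/40 + 4 * 1/10 + 1/8 = 1. If the remainder is
            4-regular, \<open>w\<close> cannot belong to it, having fallen below degree 4; its loss
            is then at least 1/4, and the surplus 1/8 is the new bonus.\<close>
          then have "1/8 \<le> l w" using lN[OF w(1)] vertex_measure_gap4[of "?D w"] by simp
          moreover have "1/4 \<le> l w" if "\<forall>x\<in>S. g x = 4"
          proof -
            have "w \<notin> S" using that gN[of w] w by auto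
            then show ?thesis using vertex_measure_mono[OF w(3)] lout[of w] by (simp add: vertex_measure_vals)
          qed
          ultimately show ?thesis using sum_ge_card_one[where l=l, OF N(1) l10 w(1)]
            using N(2) d b4 bonus_nonneg[of U ?D] by (auto simp: vertex_measure_vals)
        next
          assume "\<forall>x\<in>U. ?D x = ?d"
          \<comment> \<open>The gain is 19/40 + 5 * 1/10 = 39/40, and 39/40 + 3/20 = 1 + 1/8: giving
            up the bonus of a 5-regular graph covers even a 4-regular remainder, with
            equality.\<close>
          from reg[OF this] s10 b4 show ?thesis using d by (auto simp: vertex_measure_vals)
        qed
      qed
    qed
  qed
  ultimately show "(\<Sum>x\<in>S. vertex_measure (g x)) + bonus S g \<le> b - 1"
    using sumU by linarith
qed

text \<open>Otherwise the vertices of maximal degree form a proper nonempty subset, and an edge that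
  leaves it ends in a vertex of smaller degree.\<close>

lemma conn_branch_pref:
  assumes "conn E U" "v \<in> U" "\<And>x. x \<in> U \<Longrightarrow> deg E U x \<le> deg E U v"
   and "\<And>x w. x \<in> U \<Longrightarrow> deg E U x = deg E U v \<Longrightarrow> w \<in> U \<Longrightarrow> E x w \<Longrightarrow> \<not> deg E U w < deg E U v"
  shows "\<forall>x\<in>U. deg E U x = deg E U v"
proof (rule ccontr)
  let ?X = "{x \<in> U. deg E U x = deg E U v}"
  assume "\<not> (\<forall>x\<in>U. deg E U x = deg E U v)"
  then have "?X \<noteq> U" by auto
  then obtain x y where "x \<in> ?X" "y \<in> U - ?X" "E x y"
    using assms(1,2) unfolding conn_def by (metis (mono_tags, lifting) empty_iff mem_Collect_eq subsetI)
  then show False using assms(3)[of y] assms(4)[of x y] by auto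
qed

text \<open>Handshaking: each edge is counted at both ends, with 19/200 per unit of degree. The
  additive term 3/20 is the largest possible bonus.\<close>

lemma measure_le_initial:
  assumes "finite U" "\<And>x y. E x y \<Longrightarrow> E y x" "\<And>x. \<not> E x x" 
  shows "measure_le U E (19/100 * real (card {(x, y). x \<in> U \<and> y \<in> U \<and> x < y \<and> E x y}) + 3/20)"
proof -
  let ?P = "{(x, y). x \<in> U \<and> y \<in> U \<and> x < y \<and> E x y}"
  let ?Q = "{(x, y). x \<in> U \<and> y \<in> U \<and> y < x \<and> E x y}"
  have fin: "finite ?P" "finite ?Q" by (rule finite_subset[of _ "U \<times> U"]; use assms(1) in auto)+
  have "?Q = prod.swap ` ?P" using assms(2) by (auto simp: image_iff)
  then have "card ?Q = card ?P" by (simp add: card_image)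
  have "(\<Sum>x\<in>U. deg E U x) = card (SIGMA x:U. {y \<in> U. E x y})"
    unfolding deg_def using assms(1) by simp
  also have "(SIGMA x:U. {y \<in> U. E x y}) = ?P \<union> ?Q"
    using assms(3) by (auto, metis linorder_neqE_nat)
  also have "card \<dots> = card ?P + card ?Q" by (rule card_Un_disjoint) (use fin in auto)
  finally have deg: "(\<Sum>x\<in>U. deg E U x) = 2 * card ?P" using \<open>card ?Q = card ?P\<close> by simp
  show ?thesis unfolding measure_le_def
  proof (intro allI impI, elim conjE)
    fix S g assume S: "S \<subseteq> U" "\<forall>x\<in>S. g x \<le> deg E U x"
    have "(\<Sum>x\<in>S. vertex_measure (g x)) \<le> (\<Sum>x\<in>S. 19/200 * real (deg E U x))"
      using S by (intro sum_mono order_trans[OF vertex_measure_le]) auto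
    also have "\<dots> \<le> (\<Sum>x\<in>U. 19/200 * real (deg E U x))"
      using S assms(1) by (intro sum_mono2) auto
    also have "\<dots> = 19/200 * real (\<Sum>x\<in>U. deg E U x)" by (simp add: sum_distrib_left)
    finally show "(\<Sum>x\<in>S. vertex_measure (g x)) + bonus S g \<le> 19/100 * real (card ?P) + 3/20"
      using bonus_le[of S g] unfolding deg by simp
  qed
qed

section \<open>The stack machine\<close>

datatype 'a inst = Inst "nat list" "nat list" 'a "nat \<Rightarrow> nat \<Rightarrow> bool" "nat \<Rightarrow> nat \<Rightarrow> nat \<Rightarrow> nat \<Rightarrow> 'a"
datatype 'a item = Task "'a inst" | SumMark | ProdMark

text \<open>An instance \<open>Inst A B c E T\<close> has the vertices \<open>A @ B\<close>, where \<open>A\<close> is a connected set that is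
  being grown to a component.\<close>

definition start :: "nat list \<Rightarrow> 'a \<Rightarrow> (nat \<Rightarrow> nat \<Rightarrow> bool) \<Rightarrow> (nat \<Rightarrow> nat \<Rightarrow> nat \<Rightarrow> nat \<Rightarrow> 'a) \<Rightarrow> 'a inst" where
  "start U c E T = Inst (take 1 U) (drop 1 U) c E T"

definition nbrs :: "(nat \<Rightarrow> nat \<Rightarrow> bool) \<Rightarrow> nat list \<Rightarrow> nat \<Rightarrow> nat list" where
  "nbrs E A v = filter (E v) A"

definition without :: "nat \<Rightarrow> nat list \<Rightarrow> nat list" where
  "without y B = filter (\<lambda>z. z \<noteq> y) B"

definition elim_adj :: "nat \<Rightarrow> (nat \<Rightarrow> nat \<Rightarrow> bool) \<Rightarrow> nat \<Rightarrow> nat \<Rightarrow> bool" where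
  "elim_adj v E x y \<longleftrightarrow> E x y \<or> (x \<noteq> y \<and> E v x \<and> E v y)"

definition frontier :: "(nat \<Rightarrow> nat \<Rightarrow> bool) \<Rightarrow> nat list \<Rightarrow> nat list \<Rightarrow> nat list" where
  "frontier E A B = filter (\<lambda>y. nbrs E A y \<noteq> []) B"

text \<open>Isolated vertices are left out, since an elimination needs a neighbour that takes the
  factor. They are handled by branching, where they form a component of their own.\<close>

definition low :: "(nat \<Rightarrow> nat \<Rightarrow> bool) \<Rightarrow> nat list \<Rightarrow> nat list" where
  "low E A = filter (\<lambda>v. nbrs E A v \<noteq> [] \<and> tl (tl (nbrs E A v)) = []) A"

definition tops :: "(nat \<Rightarrow> nat \<Rightarrow> bool) \<Rightarrow> nat list \<Rightarrow> nat list" where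
  "tops E A = filter (\<lambda>v. filter (\<lambda>u. length (nbrs E A v) < length (nbrs E A u)) A = []) A"

definition preferred :: "(nat \<Rightarrow> nat \<Rightarrow> bool) \<Rightarrow> nat list \<Rightarrow> nat list" where
  "preferred E A = filter (\<lambda>v. filter (\<lambda>w. length (nbrs E A w) < length (nbrs E A v)) (nbrs E A v) \<noteq> []) (tops E A)"

definition pick :: "(nat \<Rightarrow> nat \<Rightarrow> bool) \<Rightarrow> nat list \<Rightarrow> nat" where
  "pick E A = hd (if preferred E A \<noteq> [] then preferred E A else tops E A)"

text \<open>For a single neighbour the result is that neighbour, which produces the coding
  \<open>a = b\<close> of degree 1.\<close>

definition snd_nbr :: "nat list \<Rightarrow> nat" where
  "snd_nbr N = (if tl N = [] then hd N else hd (tl N))"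

definition eliminate :: "nat \<Rightarrow> nat \<Rightarrow> nat list \<Rightarrow> 'a \<Rightarrow> (nat \<Rightarrow> nat \<Rightarrow> bool) \<Rightarrow> (nat \<Rightarrow> nat \<Rightarrow> nat \<Rightarrow> nat \<Rightarrow> 'a::comm_ring_1) \<Rightarrow> 'a inst" where
  "eliminate k v A c E T = start (without v A) c (elim_adj v E) (elim_table k v (hd (nbrs E A v)) (snd_nbr (nbrs E A v)) T)"

definition branch :: "nat \<Rightarrow> nat list \<Rightarrow> 'a \<Rightarrow> (nat \<Rightarrow> nat \<Rightarrow> bool) \<Rightarrow> (nat \<Rightarrow> nat \<Rightarrow> nat \<Rightarrow> nat \<Rightarrow> 'a::comm_ring_1) \<Rightarrow> nat \<Rightarrow> 'a inst" where
  "branch v A c E T l = start (without v A) (c * T v v l l) E (branch_table v l T)"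

text \<open>The search for a component is spread over machine steps, one frontier vertex at a time.
  An expression could not iterate it, because loop bodies have no access to the set accumulated so
  far; the outer WHILE loop can. When the frontier is empty, \<open>A\<close> is a component and
  \<open>B\<close> is the rest.\<close>

fun expand :: "nat \<Rightarrow> 'a::comm_ring_1 inst \<Rightarrow> 'a item list" where
  "expand k (Inst A B c E T) =
    (if frontier E A B \<noteq> [] then [Task (Inst (hd (frontier E A B) # A) (without (hd (frontier E A B)) B) c E T)]
     else if B \<noteq> [] then [Task (start A c E T), Task (start B 1 E T), ProdMark]
     else if low E A \<noteq> [] then [Task (eliminate k (hd (low E A)) A c E T)]
     else map Task (map (branch (pick E A) A c E T) [0..<k]) @ [SumMark])"

text \<open>Evaluation in postorder: a mark waits below the subtasks whose values it will combine.
  These values arrive on the stack in reverse order, which neither a sum nor a product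
  notices.\<close>

fun mstep :: "nat \<Rightarrow> 'a::comm_ring_1 item list \<times> 'a list \<Rightarrow> 'a item list \<times> 'a list" where
  "mstep k (Task (Inst A B c E T) # ts, vs) = (if A = [] then (ts, c # vs) else (expand k (Inst A B c E T) @ ts, vs))"
| "mstep k (SumMark # ts, vs) = (ts, (\<Sum>i\<leftarrow>[0..<k]. vs ! i) # drop k vs)"
| "mstep k (ProdMark # ts, vs) = (ts, vs ! 0 * vs ! 1 # drop 2 vs)"
| "mstep k ([], vs) = ([], vs)"

fun verts :: "'a inst \<Rightarrow> nat list" where
  "verts (Inst A B c E T) = A @ B"

fun zval :: "nat \<Rightarrow> 'a::comm_ring_1 inst \<Rightarrow> 'a" where
  "zval k (Inst A B c E T) = zsum k (set A \<union> set B) c T"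

fun small :: "nat \<Rightarrow> 'a inst \<Rightarrow> bool" where
  "small n (Inst A B c E T) \<longleftrightarrow> distinct (A @ B) \<and> set (A @ B) \<subseteq> {..<n} \<and> (A = [] \<longrightarrow> B = [])"

fun okay :: "nat \<Rightarrow> nat \<Rightarrow> 'a item list \<times> 'a list \<Rightarrow> bool" where
  "okay n L (ts, vs) \<longleftrightarrow> length ts \<le> L \<and> length vs \<le> L \<and> (\<forall>I. Task I \<in> set ts \<longrightarrow> small n I)"

text \<open>\<open>vs ! i\<close> is unspecified beyond the end of the stack. Runs are restricted to
  states in which a mark finds all its operands, and there \<open>mstep\<close> can be matched by an
  expression.\<close>

fun ready :: "nat \<Rightarrow> 'a item list \<times> 'a list \<Rightarrow> bool" where
  "ready k (SumMark # ts, vs) \<longleftrightarrow> k \<le> length vs"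
| "ready k (ProdMark # ts, vs) \<longleftrightarrow> 2 \<le> length vs"
| "ready k (Task I # ts, vs) \<longleftrightarrow> True"
| "ready k ([], vs) \<longleftrightarrow> False"

inductive steps :: "nat \<Rightarrow> ('a::comm_ring_1 item list \<times> 'a list \<Rightarrow> bool) \<Rightarrow> nat \<Rightarrow> 'a item list \<times> 'a list \<Rightarrow> 'a item list \<times> 'a list \<Rightarrow> bool"
  for k P where
  steps_refl: "P s \<Longrightarrow> steps k P 0 s s"
| steps_step: "P s \<Longrightarrow> ready k s \<Longrightarrow> steps k P N (mstep k s) t \<Longrightarrow> steps k P (Suc N) s t"

lemma steps_trans: "steps k P N s t \<Longrightarrow> steps k P N' t u \<Longrightarrow> steps k P (N + N') s u"
  by (induction rule: steps.induct) (auto intro: steps_step)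

lemma steps_one: "P s \<Longrightarrow> ready k s \<Longrightarrow> mstep k s = t \<Longrightarrow> P t \<Longrightarrow> steps k P 1 s t"
  by (auto intro: steps.intros)

text \<open>This is the contract of a subroutine call: whatever lies below on the two stacks stays
  untouched, and at no time does either stack exceed it by more than \<open>g\<close>. Bounding all
  intermediate states is what gives polynomial space.\<close>

definition solves :: "nat \<Rightarrow> nat \<Rightarrow> 'a::comm_ring_1 inst \<Rightarrow> nat \<Rightarrow> nat \<Rightarrow> bool" where
  "solves k n I N g \<longleftrightarrow> (\<forall>ts vs L. okay n (L - g) (ts, vs) \<and> g \<le> L \<longrightarrow>
     steps k (okay n L) N (Task I # ts, vs) (ts, zval k I # vs))"

text \<open>The extra \<open>length Is\<close> makes room for the subtasks that still wait and for
  the values already delivered; every finished subtask turns one into the other.\<close>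

lemma solves_tasks:
  assumes "\<And>I. I \<in> set Is \<Longrightarrow> solves k n I (N I) g \<and> small n I" "1 \<le> g"
    "okay n (L - (g + length Is)) (ts, vs)" "g + length Is \<le> L"
  shows "steps k (okay n L) (\<Sum>I\<leftarrow>Is. N I) (map Task Is @ ts, vs) (ts, rev (map (zval k) Is) @ vs)"
  using assms
proof (induction Is arbitrary: vs g)
  case Nil
  then show ?case by (auto intro!: steps_refl)
next
  case (Cons I Is)
  have ok: "okay n (L - g) (map Task Is @ ts, vs)"
    using Cons.prems by auto
  have "steps k (okay n L) (N I) (Task I # map Task Is @ ts, vs) (map Task Is @ ts, zval k I # vs)"
    using Cons.prems(1)[of I] ok Cons.prems(4) unfolding solves_def by auto
  moreover have "steps k (okay n L) (\<Sum>I\<leftarrow>Is. N I) (map Task Is @ ts, zval k I # vs) (ts, rev (map (zval k) Is) @ (zval k I # vs))"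
    by (rule Cons.IH[of g]) (use Cons.prems in auto)
  ultimately show ?case using steps_trans by fastforce
qed

lemma solves_mono: "solves k n I N g \<Longrightarrow> g \<le> g' \<Longrightarrow> solves k n I N g'"
proof -
  assume s: "solves k n I N g" and g: "g \<le> g'"
  have "okay n (L - g) x" if "okay n (L - g') x" for x :: "'a item list \<times> 'a list" and L
    using that g by (cases x) auto
  then show "solves k n I N g'" using s g unfolding solves_def by (meson le_trans)
qed

lemma solves_single:
  assumes "small n (Inst A B c E T)" "A \<noteq> []" "expand k (Inst A B c E T) = [Task I]"
    "solves k n I N g" "zval k I = zval k (Inst A B c E T)" "1 \<le> g"
  shows "solves k n (Inst A B c E T) (Suc N) g"
  unfolding solves_def
proof (intro allI impI, elim conjE)
  fix ts L and vs :: "'a list"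
  assume ok: "okay n (L - g) (ts, vs)" "g \<le> L"
  show "steps k (okay n L) (Suc N) (Task (Inst A B c E T) # ts, vs) (ts, zval k (Inst A B c E T) # vs)"
  proof (rule steps_step)
    show "okay n L (Task (Inst A B c E T) # ts, vs)"
      using ok assms(1,6) unfolding okay.simps by auto
    show "steps k (okay n L) N (mstep k (Task (Inst A B c E T) # ts, vs)) (ts, zval k (Inst A B c E T) # vs)"
      using assms(2-5) ok unfolding solves_def by (simp del: expand.simps zval.simps)
  qed simp
qed

text \<open>The two extra steps expand the task and execute the mark.\<close>

lemma solves_node:
  assumes "small n (Inst A B c E T)" "A \<noteq> []" "expand k (Inst A B c E T) = map Task Is @ [m]"
    and Is: "\<And>I. I \<in> set Is \<Longrightarrow> solves k n I (N I) g' \<and> small n I" "1 \<le> g'"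
    and g: "g' + length Is + 1 \<le> g"
    and m: "\<And>ts vs. mstep k (m # ts, rev (map (zval k) Is) @ vs) = (ts, zval k (Inst A B c E T) # vs)"
    and r: "\<And>ts vs. ready k (m # ts, rev (map (zval k) Is) @ vs)"
    and nt: "\<And>I. m \<noteq> Task I"
  shows "solves k n (Inst A B c E T) ((\<Sum>I\<leftarrow>Is. N I) + 2) g"
  unfolding solves_def
proof (intro allI impI, elim conjE)
  fix ts L and vs :: "'a list"
  assume ok: "okay n (L - g) (ts, vs)" "g \<le> L"
  let ?I = "Inst A B c E T"
  have mm: "m = SumMark \<or> m = ProdMark" using nt by (cases m) auto
  have s1: "steps k (okay n L) 1 (Task ?I # ts, vs) (map Task Is @ m # ts, vs)"
    by (rule steps_one) (use ok g assms(1-3) Is mm in \<open>auto simp: okay.simps simp del: expand.simps\<close>)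
  have s2: "steps k (okay n L) (\<Sum>I\<leftarrow>Is. N I) (map Task Is @ m # ts, vs) (m # ts, rev (map (zval k) Is) @ vs)"
    by (rule solves_tasks[of _ _ _ _ g']) (use ok g Is mm in \<open>auto simp: okay.simps\<close>)
  have s3: "steps k (okay n L) 1 (m # ts, rev (map (zval k) Is) @ vs) (ts, zval k ?I # vs)"
    by (rule steps_one) (use ok g m Is r mm in \<open>auto simp: okay.simps\<close>)
  show "steps k (okay n L) ((\<Sum>I\<leftarrow>Is. N I) + 2) (Task ?I # ts, vs) (ts, zval k ?I # vs)"
    using steps_trans[OF steps_trans[OF s1 s2] s3] by simp
qed

lemma solves_leaf: "small n (Inst [] [] c E T) \<Longrightarrow> 1 \<le> g \<Longrightarrow> solves k n (Inst [] [] c E T) 1 g"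
  unfolding solves_def
  by (intro allI impI steps_one) (auto simp: okay.simps zsum_def weight_def)

section \<open>Invariant, step count and stack height\<close>

fun consistent :: "nat \<Rightarrow> 'a::comm_ring_1 inst \<Rightarrow> bool" where
  "consistent k (Inst A B c E T) \<longleftrightarrow> (\<forall>x y. E x y \<longrightarrow> E y x) \<and> (\<forall>x. \<not> E x x) \<and> conn E (set A) \<and>
     (\<forall>x\<in>set (A @ B). \<forall>y\<in>set (A @ B). \<forall>i<k. \<forall>j<k. x \<noteq> y \<and> \<not> E x y \<longrightarrow> T x y i j = 1)"

fun inst_measure_le :: "'a inst \<Rightarrow> real \<Rightarrow> bool" where
  "inst_measure_le (Inst A B c E T) b \<longleftrightarrow> measure_le (set (A @ B)) E b"

text \<open>This is both the induction measure and the polynomial factor of the step count.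
  \<open>length B\<close> pays for growing \<open>A\<close>. The square is superadditive, with room
  for the two steps of a split, and its decrease when a vertex is removed pays for
  \<open>start\<close> refilling \<open>B\<close>.\<close>

fun rank :: "'a inst \<Rightarrow> nat" where
  "rank (Inst A B c E T) = 3 * (length A + length B)\<^sup>2 + length B + 1"

text \<open>The subproblems of a split or a branching have at least one vertex less, which releases
  \<open>k + 2\<close> stack entries. A branching needs \<open>k + 1\<close> of them, for its
  subtasks and the mark. A split needs 3, and this is at most \<open>k + 2\<close> because the
  domain is nonempty.\<close>

definition height :: "nat \<Rightarrow> nat \<Rightarrow> nat" where
  "height k u = 1 + u * (k + 2)"

lemma height_mono: "u \<le> u' \<Longrightarrow> height k u \<le> height k u'"
  unfolding height_def by (intro add_mono mult_le_mono) auto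

lemma start_facts:
  "small n (start U c E T) \<longleftrightarrow> distinct U \<and> set U \<subseteq> {..<n}"
  "zval k (start U c E T) = zsum k (set U) c T"
  "inst_measure_le (start U c E T) b \<longleftrightarrow> measure_le (set U) E b"
  "length (verts (start U c E T)) = length U"
  "rank (start U c E T) = 3 * (length U)\<^sup>2 + (length U - 1) + 1"
  by (cases U; auto simp: start_def)+

lemma consistent_start:
  "(\<And>x y. E x y \<Longrightarrow> E y x) \<Longrightarrow> (\<And>x. \<not> E x x) \<Longrightarrow>
   (\<And>x y i j. x \<in> set U \<Longrightarrow> y \<in> set U \<Longrightarrow> i < k \<Longrightarrow> j < k \<Longrightarrow> x \<noteq> y \<Longrightarrow> \<not> E x y \<Longrightarrow> T x y i j = 1) \<Longrightarrow>
   consistent k (start U c E T)"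
  by (cases U) (auto simp: start_def conn_singleton conn_def)

lemma set_without [simp]: "set (without v A) = set A - {v}"
  by (auto simp: without_def)

lemma distinct_without [simp]: "distinct A \<Longrightarrow> distinct (without v A)"
  by (simp add: without_def)

lemma length_without: "distinct A \<Longrightarrow> v \<in> set A \<Longrightarrow> length (without v A) = length A - 1"
  by (metis distinct_card distinct_without set_without card_Diff_singleton)

lemma set_nbrs [simp]: "set (nbrs E A v) = {u \<in> set A. E v u}"
  by (auto simp: nbrs_def)

lemma length_nbrs: "distinct A \<Longrightarrow> length (nbrs E A v) = deg E (set A) v"
  using distinct_card[of "nbrs E A v"] by (simp add: nbrs_def deg_def)

lemma hd_filter: "filter P xs \<noteq> [] \<Longrightarrow> hd (filter P xs) \<in> set xs \<and> P (hd (filter P xs))"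
  using hd_in_set[of "filter P xs"] by auto


text \<open>A neighbour of \<open>v\<close> loses \<open>v\<close> and gains at most the other
  neighbour of \<open>v\<close>; no other vertex is affected.\<close>

lemma deg_elim:
  assumes sym: "\<And>x y. E x y \<Longrightarrow> E y x" and fin: "finite U" and v: "v \<in> U" "{u \<in> U. E v u} = {a, b}"
    and x: "x \<in> U - {v}"
  shows "deg (elim_adj v E) (U - {v}) x \<le> deg E U x"
proof (cases "E v x")
  case False
  then show ?thesis unfolding deg_def elim_adj_def using fin by (intro card_mono) auto
next
  case True
  let ?X = "{u \<in> U. E x u}"
  have "x \<in> {a, b}" using True x v by auto
  then obtain c where c: "{a, b} - {x} \<subseteq> {c}" by auto
  have vX: "v \<in> ?X" using True sym v(1) by auto
  have "{u \<in> U - {v}. elim_adj v E x u} \<subseteq> (?X - {v}) \<union> ({a, b} - {x})"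
    using v(2) unfolding elim_adj_def by blast
  also have "\<dots> \<subseteq> insert c (?X - {v})" using c by blast
  finally have "card {u \<in> U - {v}. elim_adj v E x u} \<le> card (insert c (?X - {v}))"
    using fin by (intro card_mono) auto
  also have "\<dots> \<le> Suc (card (?X - {v}))" by (rule card_insert_le_m1) (auto simp: fin)
  also have "\<dots> = card ?X" by (rule card_Suc_Diff1) (use fin vX in auto)
  finally show ?thesis unfolding deg_def .
qed

lemma low_facts:
  assumes "low E A \<noteq> []" "v = hd (low E A)" "N = nbrs E A v" "a = hd N" "b = snd_nbr N"
  shows "v \<in> set A" "{u \<in> set A. E v u} = {a, b}"
proof -
  have "v \<in> set A \<and> N \<noteq> [] \<and> tl (tl N) = []"
    using hd_filter[OF assms(1)[unfolded low_def]] assms(2,3) unfolding low_def by simp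
  then have "v \<in> set A" "set N = {a, b}"
    unfolding assms(4,5) snd_nbr_def by (cases N; cases "tl N"; auto)+
  then show "v \<in> set A" "{u \<in> set A. E v u} = {a, b}" using assms(3) by auto
qed

lemma pick_facts:
  assumes "distinct A" "A \<noteq> []" "conn E (set A)"
  defines "v \<equiv> pick E A"
  shows "v \<in> set A" "\<And>x. x \<in> set A \<Longrightarrow> deg E (set A) x \<le> deg E (set A) v"
    "(\<exists>w\<in>set A. E v w \<and> deg E (set A) w < deg E (set A) v) \<or> (\<forall>x\<in>set A. deg E (set A) x = deg E (set A) v)"
proof -
  let ?D = "deg E (set A)"
  have tops: "set (tops E A) = {v \<in> set A. \<forall>u\<in>set A. ?D u \<le> ?D v}"
    unfolding tops_def by (auto simp: filter_empty_conv length_nbrs[OF assms(1)] not_less)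
  have pref: "set (preferred E A) = {v \<in> set (tops E A). \<exists>w\<in>set A. E v w \<and> ?D w < ?D v}"
    unfolding preferred_def by (auto simp: filter_empty_conv length_nbrs[OF assms(1)])
  obtain m where "m \<in> set A" "\<forall>u\<in>set A. ?D u \<le> ?D m"
    using obtains_MAX[of "set A" ?D] assms(2) by (metis List.finite_set Max_ge finite_imageI imageI set_empty)
  then have "tops E A \<noteq> []" using tops by force
  then have "v \<in> set (tops E A) \<and> (preferred E A = [] \<or> v \<in> set (preferred E A))"
    unfolding v_def pick_def using hd_in_set[of "tops E A"] hd_in_set[of "preferred E A"] pref by auto
  then have v: "v \<in> set (tops E A)" "preferred E A = [] \<or> v \<in> set (preferred E A)" by auto
  show 1: "v \<in> set A" and 2: "\<And>x. x \<in> set A \<Longrightarrow> ?D x \<le> ?D v" using v(1) tops by auto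
  show "(\<exists>w\<in>set A. E v w \<and> ?D w < ?D v) \<or> (\<forall>x\<in>set A. ?D x = ?D v)"
  proof (cases "preferred E A = []")
    case True
    have "\<not> ?D w < ?D v" if "x \<in> set A" "?D x = ?D v" "w \<in> set A" "E x w" for x w
    proof
      assume "?D w < ?D v"
      then have "x \<in> set (preferred E A)" using that 2 unfolding pref tops by auto
      with True show False by simp
    qed
    then show ?thesis using conn_branch_pref[OF assms(3) 1 2] by blast
  next
    case False
    then show ?thesis using v(2) pref by auto
  qed
qed

lemma Suc_le_powr:
  assumes "1 \<le> (k::real)" "real N \<le> real p * k powr c" "1 \<le> c" "p + 1 \<le> q"
  shows "real (Suc N) \<le> real q * k powr c"
proof -
  have "1 \<le> k powr c" using assms by (simp add: ge_one_powr_ge_zero)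
  moreover have "real (p + 1) * k powr c \<le> real q * k powr c"
    using assms by (intro mult_right_mono) auto
  ultimately show ?thesis using assms by (simp add: distrib_right)
qed

text \<open>The exponent is \<open>b + 1\<close> because a component that consists of one vertex is
  branched on without any decrease of the measure. Its subinstances are empty, so this extra factor
  \<open>k\<close> occurs at most once on each path of the recursion, and across a split the step
  counts only add up.\<close>

theorem solve:
  assumes k: "1 \<le> k" and "small n I" "consistent k I" "inst_measure_le I b"
  shows "\<exists>N. solves k n I N (height k (length (verts I))) \<and> real N \<le> real (rank I) * real k powr (b + 1)"
  using assms(2-4)
proof (induction "rank I" arbitrary: I b rule: less_induct)
  case less
  obtain A B c E T where I: "I = Inst A B c E T" by (cases I)
  let ?K = "real k powr (b + 1)" and ?h = "height k (length (verts I))"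
  have dist: "distinct A" "distinct B" "set A \<inter> set B = {}" "distinct (A @ B)"
    and sub: "set A \<subseteq> {..<n}" "set B \<subseteq> {..<n}" and AB: "A = [] \<Longrightarrow> B = []"
    and sym: "\<And>x y. E x y \<Longrightarrow> E y x" and irr: "\<And>x. \<not> E x x" and conn: "conn E (set A)"
    and one: "\<And>x y i j. x \<in> set (A @ B) \<Longrightarrow> y \<in> set (A @ B) \<Longrightarrow> i < k \<Longrightarrow> j < k \<Longrightarrow> x \<noteq> y \<Longrightarrow> \<not> E x y \<Longrightarrow> T x y i j = 1"
    and meas: "measure_le (set (A @ B)) E b"
    using less.prems unfolding I by auto
  note small = less.prems(1)[unfolded I]
  have b0: "0 \<le> b" using measure_le_nonneg[OF meas] .
  have K1: "1 \<le> ?K" using k b0 by (simp add: ge_one_powr_ge_zero)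
  have k1: "1 \<le> real k" using k by simp
  have h1: "1 \<le> ?h" by (simp add: height_def)
  consider (leaf) "A = []" | (grow) "A \<noteq> []" "frontier E A B \<noteq> []"
    | (split) "A \<noteq> []" "frontier E A B = []" "B \<noteq> []"
    | (elim) "A \<noteq> []" "B = []" "low E A \<noteq> []"
    | (branch) "A \<noteq> []" "B = []" "low E A = []" by blast
  then show ?case
  proof cases
    case leaf
    then have I': "I = Inst [] [] c E T" using AB I by simp
    have "solves k n I 1 ?h" unfolding I' by (rule solves_leaf) (use h1 I' in auto)
    then show ?thesis using K1 I' by (intro exI[of _ 1]) simp
  next
    case grow
    let ?y = "hd (frontier E A B)"
    let ?I = "Inst (?y # A) (without ?y B) c E T"
    have y: "?y \<in> set B" "nbrs E A ?y \<noteq> []"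
      using hd_filter[OF grow(2)[unfolded frontier_def]] unfolding frontier_def by auto
    then obtain x where x: "x \<in> set A" "E ?y x"
      by (metis (no_types, lifting) filter_empty_conv nbrs_def)
    have set: "set (?y # A @ without ?y B) = set (A @ B)" using y(1) dist(3) by auto
    have len: "length B = Suc (length (without ?y B))"
      using length_without[OF dist(2) y(1)] y(1) by (cases B) auto
    have "\<exists>N. solves k n ?I N (height k (length (verts ?I))) \<and> real N \<le> real (rank ?I) * ?K"
    proof (rule less.hyps)
      show "rank ?I < rank I" unfolding I using len by simp
      show "small n ?I" using dist sub y by auto
      show "consistent k ?I"
        using sym irr one set conn_insert[OF conn x(1) sym[OF x(2)]] sym by auto
      show "inst_measure_le ?I b" using meas set by simp
    qed
    moreover have "length (verts ?I) = length (verts I)" unfolding I using len by simp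
    ultimately obtain N where N: "solves k n ?I N ?h" "real N \<le> real (rank ?I) * ?K" by auto
    have "solves k n I (Suc N) ?h" unfolding I
    proof (rule solves_single[OF small grow(1)])
      show "expand k (Inst A B c E T) = [Task ?I]" using grow by simp
      show "solves k n ?I N (height k (length (verts (Inst A B c E T))))" using N(1) I by simp
      show "zval k ?I = zval k (Inst A B c E T)" using set by (simp only: zval.simps) (simp add: Un_ac(3))
      show "1 \<le> height k (length (verts (Inst A B c E T)))" using h1 I by simp
    qed
    moreover have "real (Suc N) \<le> real (rank I) * ?K"
      by (rule Suc_le_powr[OF k1 N(2)]) (use b0 len I in auto)
    ultimately show ?thesis by blast
  next
    case split
    let ?A = "start A c E T" and ?B = "start B 1 E T"
    have noE: "\<not> E x y" if "x \<in> set A" "y \<in> set B" for x y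
      using split(2) that sym unfolding frontier_def nbrs_def by (auto simp: filter_empty_conv)
    have lenA: "1 \<le> length A" and lenB: "1 \<le> length B" using split by (auto simp: Suc_le_eq)
    have rk: "rank ?A + rank ?B + 2 \<le> rank I"
    proof -
      \<comment> \<open>The mixed term of 3 (a + b)^2 is 6 a b. It has to cover the two additional
        steps and the linear terms of both parts.\<close>
      have "length A + 1 \<le> 6 * (length A * length B)"
        using lenA lenB by (cases "length A"; cases "length B") auto
      then show ?thesis unfolding start_facts I using lenA lenB
        by (simp add: power2_eq_square algebra_simps)
    qed
    let ?h' = "height k (length A + length B - 1)"
    have "\<exists>N. solves k n J N ?h' \<and> real N \<le> real (rank J) * ?K" and J': "small n J"
      if J: "J = start X e E T" "X = A \<or> X = B" for X e J
    proof -
      have X: "length X \<le> length A + length B - 1" "set X \<subseteq> set (A @ B)" "distinct X"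
        using J(2) lenA lenB dist by auto
      show small: "small n J" using X sub unfolding J(1) start_facts by auto
      have "\<exists>N. solves k n J N (height k (length (verts J))) \<and> real N \<le> real (rank J) * ?K"
      proof (rule less.hyps[OF _ small])
        have "rank J = rank ?A \<or> rank J = rank ?B" using J by (auto simp: start_facts)
        then show "rank J < rank I" using rk by linarith
        show "consistent k J" unfolding J(1)
          by (rule consistent_start[OF sym irr one]) (use X(2) in auto)
        show "inst_measure_le J b" unfolding J(1) start_facts
          by (rule measure_le_mono[OF meas]) (use X(2) in \<open>auto intro!: deg_mono\<close>)
      qed
      moreover have "height k (length (verts J)) \<le> ?h'"
        using X(1) unfolding J(1) start_facts by (rule height_mono)
      ultimately show "\<exists>N. solves k n J N ?h' \<and> real N \<le> real (rank J) * ?K"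
        using solves_mono by blast
    qed note J = this
    then have "\<forall>J\<in>set [?A, ?B]. \<exists>N. solves k n J N ?h' \<and> real N \<le> real (rank J) * ?K"
      by auto
    then obtain N where N: "\<And>J. J \<in> set [?A, ?B] \<Longrightarrow> solves k n J (N J) ?h' \<and> real (N J) \<le> real (rank J) * ?K"
      by metis
    have "solves k n I ((\<Sum>J\<leftarrow>[?A, ?B]. N J) + 2) ?h" unfolding I
    proof (rule solves_node[OF small split(1)])
      show "expand k (Inst A B c E T) = map Task [?A, ?B] @ [ProdMark]" using split by simp
      show "solves k n J (N J) ?h' \<and> small n J" if "J \<in> set [?A, ?B]" for J
        using N[OF that] J' that by auto
      show "1 \<le> ?h'" by (simp add: height_def)
      show "?h' + length [?A, ?B] + 1 \<le> height k (length (verts (Inst A B c E T)))"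
        using lenA k by (cases "length A") (auto simp: height_def)
      have "zsum k (set A \<union> set B) c T = zsum k (set A) c T * zsum k (set B) 1 T"
      proof (rule zsum_union)
        fix x y i j assume xy: "x \<in> set A" "y \<in> set B" "i < k" "j < k"
        then have "x \<noteq> y" "\<not> E x y" "\<not> E y x" using dist(3) noE[of x y] sym by auto
        then show "T x y i j = 1 \<and> T y x i j = 1" using one xy by auto
      qed (use dist(3) in auto)
      then show "mstep k (ProdMark # ts, rev (map (zval k) [?A, ?B]) @ vs) = (ts, zval k (Inst A B c E T) # vs)" for ts vs
        by (simp add: start_facts mult.commute)
    qed simp_all
    moreover have "real ((\<Sum>J\<leftarrow>[?A, ?B]. N J) + 2) \<le> real (rank I) * ?K"
    proof -
      have "real ((\<Sum>J\<leftarrow>[?A, ?B]. N J) + 2) \<le> real (rank ?A) * ?K + real (rank ?B) * ?K + 2 * ?K"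
        using N[of ?A] N[of ?B] K1 by simp
      also have "\<dots> = real (rank ?A + rank ?B + 2) * ?K" by (simp add: distrib_right)
      also have "\<dots> \<le> real (rank I) * ?K" using rk by (intro mult_right_mono) auto
      finally show ?thesis .
    qed
    ultimately show ?thesis by blast
  next
    case elim
    define v where "v = hd (low E A)"
    define a where "a = hd (nbrs E A v)"
    define b' where "b' = snd_nbr (nbrs E A v)"
    note v = low_facts[OF elim(3) v_def refl a_def b'_def]
    let ?E = "elim_adj v E" and ?T = "elim_table k v a b' T" and ?U = "without v A"
    let ?I = "start ?U c ?E ?T"
    have ab: "a \<in> set A - {v}" "b' \<in> set A - {v}" "E v a" "E v b'" using v irr by auto
    have "\<exists>N. solves k n ?I N (height k (length (verts ?I))) \<and> real N \<le> real (rank ?I) * ?K"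
    proof (rule less.hyps)
      show "rank ?I < rank I" unfolding start_facts I
        using length_without[OF dist(1) v(1)] elim by (cases "length A") (auto simp: power2_eq_square)
      show "small n ?I" using dist sub by (auto simp: start_facts)
      show "consistent k ?I"
      proof (rule consistent_start)
        fix x y i j assume "x \<in> set ?U" "y \<in> set ?U" "i < k" "j < k" "x \<noteq> y" "\<not> ?E x y"
        then show "?T x y i j = 1"
          using one[of x y i j] ab by (auto simp: elim_adj_def elim_table_def)
      qed (use sym irr in \<open>auto simp: elim_adj_def\<close>)
      show "inst_measure_le ?I b" unfolding start_facts set_without
        by (rule measure_le_mono[OF meas]) (use elim(2) deg_elim[of E, OF sym _ v] in auto)
    qed
    moreover have "height k (length (verts ?I)) \<le> ?h"
      unfolding start_facts I using length_without[OF dist(1) v(1)] by (intro height_mono) simp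
    ultimately obtain N where N: "solves k n ?I N ?h" "real N \<le> real (rank ?I) * ?K"
      using solves_mono by blast
    have "solves k n I (Suc N) ?h" unfolding I
    proof (rule solves_single[OF small elim(1)])
      show "expand k (Inst A B c E T) = [Task ?I]"
        using elim by (simp add: frontier_def eliminate_def v_def a_def b'_def)
      show "solves k n ?I N (height k (length (verts (Inst A B c E T))))" using N(1) I by simp
      have "zsum k (insert v (set A - {v})) c T = zsum k (set A - {v}) c ?T"
      proof (rule zsum_elim)
        fix x i j assume x: "x \<in> set A - {v} - {a, b'}" "i < k" "j < k"
        then have "\<not> E v x" "\<not> E x v" using v(2) sym by auto
        then show "T v x i j = 1 \<and> T x v i j = 1" using one x v(1) by auto
      qed (use ab in auto)
      then show "zval k ?I = zval k (Inst A B c E T)" 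
        unfolding start_facts using v(1) elim(2) by (simp add: insert_absorb)
      show "1 \<le> height k (length (verts (Inst A B c E T)))" using h1 I by simp
    qed
    moreover have "real (Suc N) \<le> real (rank I) * ?K"
    proof (rule Suc_le_powr[OF k1 N(2)])
      show "rank ?I + 1 \<le> rank I" unfolding start_facts I
        using length_without[OF dist(1) v(1)] elim by (cases "length A") (auto simp: power2_eq_square)
    qed (use b0 in auto)
    ultimately show ?thesis by blast
  next
    case branch
    define v where "v = pick E A"
    note v = pick_facts[OF dist(1) branch(1) conn, folded v_def]
    let ?U = "without v A" and ?h' = "height k (length A - 1)"
    let ?J = "\<lambda>l. branch v A c E T l" and ?r = "3 * (length A - 1)\<^sup>2 + (length A - 2) + 1"
    have lenU: "length ?U = length A - 1" using length_without[OF dist(1) v(1)] .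
    have J: "small n (?J l)" "rank (?J l) = ?r" for l
      using dist sub unfolding branch_def start_facts by (auto simp: lenU)
    have "\<exists>N. solves k n (?J l) N ?h' \<and> real N \<le> real ?r * real k powr b" if l: "l < k" for l
    proof (cases "set A = {v}")
      case True
      \<comment> \<open>Here the measure cannot be lowered, but the subinstance is empty and takes a
        single step, which fits under the bound with exponent \<open>b\<close>.\<close>
      then have "?U = []" by (metis Diff_cancel set_empty set_without)
      then have leaf: "?J l = Inst [] [] (c * T v v l l) E (branch_table v l T)"
        by (simp add: branch_def start_def)
      have "solves k n (?J l) 1 ?h'" unfolding leaf by (rule solves_leaf) (auto simp: height_def)
      moreover have "1 \<le> real ?r * real k powr b"
        using mult_mono[of 1 "real ?r" 1 "real k powr b"] k b0 by (simp add: ge_one_powr_ge_zero)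
      ultimately show ?thesis by (intro exI[of _ 1]) simp
    next
      case False
      \<comment> \<open>Connectedness rules out degree 0, and the empty list \<open>low E A\<close>
        rules out degrees 1 and 2.\<close>
      have deg3: "3 \<le> deg E (set A) x" if x: "x \<in> set A" for x
      proof -
        have "set A \<noteq> {x}" using False v(1) by auto
        then have "1 \<le> deg E (set A) x" using conn_deg_pos[OF conn _ x] by simp
        then have "nbrs E A x \<noteq> []" using length_nbrs[OF dist(1), of E x] by auto
        then have "tl (tl (nbrs E A x)) \<noteq> []" using branch(3) x unfolding low_def filter_empty_conv by blast
        then show ?thesis unfolding length_nbrs[OF dist(1), symmetric]
          by (cases "nbrs E A x"; cases "tl (nbrs E A x)"; cases "tl (tl (nbrs E A x))") auto
      qed
      have "\<exists>N. solves k n (?J l) N (height k (length (verts (?J l)))) \<and> 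
         real N \<le> real (rank (?J l)) * real k powr (b - 1 + 1)"
      proof (rule less.hyps)
        show "rank (?J l) < rank I" unfolding J I
          using branch by (cases "length A") (auto simp: power2_eq_square)
        show "small n (?J l)" by (rule J)
        show "consistent k (?J l)" unfolding branch_def
          by (rule consistent_start) (use sym irr one in \<open>auto simp: branch_table_def\<close>)
        show "inst_measure_le (?J l) (b - 1)" unfolding branch_def start_facts set_without
          by (rule measure_le_branch[of _ E, OF _ sym irr deg3 v]) (use meas branch(2) in auto)
      qed
      moreover have "height k (length (verts (?J l))) = ?h'"
        unfolding branch_def start_facts lenU ..
      ultimately show ?thesis unfolding J by simp
    qed
    then have "\<forall>l\<in>{..<k}. \<exists>N. solves k n (?J l) N ?h' \<and> real N \<le> real ?r * real k powr b" by auto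
    then have "\<forall>J'\<in>?J ` {..<k}. \<exists>N. solves k n J' N ?h' \<and> real N \<le> real ?r * real k powr b" by blast
    then obtain N where N: "\<And>J'. J' \<in> ?J ` {..<k} \<Longrightarrow> solves k n J' (N J') ?h' \<and> real (N J') \<le> real ?r * real k powr b"
      by metis
    let ?Is = "map ?J [0..<k]"
    have lenA: "1 \<le> length A" using branch(1) by (simp add: Suc_le_eq)
    have "solves k n I ((\<Sum>J\<leftarrow>?Is. N J) + 2) ?h" unfolding I
    proof (rule solves_node[OF small branch(1)])
      show "expand k (Inst A B c E T) = map Task ?Is @ [SumMark]"
        using branch by (simp add: frontier_def v_def)
      show "solves k n J' (N J') ?h' \<and> small n J'" if "J' \<in> set ?Is" for J'
        using N[of J'] J that by auto
      show "1 \<le> ?h'" by (simp add: height_def)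
      show "?h' + length ?Is + 1 \<le> height k (length (verts (Inst A B c E T)))"
        using lenA branch(2) by (cases "length A") (auto simp: height_def)
      let ?zs = "rev (map (zval k) ?Is)"
      have "(\<Sum>i\<leftarrow>[0..<k]. (?zs @ vs) ! i) = zsum k (set A) c T" for vs
      proof -
        have "map (\<lambda>i. (?zs @ vs) ! i) [0..<k] = ?zs"
          by (rule nth_equalityI) (auto simp: nth_append)
        then have "(\<Sum>i\<leftarrow>[0..<k]. (?zs @ vs) ! i) = sum_list (map (zval k) ?Is)"
          by (simp only: sum_list_rev)
        also have "\<dots> = (\<Sum>l<k. zsum k (set A - {v}) (c * T v v l l) (branch_table v l T))"
          by (simp add: branch_def start_facts comp_def interv_sum_list_conv_sum_set_nat atLeast0LessThan)
        also have "\<dots> = zsum k (set A) c T"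
          using zsum_branch[of v "set A - {v}" k c T] v(1) by (simp add: insert_absorb)
        finally show ?thesis .
      qed
      then show "mstep k (SumMark # ts, ?zs @ vs) = (ts, zval k (Inst A B c E T) # vs)" for ts vs
        using branch(2) by simp
    qed simp_all
    moreover have "real ((\<Sum>J\<leftarrow>?Is. N J) + 2) \<le> real (rank I) * ?K"
    proof -
      \<comment> \<open>The \<open>k\<close> subinstances with exponent \<open>b\<close> together
        reach exponent \<open>b + 1\<close>; the steps for expanding and summing are absorbed by the
        decrease of \<open>rank\<close>.\<close>
      have "(\<Sum>J\<leftarrow>?Is. real (N J)) \<le> (\<Sum>J\<leftarrow>?Is. real ?r * real k powr b)"
        by (rule sum_list_mono) (use N in auto)
      also have "\<dots> = real ?r * (real k * real k powr b)"
        by (simp only: sum_list_triv length_map length_upt diff_zero mult.left_commute)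
      also have "real k * real k powr b = ?K" using k by (simp add: powr_add)
      finally have "real ((\<Sum>J\<leftarrow>?Is. N J) + 2) \<le> real ?r * ?K + 2 * ?K"
        using K1 by (simp add: sum_list_of_nat[symmetric] comp_def)
      also have "\<dots> = real (?r + 2) * ?K" by (simp add: distrib_right)
      also have "\<dots> \<le> real (rank I) * ?K"
        using lenA branch(2) unfolding I by (intro mult_right_mono) (cases "length A"; auto simp: power2_eq_square)+
      finally show ?thesis .
    qed
    ultimately show ?thesis by blast
  qed
qed

section \<open>Expressions for the steps of the machine\<close>

abbreviation NulE :: expr where "NulE \<equiv> Const CNull"
abbreviation TruE :: expr where "TruE \<equiv> Binary BPair NulE NulE"
abbreviation FstE :: "expr \<Rightarrow> expr" where "FstE \<equiv> Unary UFirst"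
abbreviation SndE :: "expr \<Rightarrow> expr" where "SndE \<equiv> Unary USecond"
abbreviation PairE :: "expr \<Rightarrow> expr \<Rightarrow> expr" where "PairE \<equiv> Binary BPair"
abbreviation MultE :: "expr \<Rightarrow> expr \<Rightarrow> expr" where "MultE \<equiv> Binary BMult"
abbreviation NotE :: "expr \<Rightarrow> expr" where "NotE e \<equiv> Ite e NulE TruE"
abbreviation AndE :: "expr \<Rightarrow> expr \<Rightarrow> expr" where "AndE a b \<equiv> Ite a b NulE"
abbreviation OrE :: "expr \<Rightarrow> expr \<Rightarrow> expr" where "OrE a b \<equiv> Ite a TruE b"

text \<open>Numbers are unary lists, so dropping is at once indexing and comparison: the result is
  not \<open>Null\<close> exactly when the list \<open>l\<close> is longer than \<open>i\<close>.
  Degrees are compared in this way directly on neighbour lists.\<close>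

definition DropE :: "expr \<Rightarrow> expr \<Rightarrow> expr" where "DropE i l = Loop LTail l i NulE"
definition NthE :: "expr \<Rightarrow> expr \<Rightarrow> expr" where "NthE l i = FstE (DropE i l)"
definition RevE :: "expr \<Rightarrow> expr" where "RevE l = Loop LCons NulE l (Var 0)"
text \<open>A left fold that conses reverses its list, hence the outer \<open>RevE\<close>.\<close>

definition MapE :: "expr \<Rightarrow> expr \<Rightarrow> expr" where "MapE l b = RevE (Loop LCons NulE l b)"
definition FilterE :: "expr \<Rightarrow> expr \<Rightarrow> expr" where "FilterE l b = RevE (Loop LFilter NulE l b)"
definition AppendE :: "expr \<Rightarrow> expr \<Rightarrow> expr" where "AppendE l l' = Loop LCons l' (RevE l) (Var 0)"
definition SumE :: "expr \<Rightarrow> expr \<Rightarrow> expr" where "SumE l b = Loop LAdd (Const CZero) l b"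
definition IotaE :: "expr \<Rightarrow> expr" where "IotaE e = Loop LTails NulE e NulE"
definition EqE :: "expr \<Rightarrow> expr \<Rightarrow> expr" where "EqE a b = AndE (NotE (DropE a b)) (NotE (DropE b a))"

fun ListE :: "expr list \<Rightarrow> expr" where
  "ListE [] = NulE" | "ListE (e # es) = PairE e (ListE es)"

definition enc_nats :: "nat list \<Rightarrow> 'a val" where
  "enc_nats A = enc_list (map enc_nat A)"

definition enc_bool :: "bool \<Rightarrow> 'a val" where
  "enc_bool b = (if b then Pair Null Null else Null)"

definition enc_matrix :: "nat \<Rightarrow> (nat \<Rightarrow> nat \<Rightarrow> 'a val) \<Rightarrow> 'a val" where
  "enc_matrix n f = enc_list (map (\<lambda>x. enc_list (map (f x) [0..<n])) [0..<n])"

lemma to_list_enc_list [simp]: "to_list (enc_list xs) = xs"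
  by (induction xs) auto

lemma enc_list_eq_Null [simp]: "enc_list xs = Null \<longleftrightarrow> xs = []" "Null = enc_list xs \<longleftrightarrow> xs = []"
  by (cases xs; simp)+

lemma length_to_list_enc_nat [simp]: "length (to_list (enc_nat n)) = n"
  by (simp add: enc_nat_def)

lemma enc_nats_eq_Null [simp]: "enc_nats A = Null \<longleftrightarrow> A = []" "Null = enc_nats A \<longleftrightarrow> A = []"
  by (simp_all add: enc_nats_def)

lemma to_list_enc_nats [simp]: "to_list (enc_nats A) = map enc_nat A"
  by (simp add: enc_nats_def)

lemma enc_bool_eq_Null [simp]: "enc_bool b = Null \<longleftrightarrow> \<not> b" "Null = enc_bool b \<longleftrightarrow> \<not> b"
  by (simp_all add: enc_bool_def)

lemma first_enc_nats [simp]: "A \<noteq> [] \<Longrightarrow> first (enc_nats A) = enc_nat (hd A)"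
  by (cases A) (auto simp: enc_nats_def)

lemma second_enc_nats [simp]: "second (enc_nats A) = enc_nats (tl A)"
  by (cases A) (auto simp: enc_nats_def)

lemma Pair_enc_nats [simp]: "Pair (enc_nat x) (enc_nats A) = enc_nats (x # A)"
  by (simp add: enc_nats_def)

lemma foldl_tail: "foldl (\<lambda>a x. second a) v xs = (second ^^ length xs) v"
  by (induction xs arbitrary: v) (simp_all del: funpow.simps add: funpow_Suc_right)

lemma funpow_second_enc_list: "(second ^^ m) (enc_list xs) = enc_list (drop m xs)"
  by (induction m) (auto simp: drop_Suc tl_drop)

lemma foldl_cons: "foldl (\<lambda>a x. Pair (g x) a) (enc_list ys) xs = enc_list (rev (map g xs) @ ys)"
  by (induction xs arbitrary: ys) (auto simp flip: enc_list.simps)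

lemma foldl_filter: "foldl (\<lambda>a x. if g x = Null then a else Pair x a) (enc_list ys) xs =
   enc_list (rev (filter (\<lambda>x. g x \<noteq> Null) xs) @ ys)"
  by (induction xs arbitrary: ys) (auto simp flip: enc_list.simps)

lemma foldl_add: "foldl (\<lambda>a x. lift_op (+) (Atom (g x)) a) (Atom s) xs = Atom ((\<Sum>x\<leftarrow>xs. g x) + s :: 'a :: comm_monoid_add)"
  by (induction xs arbitrary: s) (auto simp: ac_simps)

lemma eval_DropE: "eval (DropE i l) env = (second ^^ length (to_list (eval i env))) (eval l env)"
  by (simp add: DropE_def foldl_tail items_to_list)

lemma eval_DropE_list: "eval i env = enc_nat m \<Longrightarrow> eval l env = enc_list xs \<Longrightarrow> eval (DropE i l) env = enc_list (drop m xs)"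
  by (simp add: eval_DropE funpow_second_enc_list)

lemma eval_NthE: "eval i env = enc_nat m \<Longrightarrow> eval l env = enc_list xs \<Longrightarrow> m < length xs \<Longrightarrow> eval (NthE l i) env = xs ! m"
  by (simp add: NthE_def eval_DropE_list first_drop)

lemma eval_RevE [simp]: "eval (RevE l) env = enc_list (rev (to_list (eval l env)))"
  using foldl_cons[of "\<lambda>x. x" "[]"] by (simp add: RevE_def items_to_list)

lemma eval_MapE [simp]: "eval (MapE l b) env = enc_list (map (\<lambda>x. eval b (x # env)) (to_list (eval l env)))"
  using foldl_cons[of "\<lambda>x. eval b (x # env)" "[]"] by (simp add: MapE_def items_to_list)

lemma eval_FilterE [simp]: "eval (FilterE l b) env = enc_list (filter (\<lambda>x. eval b (x # env) \<noteq> Null) (to_list (eval l env)))"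
  using foldl_filter[of "\<lambda>x. eval b (x # env)" "[]"] by (simp add: FilterE_def items_to_list)

lemma eval_AppendE: "eval l env = enc_list xs \<Longrightarrow> eval l' env = enc_list ys \<Longrightarrow> eval (AppendE l l') env = enc_list (xs @ ys)"
  using foldl_cons[of "\<lambda>x. x" ys "rev xs"] by (simp add: AppendE_def items_to_list)

lemma eval_SumE: 
  assumes "\<And>x. x \<in> set (to_list (eval l env)) \<Longrightarrow> eval b (x # env) = Atom (g x)"
  shows "eval (SumE l b) env = Atom (\<Sum>x\<leftarrow>to_list (eval l env). g x)"
proof -
  have "foldl (\<lambda>a x. lift_op (+) (eval b (x # env)) a) (Atom 0) (to_list (eval l env)) =
    foldl (\<lambda>a x. lift_op (+) (Atom (g x)) a) (Atom 0) (to_list (eval l env))"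
    using assms by (intro foldl_cong) auto
  then show ?thesis by (simp add: SumE_def items_to_list foldl_add)
qed

lemma eval_SumE_nats:
  assumes "eval l env = enc_nats A" "\<And>x. x \<in> set A \<Longrightarrow> eval b (enc_nat x # env) = Atom (g x)"
  shows "eval (SumE l b) env = Atom (\<Sum>x\<leftarrow>A. g x)"
proof -
  have "eval (SumE l b) env = Atom (\<Sum>x\<leftarrow>to_list (eval l env). g (length (to_list x)))"
    by (rule eval_SumE) (use assms in auto)
  then show ?thesis using assms(1) by (simp add: comp_def)
qed

lemma eval_FilterE_nats:
  assumes "eval l env = enc_nats A" "\<And>x. x \<in> set A \<Longrightarrow> eval b (enc_nat x # env) \<noteq> Null \<longleftrightarrow> P x"
  shows "eval (FilterE l b) env = enc_nats (filter P A)"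
  using assms by (simp add: enc_nats_def filter_map comp_def cong: filter_cong)

lemma eval_MapE_nats:
  assumes "eval l env = enc_nats A" "\<And>x. x \<in> set A \<Longrightarrow> eval b (enc_nat x # env) = f x"
  shows "eval (MapE l b) env = enc_list (map f A)"
  using assms by (simp add: comp_def cong: map_cong)

lemma eval_EqE: 
  assumes "eval a env = enc_nat x" "eval b env = enc_nat y"
  shows "eval (EqE a b) env = enc_bool (x = y)"
proof -
  have "eval (DropE a b) env = Null \<longleftrightarrow> y \<le> x" "eval (DropE b a) env = Null \<longleftrightarrow> x \<le> y"
    using assms eval_DropE_list[OF assms(1), of b "replicate y Null"] eval_DropE_list[OF assms(2), of a "replicate x Null"]
    by (simp_all add: enc_nat_def)
  then show ?thesis by (simp add: EqE_def enc_bool_def)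
qed

lemma eval_DropE_eq_Null:
  assumes "eval a env = enc_list xs" "eval b env = enc_list ys"
  shows "eval (DropE a b) env = Null \<longleftrightarrow> length ys \<le> length xs"
  using assms by (simp add: eval_DropE funpow_second_enc_list)

lemma eval_IotaE: 
  assumes "eval e env = enc_nat n"
  shows "eval (IotaE e) env = enc_nats [0..<n]"
proof -
  have "foldl (\<lambda>a x. Pair x a) (enc_nats ys) (items LTails (enc_nat n)) = enc_nats ([0..<n] @ ys)" for ys :: "nat list"
  proof (induction n arbitrary: ys)
    case (Suc n)
    show ?case using Suc[of "n # ys"] by (simp add: enc_nat_def flip: Pair_enc_nats)
  qed (simp add: enc_nat_def)
  from this[of "[]"] show ?thesis using assms by (simp add: IotaE_def enc_nats_def)
qed

lemma eval_enc_matrix: 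
  assumes "eval M env = enc_matrix n f" "eval x env = enc_nat a" "eval y env = enc_nat b" "a < n" "b < n"
  shows "eval (NthE (NthE M x) y) env = f a b"
proof -
  have "eval (NthE M x) env = enc_list (map (f a) [0..<n])"
    using eval_NthE[OF assms(2) assms(1)[unfolded enc_matrix_def]] assms(4) by simp
  from eval_NthE[OF assms(3) this] show ?thesis using assms(5) by simp
qed

definition MatrixE :: "expr \<Rightarrow> expr \<Rightarrow> expr \<Rightarrow> expr" where
  "MatrixE l l' b = MapE l (MapE l' b)"

lemma eval_MatrixE:
  assumes "eval l env = enc_nats [0..<n]" "\<And>x. eval l' (x # env) = enc_nats [0..<n]"
    "\<And>x y. x < n \<Longrightarrow> y < n \<Longrightarrow> eval b (enc_nat y # enc_nat x # env) = f x y"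
  shows "eval (MatrixE l l' b) env = enc_matrix n f"
  unfolding MatrixE_def enc_matrix_def
  by (intro eval_MapE_nats[OF assms(1)] eval_MapE_nats[OF assms(2)] assms(3)) auto


section \<open>Machine states as values\<close>

fun enc_inst :: "nat \<Rightarrow> nat \<Rightarrow> 'a inst \<Rightarrow> 'a val" where
  "enc_inst n k (Inst A B c E T) = enc_list [enc_nats A, enc_nats B, Atom c,
     enc_matrix n (\<lambda>x y. enc_bool (E x y)), enc_matrix n (\<lambda>x y. enc_matrix k (\<lambda>i j. Atom (T x y i j)))]"

text \<open>Items are told apart by shape: \<open>SumMark\<close> is \<open>Null\<close>,
  \<open>ProdMark\<close> is a pair with second component \<open>Null\<close>, and a task is a list
  of five entries, so that its second component is not \<open>Null\<close>.\<close>

fun enc_item :: "nat \<Rightarrow> nat \<Rightarrow> 'a item \<Rightarrow> 'a val" where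
  "enc_item n k (Task I) = enc_inst n k I"
| "enc_item n k SumMark = Null"
| "enc_item n k ProdMark = Pair Null Null"

text \<open>The last two entries are ranges for loops over table indices. Tables keep their full
  dimension \<open>n\<close> when vertices are removed, so vertex names remain valid
  indices.\<close>

fun enc_state :: "nat \<Rightarrow> nat \<Rightarrow> 'a item list \<times> 'a list \<Rightarrow> 'a val list" where
  "enc_state n k (ts, vs) = [enc_list (map (enc_item n k) ts), enc_list (map Atom vs), enc_nats [0..<n], enc_nats [0..<k]]"

text \<open>The argument \<open>d\<close> of the following expressions is the number of local variables bound on top of
  the four components of the state.\<close>

definition vertsE :: "nat \<Rightarrow> expr" where "vertsE d = Var (d + 2)"
definition colsE :: "nat \<Rightarrow> expr" where "colsE d = Var (d + 3)"
definition partE :: "nat \<Rightarrow> nat \<Rightarrow> expr" where "partE i d = FstE ((SndE ^^ i) (FstE (Var d)))"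
definition adjE :: "nat \<Rightarrow> expr \<Rightarrow> expr \<Rightarrow> expr" where "adjE d x y = NthE (NthE (partE 3 d) x) y"
definition tabE :: "nat \<Rightarrow> expr \<Rightarrow> expr \<Rightarrow> expr \<Rightarrow> expr \<Rightarrow> expr" where
  "tabE d x y i j = NthE (NthE (NthE (NthE (partE 4 d) x) y) i) j"
definition nbrsE :: "nat \<Rightarrow> nat \<Rightarrow> expr" where
  "nbrsE d v = FilterE (partE 0 d) (adjE (d + 1) (Var (v + 1)) (Var 0))"
definition frontierE :: "nat \<Rightarrow> expr" where
  "frontierE d = FilterE (partE 1 d) (nbrsE (d + 1) 0)"
definition withoutE :: "nat \<Rightarrow> expr \<Rightarrow> expr" where
  "withoutE v l = FilterE l (NotE (EqE (Var 0) (Var (v + 1))))"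
definition lowE :: "nat \<Rightarrow> expr" where
  "lowE d = FilterE (partE 0 d) (AndE (nbrsE (d + 1) 0) (NotE (SndE (SndE (nbrsE (d + 1) 0)))))"
definition topsE :: "nat \<Rightarrow> expr" where
  "topsE d = FilterE (partE 0 d) (NotE (FilterE (partE 0 (d + 1)) (DropE (nbrsE (d + 2) 1) (nbrsE (d + 2) 0))))"
definition preferredE :: "nat \<Rightarrow> expr" where
  "preferredE d = FilterE (topsE d) (FilterE (nbrsE (d + 1) 0) (DropE (nbrsE (d + 2) 0) (nbrsE (d + 2) 1)))"
definition pickE :: "nat \<Rightarrow> expr" where
  "pickE d = FstE (Ite (preferredE d) (preferredE d) (topsE d))"
definition startE :: "expr \<Rightarrow> expr \<Rightarrow> expr \<Rightarrow> expr \<Rightarrow> expr" where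
  "startE l c e t = ListE [Ite l (PairE (FstE l) NulE) NulE, SndE l, c, e, t]"

text \<open>The state as seen with a task on top: \<open>r\<close> is the rest of the stack of items
  and \<open>w\<close> the stack of values. Below, \<open>drop d env = base ...\<close> says that
  exactly \<open>d\<close> local variables lie above it.\<close>

definition base :: "nat \<Rightarrow> nat \<Rightarrow> 'a inst \<Rightarrow> 'a val \<Rightarrow> 'a val \<Rightarrow> 'a val list" where
  "base n k I r w = [Pair (enc_inst n k I) r, w, enc_nats [0..<n], enc_nats [0..<k]]"

lemma eval_base_Var:
  assumes "drop d env = base n k I r w"
  shows "eval (Var d) env = Pair (enc_inst n k I) r" "eval (Var (Suc d)) env = w"
   "eval (vertsE d) env = enc_nats [0..<n]" "eval (colsE d) env = enc_nats [0..<k]"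
proof -
  have len: "length env = d + 4" using arg_cong[OF assms, of length] by (simp add: base_def)
  have nth: "env ! (d + i) = base n k I r w ! i" for i 
    using assms len by (metis le_add1 nth_drop)
  show "eval (Var d) env = Pair (enc_inst n k I) r" "eval (Var (Suc d)) env = w"
   "eval (vertsE d) env = enc_nats [0..<n]" "eval (colsE d) env = enc_nats [0..<k]"
    using nth[of 0] nth[of 1] nth[of 2] nth[of 3] len
    by (simp_all add: vertsE_def colsE_def base_def)
qed

context
  fixes n k d :: nat and A B and c :: "'a::comm_ring_1" and E T and r w :: "'a val" and env :: "'a val list"
  assumes base: "drop d env = base n k (Inst A B c E T) r w"
begin

lemma base_Suc: "drop (d + 1) (x # env) = base n k (Inst A B c E T) r w"
    "drop (d + 2) (x # y # env) = base n k (Inst A B c E T) r w"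
  using base by auto

lemma eval_partE:
  "eval (partE 0 d) env = enc_nats A"
  "eval (partE (Suc 0) d) env = enc_nats B"
  "eval (partE 2 d) env = Atom c"
  "eval (partE 3 d) env = enc_matrix n (\<lambda>x y. enc_bool (E x y))"
  "eval (partE 4 d) env = enc_matrix n (\<lambda>x y. enc_matrix k (\<lambda>i j. Atom (T x y i j)))"
  by (simp_all add: partE_def eval_base_Var(1)[OF base] numeral_eq_Suc del: eval.simps(1))

lemma eval_adjE:
  "eval x env = enc_nat a \<Longrightarrow> eval y env = enc_nat b \<Longrightarrow> a < n \<Longrightarrow> b < n \<Longrightarrow> eval (adjE d x y) env = enc_bool (E a b)"
  unfolding adjE_def by (rule eval_enc_matrix[OF eval_partE(4)])

lemma eval_tabE:
  "eval x env = enc_nat a \<Longrightarrow> eval y env = enc_nat b \<Longrightarrow> eval i env = enc_nat p \<Longrightarrow> eval j env = enc_nat q \<Longrightarrow>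
   a < n \<Longrightarrow> b < n \<Longrightarrow> p < k \<Longrightarrow> q < k \<Longrightarrow> eval (tabE d x y i j) env = Atom (T a b p q)"
  unfolding tabE_def by (rule eval_enc_matrix[OF eval_enc_matrix[OF eval_partE(5)]])

end

lemma eval_nbrsE:
  assumes "drop d env = base n k (Inst A B c E T) r w" "set A \<subseteq> {..<n}"
    "eval (Var v) env = enc_nat a" "a < n"
  shows "eval (nbrsE d v) env = enc_nats (nbrs E A a)"
  unfolding nbrsE_def nbrs_def
proof (rule eval_FilterE_nats)
  show "eval (partE 0 d) env = enc_nats A" by (rule eval_partE[OF assms(1)])
  fix x assume "x \<in> set A"
  then have "eval (adjE (d + 1) (Var (v + 1)) (Var 0)) (enc_nat x # env) = enc_bool (E a x)"
    using assms by (intro eval_adjE[OF base_Suc(1)[OF assms(1)]]) auto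
  then show "eval (adjE (d + 1) (Var (v + 1)) (Var 0)) (enc_nat x # env) \<noteq> Null \<longleftrightarrow> E a x" by simp
qed

lemma tops_nonempty: 
  assumes "A \<noteq> []"
  shows "tops E A \<noteq> []"
proof -
  let ?f = "\<lambda>v. length (nbrs E A v)"
  have "Max (?f ` set A) \<in> ?f ` set A" using assms by (intro Max_in) auto
  then obtain m where "m \<in> set A" "?f m = Max (?f ` set A)" by auto
  then have "m \<in> set (tops E A)" by (auto simp: tops_def filter_empty_conv not_less)
  then show ?thesis by auto
qed

lemma set_tops: "set (tops E A) \<subseteq> set A"
  by (auto simp: tops_def)

lemma eval_withoutE:
  assumes "eval l env = enc_nats B" "eval (Var v) env = enc_nat y"
  shows "eval (withoutE v l) env = enc_nats (without y B)"
  unfolding withoutE_def without_def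
proof (rule eval_FilterE_nats[OF assms(1)])
  fix x
  have "eval (EqE (Var 0) (Var (v + 1))) (enc_nat x # env) = enc_bool (x = y)"
    by (rule eval_EqE) (use assms in auto)
  then show "eval (NotE (EqE (Var 0) (Var (v + 1)))) (enc_nat x # env) \<noteq> Null \<longleftrightarrow> x \<noteq> y" by simp
qed

lemma eval_startE:
  assumes "eval l env = enc_nats U" "eval c env = Atom c'" "eval e env = enc_matrix n (\<lambda>x y. enc_bool (E x y))"
    "eval t env = enc_matrix n (\<lambda>x y. enc_matrix k (\<lambda>i j. Atom (T x y i j)))"
  shows "eval (startE l c e t) env = enc_inst n k (start U c' E T)"
  using assms by (cases U) (auto simp: startE_def start_def enc_nats_def)

context
  fixes n k d :: nat and A B and c :: "'a::comm_ring_1" and E T and r w :: "'a val" and env :: "'a val list"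
  assumes base: "drop d env = base n k (Inst A B c E T) r w"
    and A: "set A \<subseteq> {..<n}" and B: "set B \<subseteq> {..<n}"
begin

lemma eval_frontierE: "eval (frontierE d) env = enc_nats (frontier E A B)"
  unfolding frontierE_def frontier_def
proof (rule eval_FilterE_nats)
  show "eval (partE 1 d) env = enc_nats B" using eval_partE[OF base] by simp
  fix x assume "x \<in> set B"
  then have "eval (nbrsE (d + 1) 0) (enc_nat x # env) = enc_nats (nbrs E A x)"
    using B by (intro eval_nbrsE[OF base_Suc(1)[OF base] A]) auto
  then show "eval (nbrsE (d + 1) 0) (enc_nat x # env) \<noteq> Null \<longleftrightarrow> nbrs E A x \<noteq> []" by simp
qed

lemma eval_lowE: "eval (lowE d) env = enc_nats (low E A)"
  unfolding lowE_def low_def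
proof (rule eval_FilterE_nats)
  show "eval (partE 0 d) env = enc_nats A" by (rule eval_partE[OF base])
  fix x assume "x \<in> set A"
  then have "eval (nbrsE (d + 1) 0) (enc_nat x # env) = enc_nats (nbrs E A x)"
    using A by (intro eval_nbrsE[OF base_Suc(1)[OF base] A]) auto
  then show "eval (AndE (nbrsE (d + 1) 0) (NotE (SndE (SndE (nbrsE (d + 1) 0))))) (enc_nat x # env) \<noteq> Null
    \<longleftrightarrow> nbrs E A x \<noteq> [] \<and> tl (tl (nbrs E A x)) = []" by simp
qed

lemma eval_degree_less:
  assumes "eval (Var u) (y # x # env) = enc_nat a" "eval (Var v) (y # x # env) = enc_nat b" "a < n" "b < n"
  shows "eval (DropE (nbrsE (d + 2) u) (nbrsE (d + 2) v)) (y # x # env) \<noteq> Null \<longleftrightarrow>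
    length (nbrs E A a) < length (nbrs E A b)"
proof -
  have "eval (nbrsE (d + 2) u) (y # x # env) = enc_nats (nbrs E A a)"
     "eval (nbrsE (d + 2) v) (y # x # env) = enc_nats (nbrs E A b)"
    using assms by (intro eval_nbrsE[OF base_Suc(2)[OF base] A]; simp)+
  from eval_DropE_eq_Null[OF this[unfolded enc_nats_def]] show ?thesis by auto
qed

lemma eval_topsE: "eval (topsE d) env = enc_nats (tops E A)"
  unfolding topsE_def tops_def
proof (rule eval_FilterE_nats)
  show "eval (partE 0 d) env = enc_nats A" by (rule eval_partE[OF base])
  fix x assume x: "x \<in> set A"
  have "eval (FilterE (partE 0 (d + 1)) (DropE (nbrsE (d + 2) 1) (nbrsE (d + 2) 0))) (enc_nat x # env)
     = enc_nats (filter (\<lambda>u. length (nbrs E A x) < length (nbrs E A u)) A)"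
    using x A by (intro eval_FilterE_nats eval_partE[OF base_Suc(1)[OF base]] eval_degree_less) auto
  then show "eval (NotE (FilterE (partE 0 (d + 1)) (DropE (nbrsE (d + 2) 1) (nbrsE (d + 2) 0)))) (enc_nat x # env) \<noteq> Null
    \<longleftrightarrow> filter (\<lambda>u. length (nbrs E A x) < length (nbrs E A u)) A = []" by (simp del: eval_FilterE)
qed

lemma eval_preferredE: "eval (preferredE d) env = enc_nats (preferred E A)"
  unfolding preferredE_def preferred_def
proof (rule eval_FilterE_nats[OF eval_topsE])
  fix x assume x: "x \<in> set (tops E A)"
  then have xA: "x \<in> set A" using set_tops by auto
  have "eval (FilterE (nbrsE (d + 1) 0) (DropE (nbrsE (d + 2) 0) (nbrsE (d + 2) 1))) (enc_nat x # env)
     = enc_nats (filter (\<lambda>w. length (nbrs E A w) < length (nbrs E A x)) (nbrs E A x))"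
    using xA A by (intro eval_FilterE_nats eval_nbrsE[OF base_Suc(1)[OF base] A] eval_degree_less) auto
  then show "eval (FilterE (nbrsE (d + 1) 0) (DropE (nbrsE (d + 2) 0) (nbrsE (d + 2) 1))) (enc_nat x # env) \<noteq> Null
    \<longleftrightarrow> filter (\<lambda>w. length (nbrs E A w) < length (nbrs E A x)) (nbrs E A x) \<noteq> []" by (simp del: eval_FilterE)
qed

lemma eval_pickE: "A \<noteq> [] \<Longrightarrow> eval (pickE d) env = enc_nat (pick E A)"
  using tops_nonempty[of A E] by (simp add: pickE_def pick_def eval_preferredE eval_topsE)

end

section \<open>Expressions for single machine steps\<close>

definition elim_adjE :: expr where
  "elim_adjE = OrE (adjE 5 (Var 1) (Var 0))
     (AndE (NotE (EqE (Var 1) (Var 0))) (AndE (adjE 5 (Var 4) (Var 1)) (adjE 5 (Var 4) (Var 0))))"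

text \<open>The local variables from \<open>Var 0\<close> on are \<open>l\<close>, \<open>j\<close>,
  \<open>i\<close>, \<open>y\<close>, \<open>x\<close>, \<open>b\<close>, \<open>a\<close>,
  \<open>v\<close>, where \<open>l\<close> is the value of \<open>v\<close> summed over. In
  \<open>elim_tabE\<close> the variable \<open>l\<close> is missing, in \<open>elim_adjE\<close>
  also \<open>j\<close> and \<open>i\<close>.\<close>

definition elim_sumE :: expr where
  "elim_sumE = MultE (MultE (tabE 8 (Var 7) (Var 7) (Var 0) (Var 0))
      (MultE (tabE 8 (Var 7) (Var 6) (Var 0) (Var 2)) (tabE 8 (Var 6) (Var 7) (Var 2) (Var 0))))
    (Ite (EqE (Var 6) (Var 5)) (Const COne)
      (MultE (tabE 8 (Var 7) (Var 5) (Var 0) (Var 1)) (tabE 8 (Var 5) (Var 7) (Var 1) (Var 0))))"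

definition elim_tabE :: expr where
  "elim_tabE = Ite (AndE (EqE (Var 3) (Var 5)) (EqE (Var 2) (Var 4)))
     (MultE (tabE 7 (Var 3) (Var 2) (Var 1) (Var 0)) (SumE (colsE 7) elim_sumE))
     (tabE 7 (Var 3) (Var 2) (Var 1) (Var 0))"

definition elimE :: expr where
  "elimE = LetIn (FstE (lowE 0)) (LetIn (FstE (nbrsE 1 0))
     (LetIn (Ite (SndE (nbrsE 2 1)) (FstE (SndE (nbrsE 2 1))) (Var 0))
       (PairE (startE (withoutE 2 (partE 0 3)) (partE 2 3) (MatrixE (vertsE 3) (vertsE 4) elim_adjE)
           (MatrixE (vertsE 3) (vertsE 4) (MatrixE (colsE 5) (colsE 6) elim_tabE))) (SndE (Var 3)))))"

text \<open>The local variables from \<open>Var 0\<close> on are \<open>j\<close>, \<open>i\<close>,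
  \<open>y\<close>, \<open>x\<close>, \<open>l\<close>, \<open>v\<close>.\<close>

definition branch_tabE :: expr where
  "branch_tabE = Ite (EqE (Var 3) (Var 2))
     (MultE (tabE 6 (Var 3) (Var 2) (Var 1) (Var 0))
       (MultE (tabE 6 (Var 5) (Var 3) (Var 4) (Var 1)) (tabE 6 (Var 3) (Var 5) (Var 1) (Var 4))))
     (tabE 6 (Var 3) (Var 2) (Var 1) (Var 0))"

definition branchE :: expr where
  "branchE = LetIn (pickE 0) (AppendE
     (MapE (colsE 1) (startE (withoutE 1 (partE 0 2)) (MultE (partE 2 2) (tabE 2 (Var 1) (Var 1) (Var 0) (Var 0)))
         (partE 3 2) (MatrixE (vertsE 2) (vertsE 3) (MatrixE (colsE 4) (colsE 5) branch_tabE))))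
     (PairE NulE (SndE (Var 1))))"

definition growE :: expr where
  "growE = LetIn (FstE (frontierE 0)) (PairE
     (ListE [PairE (Var 0) (partE 0 1), withoutE 0 (partE 1 1), partE 2 1, partE 3 1, partE 4 1]) (SndE (Var 1)))"

definition splitE :: expr where
  "splitE = PairE (startE (partE 0 0) (partE 2 0) (partE 3 0) (partE 4 0))
    (PairE (startE (partE 1 0) (Const COne) (partE 3 0) (partE 4 0)) (PairE TruE (SndE (Var 0))))"

definition expandE :: expr where
  "expandE = Ite (frontierE 0) growE (Ite (partE 1 0) splitE (Ite (lowE 0) elimE branchE))"

definition stepE :: expr where
  "stepE = Ite (FstE (Var 0))
     (Ite (SndE (FstE (Var 0)))
        (Ite (partE 0 0) (ListE [expandE, Var 1, vertsE 0, colsE 0])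
          (ListE [SndE (Var 0), PairE (partE 2 0) (Var 1), vertsE 0, colsE 0]))
        (ListE [SndE (Var 0), PairE (MultE (FstE (Var 1)) (FstE (SndE (Var 1)))) (SndE (SndE (Var 1))), vertsE 0, colsE 0]))
     (ListE [SndE (Var 0), PairE (SumE (colsE 0) (NthE (Var 2) (Var 0))) (DropE (colsE 0) (Var 1)), vertsE 0, colsE 0])"

context
  fixes n k :: nat and A B and c :: "'a::comm_ring_1" and E T and ts :: "'a item list" and w :: "'a val" and env :: "'a val list"
  assumes env: "env = base n k (Inst A B c E T) (enc_list (map (enc_item n k) ts)) w"
    and small: "small n (Inst A B c E T)"
begin

lemma base_env:
  "drop 0 env = base n k (Inst A B c E T) (enc_list (map (enc_item n k) ts)) w"
  using env by simp

lemma parts_less: "set A \<subseteq> {..<n}" "set B \<subseteq> {..<n}"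
  using small by auto

lemma eval_growE:
  assumes "frontier E A B \<noteq> []"
  shows "eval growE env = enc_list (map (enc_item n k) 
     (Task (Inst (hd (frontier E A B) # A) (without (hd (frontier E A B)) B) c E T) # ts))"
proof -
  let ?y = "hd (frontier E A B)"
  have y: "eval (FstE (frontierE 0)) env = enc_nat ?y"
    using assms by (simp add: eval_frontierE[OF base_env parts_less])
  let ?e = "enc_nat ?y # env"
  have b: "drop 1 ?e = base n k (Inst A B c E T) (enc_list (map (enc_item n k) ts)) w" using env by simp
  have "eval (withoutE 0 (partE 1 1)) ?e = enc_nats (without ?y B)"
    by (rule eval_withoutE) (use eval_partE[OF b] in auto)
  then show ?thesis unfolding growE_def eval.simps(6) y
    using eval_base_Var(1)[OF b] by (simp add: eval_partE[OF b] del: One_nat_def)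
qed

lemma eval_splitE:
  "eval splitE env = enc_list (map (enc_item n k) (Task (start A c E T) # Task (start B 1 E T) # ProdMark # ts))"
proof -
  have "eval (startE (partE 0 0) (partE 2 0) (partE 3 0) (partE 4 0)) env = enc_inst n k (start A c E T)"
     "eval (startE (partE 1 0) (Const COne) (partE 3 0) (partE 4 0)) env = enc_inst n k (start B 1 E T)"
    by (rule eval_startE; simp add: eval_partE[OF base_env])+
  then show ?thesis using eval_base_Var(1)[OF base_env] by (simp add: splitE_def)
qed

lemma eval_elimE:
  assumes "low E A \<noteq> []"
  shows "eval elimE env = enc_list (map (enc_item n k) (Task (eliminate k (hd (low E A)) A c E T) # ts))"
proof -
  define v where "v = hd (low E A)"
  define a where "a = hd (nbrs E A v)"
  define b where "b = snd_nbr (nbrs E A v)"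
  note vab = low_facts[OF assms v_def refl a_def b_def]
  have less: "v < n" "a < n" "b < n" using vab parts_less by auto
  have ne: "nbrs E A v \<noteq> []" using vab(2) set_nbrs[of E A v] by (metis empty_set insert_not_empty)
  let ?base = "base n k (Inst A B c E T) (enc_list (map (enc_item n k) ts)) w"
  have v: "eval (FstE (lowE 0)) env = enc_nat v"
    using assms by (simp add: eval_lowE[OF base_env parts_less] v_def)
  let ?e1 = "enc_nat v # env"
  have e1: "drop 1 ?e1 = ?base" using env by simp
  have "eval (nbrsE 1 0) ?e1 = enc_nats (nbrs E A v)"
    by (rule eval_nbrsE[OF e1 parts_less(1)]) (use less in auto)
  then have a: "eval (FstE (nbrsE 1 0)) ?e1 = enc_nat a" using ne by (simp add: a_def)
  let ?e2 = "enc_nat a # ?e1"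
  have e2: "drop 2 ?e2 = ?base" using env by simp
  have "eval (nbrsE 2 1) ?e2 = enc_nats (nbrs E A v)"
    by (rule eval_nbrsE[OF e2 parts_less(1)]) (use less in auto)
  then have b: "eval (Ite (SndE (nbrsE 2 1)) (FstE (SndE (nbrsE 2 1))) (Var 0)) ?e2 = enc_nat b"
    by (simp add: b_def a_def snd_nbr_def)
  let ?e3 = "enc_nat b # ?e2"
  have e3: "drop 3 ?e3 = ?base" using env by simp
  have drops: "drop 4 (x # ?e3) = ?base" "drop 5 (x # y # ?e3) = ?base" "drop 6 (x # y # z # ?e3) = ?base"
      "drop 7 (x # y # z # u # ?e3) = ?base" "drop 8 (t # x # y # z # u # ?e3) = ?base" for x y z u t
    using env by simp_all
  have adj: "eval (MatrixE (vertsE 3) (vertsE 4) elim_adjE) ?e3 = enc_matrix n (\<lambda>x y. enc_bool (elim_adj v E x y))"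
  proof (rule eval_MatrixE)
    fix x y assume xy: "x < n" "y < n"
    let ?e = "enc_nat y # enc_nat x # ?e3"
    have "eval (adjE 5 (Var 1) (Var 0)) ?e = enc_bool (E x y)"
      "eval (adjE 5 (Var 4) (Var 1)) ?e = enc_bool (E v x)" "eval (adjE 5 (Var 4) (Var 0)) ?e = enc_bool (E v y)"
      by (rule eval_adjE[OF drops(2)]; use xy less in simp)+
    moreover have "eval (EqE (Var 1) (Var 0)) ?e = enc_bool (x = y)" by (rule eval_EqE) auto
    ultimately show "eval elim_adjE ?e = enc_bool (elim_adj v E x y)"
      by (simp add: elim_adjE_def elim_adj_def enc_bool_def)
  qed (use eval_base_Var(3)[OF e3] eval_base_Var(3)[OF drops(1)] in auto)
  have tab: "eval (MatrixE (vertsE 3) (vertsE 4) (MatrixE (colsE 5) (colsE 6) elim_tabE)) ?e3 =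
     enc_matrix n (\<lambda>x y. enc_matrix k (\<lambda>i j. Atom (elim_table k v a b T x y i j)))"
  proof (intro eval_MatrixE)
    fix x y i j assume xy: "x < n" "y < n" "i < k" "j < k"
    let ?e = "enc_nat j # enc_nat i # enc_nat y # enc_nat x # ?e3"
    have "eval (SumE (colsE 7) elim_sumE) ?e = Atom (\<Sum>l\<leftarrow>[0..<k]. T v v l l * (T v a l i * T a v i l) * 
        (if a = b then 1 else T v b l j * T b v j l))"
    proof (rule eval_SumE_nats)
      show "eval (colsE 7) ?e = enc_nats [0..<k]" by (rule eval_base_Var[OF drops(4)])
      fix l assume "l \<in> set [0..<k]"
      then have l: "l < k" by simp
      let ?e' = "enc_nat l # ?e"
      have "eval (tabE 8 (Var 7) (Var 7) (Var 0) (Var 0)) ?e' = Atom (T v v l l)"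
        "eval (tabE 8 (Var 7) (Var 6) (Var 0) (Var 2)) ?e' = Atom (T v a l i)" 
        "eval (tabE 8 (Var 6) (Var 7) (Var 2) (Var 0)) ?e' = Atom (T a v i l)"
        "eval (tabE 8 (Var 7) (Var 5) (Var 0) (Var 1)) ?e' = Atom (T v b l j)" 
        "eval (tabE 8 (Var 5) (Var 7) (Var 1) (Var 0)) ?e' = Atom (T b v j l)"
        by (rule eval_tabE[OF drops(5)]; use xy less l in simp)+
      moreover have "eval (EqE (Var 6) (Var 5)) ?e' = enc_bool (a = b)" by (rule eval_EqE) auto
      ultimately show "eval elim_sumE ?e' = Atom (T v v l l * (T v a l i * T a v i l) * 
        (if a = b then 1 else T v b l j * T b v j l))"
        by (cases "a = b"; auto simp: elim_sumE_def)
    qed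
    moreover have "eval (tabE 7 (Var 3) (Var 2) (Var 1) (Var 0)) ?e = Atom (T x y i j)"
      by (rule eval_tabE[OF drops(4)]; use xy less in simp)
    moreover have "eval (EqE (Var 3) (Var 5)) ?e = enc_bool (x = a)" "eval (EqE (Var 2) (Var 4)) ?e = enc_bool (y = b)"
      by (rule eval_EqE; simp)+
    ultimately show "eval elim_tabE ?e = Atom (elim_table k v a b T x y i j)"
      by (cases "x = a"; cases "y = b"; auto simp: elim_tabE_def elim_table_def interv_sum_list_conv_sum_set_nat atLeast0LessThan)
  qed (use eval_base_Var[OF e3] eval_base_Var[OF drops(1)] eval_base_Var[OF drops(2)] eval_base_Var[OF drops(3)] in auto)
  have "eval (startE (withoutE 2 (partE 0 3)) (partE 2 3) (MatrixE (vertsE 3) (vertsE 4) elim_adjE)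
       (MatrixE (vertsE 3) (vertsE 4) (MatrixE (colsE 5) (colsE 6) elim_tabE))) ?e3 = enc_inst n k (eliminate k v A c E T)"
    unfolding eliminate_def a_def[symmetric] b_def[symmetric]
    by (intro eval_startE eval_withoutE adj tab) (auto simp: eval_partE[OF e3])
  then show ?thesis unfolding elimE_def eval.simps(6) v a b v_def[symmetric]
    using eval_base_Var(1)[OF e3] by simp
qed

lemma eval_branchE:
  assumes "A \<noteq> []"
  shows "eval branchE env = enc_list (map (enc_item n k) (map Task (map (branch (pick E A) A c E T) [0..<k]) @ SumMark # ts))"
proof -
  define v where "v = pick E A"
  let ?base = "base n k (Inst A B c E T) (enc_list (map (enc_item n k) ts)) w"
  have "preferred E A = [] \<or> hd (preferred E A) \<in> set (tops E A)"
    using hd_in_set[of "preferred E A"] by (auto simp: preferred_def)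
  then have "v \<in> set A" unfolding v_def pick_def using tops_nonempty[OF assms, of E] set_tops[of E A] 
    by (auto simp: subset_iff)
  then have less: "v < n" using parts_less by auto
  have v: "eval (pickE 0) env = enc_nat v"
    unfolding v_def by (rule eval_pickE[OF base_env parts_less assms])
  let ?e1 = "enc_nat v # env"
  have e1: "drop 1 ?e1 = ?base" using env by simp
  have "eval (MapE (colsE 1) (startE (withoutE 1 (partE 0 2)) (MultE (partE 2 2) (tabE 2 (Var 1) (Var 1) (Var 0) (Var 0)))
         (partE 3 2) (MatrixE (vertsE 2) (vertsE 3) (MatrixE (colsE 4) (colsE 5) branch_tabE)))) ?e1 =
     enc_list (map (\<lambda>l. enc_inst n k (branch v A c E T l)) [0..<k])"
  proof (rule eval_MapE_nats)
    show "eval (colsE 1) ?e1 = enc_nats [0..<k]" by (rule eval_base_Var[OF e1])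
    fix l assume "l \<in> set [0..<k]"
    then have l: "l < k" by simp
    let ?e2 = "enc_nat l # ?e1"
    have e2: "drop 2 ?e2 = ?base" using env by simp
    have drops: "drop 3 (x # ?e2) = ?base" "drop 4 (x # y # ?e2) = ?base" "drop 5 (x # y # z # ?e2) = ?base"
      "drop 6 (x # y # z # u # ?e2) = ?base" for x y z u
      using env by simp_all
    have tab: "eval (MatrixE (vertsE 2) (vertsE 3) (MatrixE (colsE 4) (colsE 5) branch_tabE)) ?e2 =
       enc_matrix n (\<lambda>x y. enc_matrix k (\<lambda>i j. Atom (branch_table v l T x y i j)))"
    proof (intro eval_MatrixE)
      fix x y i j assume xy: "x < n" "y < n" "i < k" "j < k"
      let ?e = "enc_nat j # enc_nat i # enc_nat y # enc_nat x # ?e2"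
      have "eval (tabE 6 (Var 3) (Var 2) (Var 1) (Var 0)) ?e = Atom (T x y i j)"
        "eval (tabE 6 (Var 5) (Var 3) (Var 4) (Var 1)) ?e = Atom (T v x l i)"
        "eval (tabE 6 (Var 3) (Var 5) (Var 1) (Var 4)) ?e = Atom (T x v i l)"
        by (rule eval_tabE[OF drops(4)]; use xy less l in simp)+
      moreover have "eval (EqE (Var 3) (Var 2)) ?e = enc_bool (x = y)" by (rule eval_EqE) auto
      ultimately show "eval branch_tabE ?e = Atom (branch_table v l T x y i j)"
        by (cases "x = y"; auto simp: branch_tabE_def branch_table_def)
    qed (use eval_base_Var[OF e2] eval_base_Var[OF drops(1)] eval_base_Var[OF drops(2)] eval_base_Var[OF drops(3)] in auto)
    have "eval (tabE 2 (Var 1) (Var 1) (Var 0) (Var 0)) ?e2 = Atom (T v v l l)"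
      by (rule eval_tabE[OF e2]; use less l in simp)
    then show "eval (startE (withoutE 1 (partE 0 2)) (MultE (partE 2 2) (tabE 2 (Var 1) (Var 1) (Var 0) (Var 0)))
         (partE 3 2) (MatrixE (vertsE 2) (vertsE 3) (MatrixE (colsE 4) (colsE 5) branch_tabE))) ?e2 = 
         enc_inst n k (branch v A c E T l)"
      unfolding branch_def
      by (intro eval_startE eval_withoutE tab) (auto simp: eval_partE[OF e2])
  qed
  then have "eval branchE env = enc_list (map (\<lambda>l. enc_inst n k (branch v A c E T l)) [0..<k] @ 
     (Null # map (enc_item n k) ts))"
    unfolding branchE_def eval.simps(6) v
    by (rule eval_AppendE) (use eval_base_Var(1)[OF e1] in simp)
  then show ?thesis by (simp add: v_def comp_def)
qed

lemma eval_expandE: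
  assumes "A \<noteq> []"
  shows "eval expandE env = enc_list (map (enc_item n k) (expand k (Inst A B c E T) @ ts))"
  using eval_growE eval_splitE eval_elimE eval_branchE[OF assms] 
  by (simp add: expandE_def eval_frontierE[OF base_env parts_less] eval_lowE[OF base_env parts_less] eval_partE[OF base_env])

end

lemma eval_stepE:
  assumes "ready k s" "\<forall>I. Task I \<in> set (fst s) \<longrightarrow> small n I"
  shows "eval stepE (enc_state n k s) = enc_list (enc_state n k (mstep k s))"
proof (cases "(k, s)" rule: mstep.cases)
  case (1 k' A B c E T ts vs)
  then have s: "s = (Task (Inst A B c E T) # ts, vs)" by auto
  let ?w = "enc_list (map Atom vs)"
  define env where "env = enc_state n k s"
  have env: "env = base n k (Inst A B c E T) (enc_list (map (enc_item n k) ts)) ?w"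
    by (simp add: s base_def env_def)
  have small: "small n (Inst A B c E T)" using assms(2) s by simp
  note b = base_env[OF env small]
  have "eval stepE env = enc_list (enc_state n k (mstep k s))"
    using eval_expandE[OF env small] eval_base_Var[OF b] 1 
    by (simp add: stepE_def eval_partE[OF b] s del: expand.simps eval.simps(1))
  then show ?thesis by (simp add: env_def)
next
  case (2 k' ts vs)
  then have s: "s = (SumMark # ts, vs)" and k: "k \<le> length vs" using assms(1) by auto
  let ?env = "enc_state n k s"
  have "eval (SumE (colsE 0) (NthE (Var 2) (Var 0))) ?env = Atom (\<Sum>i\<leftarrow>[0..<k]. vs ! i)"
  proof (rule eval_SumE_nats)
    fix i assume "i \<in> set [0..<k]"
    then have "eval (NthE (Var 2) (Var 0)) (enc_nat i # ?env) = map Atom vs ! i"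
      by (intro eval_NthE) (use k s in auto)
    then show "eval (NthE (Var 2) (Var 0)) (enc_nat i # ?env) = Atom (vs ! i)"
      using k \<open>i \<in> _\<close> by simp
  qed (simp add: s colsE_def)
  moreover have "eval (DropE (colsE 0) (Var 1)) ?env = enc_list (map Atom (drop k vs))"
    by (simp add: eval_DropE s colsE_def funpow_second_enc_list drop_map)
  ultimately show ?thesis using 2 by (simp add: stepE_def s vertsE_def colsE_def)
next
  case (3 k' ts vs)
  then have s: "s = (ProdMark # ts, vs)" and "2 \<le> length vs" using assms(1) by auto
  then obtain a b vs' where vs: "vs = a # b # vs'" by (cases vs; cases "tl vs") auto
  show ?thesis using 3 by (simp add: stepE_def s vs vertsE_def colsE_def)
next
  case (4 k' vs)
  then show ?thesis using assms by simp
qed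

section \<open>The initial state\<close>

definition init_adj :: "'a rcsp \<Rightarrow> nat \<Rightarrow> nat \<Rightarrow> bool" where
  "init_adj I x y \<longleftrightarrow> x \<noteq> y \<and> {x, y} \<in> edges I"

text \<open>An edge score is placed on the orientation \<open>x < y\<close> only, because
  \<open>weight\<close> multiplies both orientations. Diagonal entries may ignore \<open>j\<close>,
  since they are read at \<open>i = j\<close> only.\<close>

definition init_table :: "'a::comm_ring_1 rcsp \<Rightarrow> nat \<Rightarrow> nat \<Rightarrow> nat \<Rightarrow> nat \<Rightarrow> 'a" where
  "init_table I x y i j = (if x = y then vertex_score I x i
     else if x < y \<and> {x, y} \<in> edges I then edge_score I x y i j else 1)"

definition init_inst :: "'a::comm_ring_1 rcsp \<Rightarrow> 'a inst" where
  "init_inst I = start [0..<nverts I] (const_score I) (init_adj I) (init_table I)"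

definition inputE :: "nat \<Rightarrow> nat \<Rightarrow> expr" where
  "inputE i d = FstE ((SndE ^^ i) (Var d))"

definition edgeE :: "nat \<Rightarrow> nat \<Rightarrow> nat \<Rightarrow> expr" where
  "edgeE d x y = FilterE (inputE 4 d) (AndE (EqE (FstE (Var 0)) (Var (x + 1))) (EqE (FstE (SndE (Var 0))) (Var (y + 1))))"

text \<open>The input lists an edge in one orientation, so both are searched. The final
  \<open>OrE _ NulE\<close> replaces the list of hits by the canonical truth value.\<close>

definition init_adjE :: expr where
  "init_adjE = OrE (edgeE 4 1 0) (OrE (edgeE 4 0 1) NulE)"

definition init_tableE :: expr where
  "init_tableE = Ite (EqE (Var 3) (Var 2)) (NthE (NthE (inputE 3 6) (Var 3)) (Var 1))
     (Ite (edgeE 6 3 2) (NthE (NthE (FstE (SndE (SndE (FstE (edgeE 6 3 2))))) (Var 1)) (Var 0)) (Const COne))"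

definition initE :: expr where
  "initE = LetIn (IotaE (inputE 0 0)) (LetIn (IotaE (inputE 1 1))
     (ListE [ListE [startE (Var 1) (inputE 2 2) (MatrixE (Var 1) (Var 2) init_adjE)
         (MatrixE (Var 1) (Var 2) (MatrixE (Var 2) (Var 3) init_tableE))], NulE, Var 1, Var 0]))"

lemma set_edge_list: "set (edge_list I) = {(x, y). x < y \<and> y < nverts I \<and> {x, y} \<in> edges I}"
  by (auto simp: edge_list_def)

lemma eval_inputE:
  assumes "eval (Var d) env = enc_rcsp I"
  shows "eval (inputE 0 d) env = enc_nat (nverts I)" "eval (inputE 1 d) env = enc_nat (dom_size I)"
    "eval (inputE 2 d) env = Atom (const_score I)"
    "eval (inputE 3 d) env = enc_list (map (enc_vertex I) [0..<nverts I])"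
    "eval (inputE 4 d) env = enc_list (map (enc_edge I) (edge_list I))"
  using assms by (simp_all add: inputE_def enc_rcsp_def numeral_eq_Suc del: eval.simps(1))

lemma eval_Var_Cons: "eval (Var 0) (v # env) = v" "eval (Var (Suc i)) (v # env) = eval (Var i) env"
  by simp_all

lemma eval_edgeE:
  assumes "eval (Var d) env = enc_rcsp I" "eval (Var x) env = enc_nat a" "eval (Var y) env = enc_nat b"
  shows "eval (edgeE d x y) env = enc_list (map (enc_edge I) (filter (\<lambda>e. e = (a, b)) (edge_list I)))"
proof -
  have "eval (AndE (EqE (FstE (Var 0)) (Var (x + 1))) (EqE (FstE (SndE (Var 0))) (Var (y + 1)))) (enc_edge I e # env) \<noteq> Null
    \<longleftrightarrow> e = (a, b)" for e
  proof -
    have "eval (EqE (FstE (Var 0)) (Var (x + 1))) (enc_edge I e # env) = enc_bool (fst e = a)"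
      "eval (EqE (FstE (SndE (Var 0))) (Var (y + 1))) (enc_edge I e # env) = enc_bool (snd e = b)"
      by (rule eval_EqE; cases e; use assms in \<open>simp add: enc_edge_def eval_Var_Cons del: eval.simps(1)\<close>)+
    then show ?thesis by (cases e) auto
  qed
  then show ?thesis
    using eval_inputE(5)[OF assms(1)] by (simp add: edgeE_def filter_map comp_def)
qed

lemma eval_edgeE':
  assumes "eval (Var d) env = enc_rcsp I" "eval (Var x) env = enc_nat a" "eval (Var y) env = enc_nat b"
  shows "eval (edgeE d x y) env \<noteq> Null \<longleftrightarrow> a < b \<and> b < nverts I \<and> {a, b} \<in> edges I"
    "eval (edgeE d x y) env \<noteq> Null \<Longrightarrow> first (eval (edgeE d x y) env) = enc_edge I (a, b)"
proof -
  let ?F = "filter (\<lambda>e. e = (a, b)) (edge_list I)"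
  have "?F \<noteq> [] \<longleftrightarrow> a < b \<and> b < nverts I \<and> {a, b} \<in> edges I"
    by (auto simp: filter_empty_conv set_edge_list)
  then show "eval (edgeE d x y) env \<noteq> Null \<longleftrightarrow> a < b \<and> b < nverts I \<and> {a, b} \<in> edges I"
    unfolding eval_edgeE[OF assms] by simp
  assume "eval (edgeE d x y) env \<noteq> Null"
  then have "?F \<noteq> []" unfolding eval_edgeE[OF assms] by simp
  then show "first (eval (edgeE d x y) env) = enc_edge I (a, b)"
    unfolding eval_edgeE[OF assms] using hd_filter[of "\<lambda>e. e = (a, b)" "edge_list I"] by (cases ?F) auto
qed

lemma eval_initE:
  "eval initE [enc_rcsp I] = enc_list (enc_state (nverts I) (dom_size I) ([Task (init_inst I)], []))"
proof -
  let ?n = "nverts I" and ?k = "dom_size I" and ?in = "enc_rcsp I"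
  let ?e2 = "[enc_nats [0..<?k], enc_nats [0..<?n], ?in]"
  have N: "eval (IotaE (inputE 0 0)) [?in] = enc_nats [0..<?n]"
    by (rule eval_IotaE, rule eval_inputE) simp
  have K: "eval (IotaE (inputE 1 1)) [enc_nats [0..<?n], ?in] = enc_nats [0..<?k]"
    by (rule eval_IotaE, rule eval_inputE) simp
  have adj: "eval (MatrixE (Var 1) (Var 2) init_adjE) ?e2 = enc_matrix ?n (\<lambda>x y. enc_bool (init_adj I x y))"
  proof (rule eval_MatrixE)
    fix x y assume "x < ?n" "y < ?n"
    let ?e = "enc_nat y # enc_nat x # ?e2"
    have "eval (Var 4) ?e = ?in" by simp
    from eval_edgeE'(1)[OF this, of 1 x 0 y] eval_edgeE'(1)[OF this, of 0 y 1 x]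
    have "eval (edgeE 4 1 0) ?e \<noteq> Null \<longleftrightarrow> x < y \<and> y < ?n \<and> {x, y} \<in> edges I"
      "eval (edgeE 4 0 1) ?e \<noteq> Null \<longleftrightarrow> y < x \<and> x < ?n \<and> {y, x} \<in> edges I" by simp_all
    then show "eval init_adjE ?e = enc_bool (init_adj I x y)"
      using \<open>x < ?n\<close> \<open>y < ?n\<close> by (cases x y rule: linorder_cases; 
        simp add: init_adjE_def init_adj_def enc_bool_def insert_commute)
  qed simp_all
  have tab: "eval (MatrixE (Var 1) (Var 2) (MatrixE (Var 2) (Var 3) init_tableE)) ?e2 =
     enc_matrix ?n (\<lambda>x y. enc_matrix ?k (\<lambda>i j. Atom (init_table I x y i j)))"
  proof (intro eval_MatrixE)
    fix x y i j assume xy: "x < ?n" "y < ?n" "i < ?k" "j < ?k"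
    let ?e = "enc_nat j # enc_nat i # enc_nat y # enc_nat x # ?e2"
    have 6: "eval (Var 6) ?e = ?in" by simp
    have eq: "eval (EqE (Var 3) (Var 2)) ?e = enc_bool (x = y)" by (rule eval_EqE) auto
    have "eval (NthE (inputE 3 6) (Var 3)) ?e = enc_vertex I x"
      using eval_NthE[OF _ eval_inputE(4)[OF 6], of "Var 3" x] xy by simp
    then have "eval (NthE (NthE (inputE 3 6) (Var 3)) (Var 1)) ?e = Atom (vertex_score I x i)"
      using eval_NthE[of "Var 1" ?e i "NthE (inputE 3 6) (Var 3)"] xy by (simp add: enc_vertex_def)
    note v = this
    note edge = eval_edgeE'[OF 6, of 3 x 2 y]
    show "eval init_tableE ?e = Atom (init_table I x y i j)"
    proof (cases "x \<noteq> y \<and> eval (edgeE 6 3 2) ?e \<noteq> Null")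
      case True
      let ?t = "FstE (SndE (SndE (FstE (edgeE 6 3 2))))"
      have "eval ?t ?e = enc_list (map (\<lambda>i. enc_list (map (\<lambda>j. Atom (edge_score I x y i j)) [0..<?k])) [0..<?k])"
        using edge(2) True by (simp add: enc_edge_def)
      then have "eval (NthE ?t (Var 1)) ?e = enc_list (map (\<lambda>j. Atom (edge_score I x y i j)) [0..<?k])"
        using eval_NthE[of "Var 1" ?e i ?t] xy by simp
      then have "eval (NthE (NthE ?t (Var 1)) (Var 0)) ?e = Atom (edge_score I x y i j)"
        using eval_NthE[of "Var 0" ?e j "NthE ?t (Var 1)"] xy by simp
      then show ?thesis using True edge(1) eq by (simp add: init_tableE_def init_table_def)
    next
      case False
      then show ?thesis using v eq edge(1) xy
        by (cases "x = y"; cases "x < y"; simp add: init_tableE_def init_table_def)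
    qed
  qed simp_all
  have "eval (startE (Var 1) (inputE 2 2) (MatrixE (Var 1) (Var 2) init_adjE)
         (MatrixE (Var 1) (Var 2) (MatrixE (Var 2) (Var 3) init_tableE))) ?e2 = enc_inst ?n ?k (init_inst I)"
    unfolding init_inst_def by (rule eval_startE[OF _ eval_inputE(3) adj tab]) simp_all
  then show ?thesis unfolding initE_def eval.simps(6) N K by simp
qed

lemma valid_edge:
  assumes "valid_rcsp I" "e \<in> edges I"
  obtains a b where "a < nverts I" "b < nverts I" "a \<noteq> b" "e = {a, b}"
proof -
  have "\<forall>e\<in>edges I. \<exists>x<nverts I. \<exists>y<nverts I. x \<noteq> y \<and> e = {x, y}"
    using assms(1) unfolding valid_rcsp_def by (rule conjunct1)
  from bspec[OF this assms(2)] show ?thesis using that by blast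
qed

lemma valid_edges_pairs:
  assumes "valid_rcsp I"
  shows "{(x, y). x < y \<and> {x, y} \<in> edges I} \<subseteq> {..<nverts I} \<times> {..<nverts I}"
proof clarify
  fix x y assume "{x, y} \<in> edges I"
  from valid_edge[OF assms this] obtain a b where "a < nverts I" "b < nverts I" "{x, y} = {a, b}" .
  then have "x \<in> {a, b}" "y \<in> {a, b}" by blast+
  then show "x \<in> {..<nverts I} \<and> y \<in> {..<nverts I}"
    using \<open>a < nverts I\<close> \<open>b < nverts I\<close> by auto
qed

lemma card_edges:
  assumes "valid_rcsp I"
  shows "card {(x, y). x < y \<and> {x, y} \<in> edges I} = card (edges I)"
proof (rule bij_betw_same_card[of "\<lambda>(x, y). {x, y}"], rule bij_betwI')
  fix p q assume "p \<in> {(x, y). x < y \<and> {x, y} \<in> edges I}" "q \<in> {(x, y). x < y \<and> {x, y} \<in> edges I}"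
  then show "((case p of (x, y) \<Rightarrow> {x, y}) = (case q of (x, y) \<Rightarrow> {x, y})) = (p = q)"
    by (auto simp: doubleton_eq_iff)
next
  fix e assume e: "e \<in> edges I"
  from valid_edge[OF assms this] obtain x y where "x \<noteq> y" "e = {x, y}" .
  then show "\<exists>p\<in>{(x, y). x < y \<and> {x, y} \<in> edges I}. e = (case p of (x, y) \<Rightarrow> {x, y})"
  proof (cases "x < y")
    case True
    then show ?thesis using e \<open>e = {x, y}\<close> by (intro bexI[of _ "(x, y)"]) auto
  next
    case False
    have "e = {y, x}" using \<open>e = {x, y}\<close> by auto
    then show ?thesis using e False \<open>x \<noteq> y\<close> by (intro bexI[of _ "(y, x)"]) auto
  qed
qed auto

lemma weight_init:
  assumes "valid_rcsp I"
  shows "const_score I * weight {..<nverts I} (init_table I) \<sigma> = score I \<sigma>"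
proof -
  let ?n = "nverts I"
  let ?P = "{(x, y). x < y \<and> {x, y} \<in> edges I}"
  let ?s = "\<lambda>x y. edge_score I x y (\<sigma> x) (\<sigma> y)"
  have "init_table I x y (\<sigma> x) (\<sigma> y) =
    (if x = y then vertex_score I x (\<sigma> x) else 1) * (if (x, y) \<in> ?P then ?s x y else 1)" for x y
    by (auto simp: init_table_def)
  then have "weight {..<?n} (init_table I) \<sigma> = (\<Prod>v<?n. vertex_score I v (\<sigma> v)) * 
     (\<Prod>x<?n. \<Prod>y<?n. if (x, y) \<in> ?P then ?s x y else 1)"
    unfolding weight_def by (simp add: prod.distrib)
  also have "(\<Prod>x<?n. \<Prod>y<?n. if (x, y) \<in> ?P then ?s x y else 1) =
     (\<Prod>p\<in>{..<?n} \<times> {..<?n}. if p \<in> ?P then case p of (x, y) \<Rightarrow> ?s x y else 1)"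
    unfolding prod.cartesian_product by (rule prod.cong[OF refl]) (simp only: split_paired_all case_prod_conv)
  also have "\<dots> = (\<Prod>p\<in>?P. case p of (x, y) \<Rightarrow> ?s x y)"
  proof (rule prod.mono_neutral_cong_right)
    show "\<forall>p\<in>{..<?n} \<times> {..<?n} - ?P. (if p \<in> ?P then case p of (x, y) \<Rightarrow> ?s x y else 1) = 1"
      by (blast intro: if_not_P)
  qed (use valid_edges_pairs[OF assms] in \<open>auto intro: if_P\<close>)
  finally show ?thesis by (simp add: score_def mult.assoc)
qed

lemma init_inst_facts:
  assumes "valid_rcsp I"
  defines "n \<equiv> nverts I" and "k \<equiv> dom_size I"
  shows "small n (init_inst I)" "consistent k (init_inst I)" "zval k (init_inst I) = partition_function I"
    "inst_measure_le (init_inst I) (19/100 * real (card (edges I)) + 3/20)"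
    "length (verts (init_inst I)) = n" "rank (init_inst I) = 3 * n\<^sup>2 + (n - 1) + 1"
proof -
  show "small n (init_inst I)" "length (verts (init_inst I)) = n" "rank (init_inst I) = 3 * n\<^sup>2 + (n - 1) + 1"
    by (auto simp: init_inst_def start_facts n_def)
  show "zval k (init_inst I) = partition_function I"
    unfolding init_inst_def start_facts zsum_def partition_function_def sum_distrib_left
    by (simp add: weight_init[OF assms(1)] n_def k_def atLeast0LessThan)
  show "consistent k (init_inst I)"
    unfolding init_inst_def
    by (rule consistent_start) (auto simp: init_adj_def init_table_def insert_commute)
  have "{(x, y). x \<in> {..<n} \<and> y \<in> {..<n} \<and> x < y \<and> init_adj I x y} = {(x, y). x < y \<and> {x, y} \<in> edges I}"
    using valid_edges_pairs[OF assms(1)] by (auto simp: init_adj_def n_def)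
  then show "inst_measure_le (init_inst I) (19/100 * real (card (edges I)) + 3/20)"
    using measure_le_initial[of "{..<n}" "init_adj I"] card_edges[OF assms(1)]
    unfolding init_inst_def start_facts by (simp add: init_adj_def insert_commute n_def atLeast0LessThan)
qed

section \<open>Complexity\<close>

text \<open>The explicit sequence of states is the form in which \<open>iterate_correct\<close>
  expects a run.\<close>

lemma steps_sequence:
  assumes "steps k P N s t"
  shows "\<exists>f. f 0 = s \<and> f N = t \<and> (\<forall>i\<le>N. P (f i)) \<and> (\<forall>i<N. ready k (f i) \<and> f (Suc i) = mstep k (f i))"
  using assms
proof (induction rule: steps.induct)
  case (steps_refl s)
  then show ?case by (intro exI[of _ "\<lambda>_. s"]) simp
next
  case (steps_step s N t)
  then obtain f where f: "f 0 = mstep k s" "f N = t" "\<forall>i\<le>N. P (f i)" 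
    "\<forall>i<N. ready k (f i) \<and> f (Suc i) = mstep k (f i)" by blast
  let ?g = "\<lambda>i. case i of 0 \<Rightarrow> s | Suc i \<Rightarrow> f i"
  have "P (?g i)" if "i \<le> Suc N" for i using that f(3) steps_step.hyps(1) by (cases i) auto
  moreover have "ready k (?g i) \<and> ?g (Suc i) = mstep k (?g i)" if "i < Suc N" for i
    using that f(1,4) steps_step.hyps(2) by (cases i) auto
  ultimately show ?case using f(2) by (intro exI[of _ ?g]) simp
qed

lemma esz_le: "(\<And>x. x \<in> set xs \<Longrightarrow> val_size x \<le> b) \<Longrightarrow> length xs \<le> l \<Longrightarrow> esz xs \<le> 1 + l * (1 + b)"
proof (induction xs arbitrary: l)
  case (Cons x xs)
  then obtain l' where "l = Suc l'" by (cases l) auto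
  moreover from this have "esz xs \<le> 1 + l' * (1 + b)" using Cons.prems by (intro Cons.IH) auto
  moreover have "val_size x \<le> b" using Cons.prems by simp
  ultimately show ?case by simp
qed simp

section \<open>Sizes of encodings\<close>

lemma val_size_enc_nat [simp]: "val_size (enc_nat m) = 2 * m + 1"
proof -
  have "esz (replicate m (Null :: 'a val)) = 2 * m + 1" by (induction m) auto
  then show ?thesis by (simp add: enc_nat_def)
qed

context
  fixes n k z :: nat
  assumes z: "1 \<le> z" "n \<le> z" "k \<le> z"
begin

lemma z_powers: "1 \<le> z ^ i" "i \<le> j \<Longrightarrow> z ^ i \<le> z ^ j"
  using z(1) by (auto intro: power_increasing)

lemma val_size_enc_nats:
  assumes "\<And>x. x \<in> set A \<Longrightarrow> x \<le> z" "length A \<le> z"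
  shows "val_size (enc_nats A :: 'a val) \<le> 5 * z ^ 2"
proof -
  have "val_size (enc_nats A :: 'a val) \<le> 1 + z * (1 + (2 * z + 1))"
    unfolding enc_nats_def by (rule esz_le) (use assms in auto)
  also have "\<dots> = 1 + 2 * z ^ 1 + 2 * z ^ 2" by (simp add: algebra_simps power2_eq_square)
  finally show ?thesis using z_powers(1)[of 2] z_powers(2)[of 1 2] by simp
qed

lemma val_size_enc_matrix:
  fixes f :: "nat \<Rightarrow> nat \<Rightarrow> 'a val"
  assumes "\<And>x y. x < n' \<Longrightarrow> y < n' \<Longrightarrow> val_size (f x y) \<le> b * z ^ i" "n' \<le> z"
  shows "val_size (enc_matrix n' f) \<le> (4 + b) * z ^ (i + 2)"
proof -
  have "val_size (enc_list (map (f x) [0..<n'])) \<le> 1 + z * (1 + b * z ^ i)" if "x < n'" for x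
    by (rule esz_le) (use assms that in auto)
  then have "val_size (enc_matrix n' f) \<le> 1 + z * (1 + (1 + z * (1 + b * z ^ i)))"
    unfolding enc_matrix_def by (intro esz_le) (use assms in auto)
  also have "\<dots> = 1 + 2 * z ^ 1 + z ^ 2 + b * z ^ (i + 2)"
    by (simp add: algebra_simps power2_eq_square)
  finally show ?thesis
    using z_powers(1)[of "i + 2"] z_powers(2)[of 1 "i + 2"] z_powers(2)[of 2 "i + 2"] unfolding distrib_right by linarith
qed

lemma val_size_enc_matrix_const:
  fixes f :: "nat \<Rightarrow> nat \<Rightarrow> 'a val"
  assumes "\<And>x y. x < n' \<Longrightarrow> y < n' \<Longrightarrow> val_size (f x y) \<le> b" "n' \<le> z"
  shows "val_size (enc_matrix n' f) \<le> (4 + b) * z ^ 2"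
  using val_size_enc_matrix[of n' f b 0] assms by (simp add: power2_eq_square)

lemma val_size_enc_inst:
  assumes "small n I"
  shows "val_size (enc_inst n k I) \<le> 60 * z ^ 4"
proof -
  obtain A B c E T where I: "I = Inst A B c E T" by (cases I)
  have dist: "distinct A" "distinct B" "set A \<subseteq> {..<n}" "set B \<subseteq> {..<n}" using assms I by auto
  have "card (set A) \<le> n" "card (set B) \<le> n"
    using card_mono[OF _ dist(3)] card_mono[OF _ dist(4)] by simp_all
  then have len: "length A \<le> z" "length B \<le> z" using dist z by (simp_all add: distinct_card)
  have A: "val_size (enc_nats A :: 'a val) \<le> 5 * z ^ 2" and B: "val_size (enc_nats B :: 'a val) \<le> 5 * z ^ 2"
    by (rule val_size_enc_nats; use dist len z in force)+
  have E: "val_size (enc_matrix n (\<lambda>x y. enc_bool (E x y)) :: 'a val) \<le> (4 + 3) * z ^ 2"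
    by (rule val_size_enc_matrix_const) (use z in \<open>auto simp: enc_bool_def\<close>)
  have "val_size (enc_matrix k (\<lambda>i j. Atom (T x y i j))) \<le> (4 + 1) * z ^ 2" for x y
    by (rule val_size_enc_matrix_const) (use z in auto)
  then have T: "val_size (enc_matrix n (\<lambda>x y. enc_matrix k (\<lambda>i j. Atom (T x y i j)))) \<le> (4 + (4 + 1)) * z ^ (2 + 2)"
    by (rule val_size_enc_matrix) (use z in auto)
  show ?thesis unfolding I enc_inst.simps enc_list.simps val_size.simps
    using A B E T z_powers(1)[of 4] z_powers(2)[of 2 4] by (simp del: add_mult_distrib)
qed

text \<open>At most \<open>4 * z ^ 2\<close> items, each dominated by its dense table with up to
  \<open>z ^ 4\<close> ring elements.\<close>

lemma esz_enc_state:
  fixes s :: "'a::comm_ring_1 item list \<times> 'a list"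
  assumes "okay n L s" "1 \<le> L" "L \<le> 4 * z ^ 2"
  shows "esz (enc_state n k s) \<le> 400 * z ^ 6"
proof -
  obtain ts vs where s: "s = (ts, vs)" by (cases s)
  have item: "val_size (enc_item n k t) \<le> 60 * z ^ 4" if "t \<in> set ts" for t
  proof (cases t)
    case (Task I)
    then show ?thesis using that assms(1) s val_size_enc_inst[of I] by simp
  qed (use z_powers(1)[of 4] in simp_all)
  have ts: "val_size (enc_list (map (enc_item n k) ts)) \<le> 1 + (4 * z ^ 2) * (1 + 60 * z ^ 4)"
    by (rule esz_le) (use assms s item in auto)
  have vs: "val_size (enc_list (map Atom vs)) \<le> 1 + (4 * z ^ 2) * (1 + 1)"
    by (rule esz_le) (use assms s in auto)
  have nk: "val_size (enc_nats [0..<n] :: 'a val) \<le> 5 * z ^ 2" "val_size (enc_nats [0..<k] :: 'a val) \<le> 5 * z ^ 2"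
    by (rule val_size_enc_nats; use z in auto)+
  have "(4 * z ^ 2) * (1 + 60 * z ^ 4) = 4 * z ^ 2 + 240 * z ^ 6"
    by (simp add: algebra_simps flip: power_add)
  with ts vs nk show ?thesis unfolding s enc_state.simps enc_list.simps val_size.simps
    using z_powers(1)[of 6] z_powers(2)[of 2 6] by simp
qed

lemma length_concat_le: "(\<And>x. x \<in> set xs \<Longrightarrow> length (f x) \<le> b) \<Longrightarrow> length (concat (map f xs)) \<le> length xs * b"
  by (induction xs) (auto intro: add_mono)

lemma val_size_enc_rcsp:
  fixes I :: "'a rcsp"
  assumes "n = nverts I" "k = dom_size I"
  shows "val_size (enc_rcsp I) + 2 \<le> 400 * z ^ 6"
proof -
  have "length (edge_list I) \<le> length [0..<nverts I] * z"
    unfolding edge_list_def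
  proof (rule length_concat_le)
    fix x assume "x \<in> set [0..<nverts I]"
    have "length (concat (map (\<lambda>y. if {x, y} \<in> edges I then [(x, y)] else []) [Suc x..<nverts I])) \<le>
       length [Suc x..<nverts I] * 1" by (rule length_concat_le) simp
    then show "length (concat (map (\<lambda>y. if {x, y} \<in> edges I then [(x, y)] else []) [Suc x..<nverts I])) \<le> z"
      using z assms by simp
  qed
  also have "\<dots> \<le> z ^ 2" using z assms by (simp add: power2_eq_square)
  finally have len: "length (edge_list I) \<le> z ^ 2" .
  have edge: "val_size (enc_edge I e) \<le> 30 * z ^ 2" if "e \<in> set (edge_list I)" for e
  proof -
    obtain x y where e: "e = (x, y)" by (cases e)
    have xy: "x \<le> z" "y \<le> z" using that z assms unfolding e by (auto simp: set_edge_list)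
    have "val_size (enc_matrix k (\<lambda>i j. Atom (edge_score I x y i j))) \<le> (4 + 1) * z ^ 2"
      by (rule val_size_enc_matrix_const) (use z in auto)
    then have "val_size (enc_edge I e) \<le> 7 + 4 * z + 5 * z ^ 2"
      using xy by (simp add: e enc_edge_def enc_matrix_def assms)
    then show ?thesis using z_powers(1)[of 2] z_powers(2)[of 1 2] by simp
  qed
  have edges: "val_size (enc_list (map (enc_edge I) (edge_list I))) \<le> 1 + z ^ 2 * (1 + 30 * z ^ 2)"
    by (rule esz_le) (use len edge in auto)
  have "val_size (enc_vertex I v) \<le> 1 + z * (1 + 1)" for v
    unfolding enc_vertex_def by (rule esz_le) (use z assms in auto)
  then have verts: "val_size (enc_list (map (enc_vertex I) [0..<nverts I])) \<le> 1 + z * (1 + (1 + z * (1 + 1)))"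
    by (intro esz_le) (use z assms in auto)
  from edges have edges': "val_size (enc_list (map (enc_edge I) (edge_list I))) \<le> 1 + z ^ 2 + 30 * z ^ 4"
    by (simp add: algebra_simps power2_eq_square power4_eq_xxxx)
  from verts have verts': "val_size (enc_list (map (enc_vertex I) [0..<nverts I])) \<le> 1 + 2 * z + 2 * z ^ 2"
    by (simp add: algebra_simps power2_eq_square)
  from edges' verts' show ?thesis
    unfolding enc_rcsp_def enc_list.simps val_size.simps
    using z assms z_powers(1)[of 6] z_powers(2)[of 1 6] z_powers(2)[of 2 6] z_powers(2)[of 4 6] by simp
qed

end

theorem theorem7p1:
  "\<exists>(P :: com) (C :: nat) (d :: nat). \<forall>I :: 'a::comm_ring_1 rcsp. valid_rcsp I \<longrightarrow>
     (let n = nverts I; m = card (edges I); k = dom_size I in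
      \<exists>r w t. exec P (init_store (enc_rcsp I)) r w t \<and>
        t 0 = Atom (partition_function I) \<and>
        w \<le> C * (n + m + k) ^ d \<and>
        real r \<le> real (C * (n + m + k) ^ d) * real k powr (19 * real m / 100))"
proof -
  obtain C d where exec: "\<And>v (s :: nat \<Rightarrow> 'a val list) N M. 
     eval initE [v] = enc_list (s 0) \<Longrightarrow> (\<forall>i<N. eval stepE (s i) = enc_list (s (Suc i)) \<and> hd (s i) \<noteq> Null) \<Longrightarrow>
     hd (s N) = Null \<Longrightarrow> (\<forall>i\<le>N. esz (s i) \<le> M \<and> s i \<noteq> []) \<Longrightarrow> val_size v + 2 \<le> M \<Longrightarrow>
     \<exists>r w t. exec (iterate initE stepE) (init_store v) r w t \<and> t 0 = first (first (enc_list (tl (s N)))) \<and>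
       w \<le> C * M ^ d \<and> r \<le> Suc N * (C * M ^ d)"
    using iterate_correct[of initE stepE, where ?'a='a] by blast
  \<comment> \<open>In \<open>?d\<close> the part \<open>6 * d\<close> comes from states of size at
    most \<open>400 * z ^ 6\<close>, and 4 from the bound \<open>6 * z ^ 4\<close> on the polynomial
    factor in the number of steps.\<close>
  let ?P = "iterate initE stepE" and ?C = "6 * (C * 400 ^ d)" and ?d = "6 * d + 4"
  have "\<exists>r w t. exec ?P (init_store (enc_rcsp I)) r w t \<and>
        t 0 = Atom (partition_function I) \<and>
        w \<le> ?C * (nverts I + card (edges I) + dom_size I) ^ ?d \<and>
        real r \<le> real (?C * (nverts I + card (edges I) + dom_size I) ^ ?d) * real (dom_size I) powr (19 * real (card (edges I)) / 100)"
    if valid: "valid_rcsp I" for I :: "'a rcsp"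
  proof -
    define n where "n = nverts I"
    define k where "k = dom_size I"
    define m where "m = card (edges I)"
    define z where "z = n + m + k"
    have k: "1 \<le> k" using valid by (simp add: valid_rcsp_def k_def)
    have z: "1 \<le> z" "n \<le> z" "k \<le> z" using k by (auto simp: z_def)
    note I = init_inst_facts[OF valid, folded n_def k_def m_def]
    define b where "b = 19/100 * real m + 3/20"
    obtain N where N: "solves k n (init_inst I) N (height k n)" "real N \<le> real (3 * n\<^sup>2 + (n - 1) + 1) * real k powr (b + 1)"
      using solve[OF k I(1,2,4)] unfolding I(5,6) b_def by auto
    let ?L = "height k n" and ?M = "400 * z ^ 6"
    have L: "1 \<le> ?L" "?L \<le> 4 * z ^ 2"
    proof -
      have "?L \<le> 1 + z * (z + 2)" unfolding height_def using z by (intro add_mono mult_mono) auto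
      also have "\<dots> = 1 + 2 * z ^ 1 + z ^ 2" by (simp add: power2_eq_square)
      also have "\<dots> \<le> 4 * z ^ 2"
        using power_increasing[of 1 2 z] power_increasing[of 0 2 z] z(1) by simp
      finally show "?L \<le> 4 * z ^ 2" .
    qed (simp add: height_def)
    have "steps k (okay n ?L) N ([Task (init_inst I)], []) ([], [partition_function I])"
      using N(1) unfolding solves_def I(3) by simp
    from steps_sequence[OF this] obtain f where f: "f 0 = ([Task (init_inst I)], [])" "f N = ([], [partition_function I])"
      "\<And>i. i \<le> N \<Longrightarrow> okay n ?L (f i)" "\<And>i. i < N \<Longrightarrow> ready k (f i) \<and> f (Suc i) = mstep k (f i)"
      by blast
    let ?s = "\<lambda>i. enc_state n k (f i)"
    have "\<exists>r w t. exec ?P (init_store (enc_rcsp I)) r w t \<and> t 0 = first (first (enc_list (tl (?s N)))) \<and>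
       w \<le> C * ?M ^ d \<and> r \<le> Suc N * (C * ?M ^ d)"
    proof (rule exec)
      show "eval initE [enc_rcsp I] = enc_list (?s 0)"
        unfolding f(1) n_def k_def by (rule eval_initE)
      show "\<forall>i<N. eval stepE (?s i) = enc_list (?s (Suc i)) \<and> hd (?s i) \<noteq> Null"
      proof (intro allI impI conjI)
        fix i assume i: "i < N"
        have ok: "\<forall>I. Task I \<in> set (fst (f i)) \<longrightarrow> small n I"
          using f(3)[of i] i by (cases "f i") auto
        show "eval stepE (?s i) = enc_list (?s (Suc i))"
          using eval_stepE[OF _ ok] f(4)[OF i] by simp
        have "fst (f i) \<noteq> []" using f(4)[OF i] by (cases "f i"; cases "fst (f i)") auto
        then show "hd (?s i) \<noteq> Null" by (cases "f i") auto
      qed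
      show "hd (?s N) = Null" by (simp add: f(2))
      show "\<forall>i\<le>N. esz (?s i) \<le> ?M \<and> ?s i \<noteq> []"
      proof (intro allI impI conjI)
        fix i assume "i \<le> N"
        then show "esz (?s i) \<le> ?M" by (intro esz_enc_state[OF z f(3) L])
        show "?s i \<noteq> []" by (cases "f i") simp
      qed
      show "val_size (enc_rcsp I) + 2 \<le> ?M"
        by (rule val_size_enc_rcsp[OF z n_def k_def])
    qed
    then obtain r w t where rw: "exec ?P (init_store (enc_rcsp I)) r w t" "t 0 = Atom (partition_function I)"
       "w \<le> C * ?M ^ d" "r \<le> Suc N * (C * ?M ^ d)"
      by (auto simp: f(2))
    have M: "C * ?M ^ d = C * 400 ^ d * z ^ (6 * d)"
      by (simp add: power_mult_distrib flip: power_mult)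
    have zd: "z ^ (6 * d) * z ^ 4 = z ^ ?d" "1 \<le> z ^ 4" using z(1) by (simp_all add: power_add)
    have w: "w \<le> ?C * z ^ ?d"
    proof -
      have "z ^ (6 * d) \<le> z ^ ?d" using z(1) by (intro power_increasing) auto
      then have "C * 400 ^ d * z ^ (6 * d) \<le> C * 400 ^ d * z ^ ?d" by (rule mult_left_mono) simp
      also have "\<dots> \<le> 6 * (C * 400 ^ d * z ^ ?d)" by simp
      finally show ?thesis using rw(3) M by (simp only: mult.assoc)
    qed
    let ?K = "real k powr (19 * real m / 100)"
    have K1: "1 \<le> ?K" using k by (simp add: ge_one_powr_ge_zero)
    \<comment> \<open>23/20 is the bonus 3/20 plus the 1 for components with a single vertex. Since
      \<open>k\<close> is at most \<open>z\<close>, this excess is hidden in the factor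
      \<open>z ^ 2\<close>.\<close>
    have "real k powr (b + 1) = ?K * real k powr (23/20)"
      unfolding b_def by (simp flip: powr_add) (simp add: algebra_simps)
    also have "\<dots> \<le> ?K * real k powr 2"
      using k by (intro mult_left_mono powr_mono) auto
    also have "\<dots> \<le> ?K * real z ^ 2"
      using k z(3) by (intro mult_left_mono) (auto simp: powr_numeral intro!: power_mono)
    finally have pw: "real k powr (b + 1) \<le> ?K * real z ^ 2" .
    have "3 * n\<^sup>2 + (n - 1) + 1 \<le> 5 * z ^ 2"
    proof -
      have "n\<^sup>2 \<le> z ^ 2" using z(2) by (intro power_mono) auto
      moreover have "z \<le> z ^ 2" "1 \<le> z ^ 2" using power_increasing[of 1 2 z] z(1) by auto
      ultimately show ?thesis using z(2) by linarith
    qed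
    then have "real (3 * n\<^sup>2 + (n - 1) + 1) \<le> 5 * real z ^ 2"
      by (metis of_nat_le_iff of_nat_mult of_nat_numeral of_nat_power)
    with N(2) pw have "real N \<le> 5 * real z ^ 2 * (?K * real z ^ 2)"
      by (elim order_trans) (intro mult_mono, auto)
    also have "\<dots> = 5 * real z ^ 4 * ?K" by (simp add: mult_ac flip: power_add)
    finally have "real (Suc N) \<le> 5 * real z ^ 4 * ?K + 1" by simp
    also have "\<dots> \<le> 5 * real z ^ 4 * ?K + real z ^ 4 * ?K"
    proof -
      have "1 \<le> real z ^ 4" using z(1) by simp
      then have "1 * 1 \<le> real z ^ 4 * ?K" using K1 by (intro mult_mono) auto
      then show ?thesis by simp
    qed
    finally have SN: "real (Suc N) \<le> 6 * real z ^ 4 * ?K" by simp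
    have "real r \<le> real (Suc N) * real (C * ?M ^ d)"
      using rw(4) by (metis of_nat_le_iff of_nat_mult)
    also have "\<dots> \<le> (6 * real z ^ 4 * ?K) * real (C * ?M ^ d)"
      by (intro mult_right_mono SN) simp
    also have "\<dots> = real (?C * z ^ ?d) * ?K"
      unfolding M zd(1)[symmetric] by simp
    finally have r: "real r \<le> real (?C * z ^ ?d) * ?K" .
    show ?thesis using rw(1,2) w r unfolding z_def n_def m_def k_def by blast
  qed
  then show ?thesis unfolding Let_def by blast
qed

end
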